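(* The homomorphism $i_{\dot{\mathcal U}}\colon\dot{\mathcal U}\to U_h$ induced by the inclusion $\mathcal U\subset U_h$ is injective.
   Context: Let $\mathcal A=\mathbb Z[v,v^{-1}]$, regarded as a subring of $\mathbb Q[[h]]$ via $v=\exp\frac h2$. $U_h=U_h(sl_2)$ is the $h$-adically complete $\mathbb Q[[h]]$-algebra topologically generated by $H,E,F$ with relations $HE=E(H+2)$, $HF=F(H-2)$, $EF-FE=\frac{K-K^{-1}}{v-v^{-1}}$, where $K=v^H=\exp\frac{hH}{2}$. Put $[i]=\frac{v^i-v^{-i}}{v-v^{-1}}$, $[n]!=[1]\cdots[n]$, $e=(v-v^{-1})E$, $F^{(n)}=F^n/[n]!$. $\mathcal U$ is the $\mathcal A$-subalgebra generated by $K,K^{-1},e$ and $F^{(n)}$ ($n\ge1$); it may be viewed as a subalgebra of $U_h$, or equivalently of the quantized enveloping algebra $U_v(sl_2)$ over $\mathbb Q(v)$ (generated by $K^{\pm1},E,F$ with $KE=v^2EK$, $KF=v^{-2}FK$, $EF-FE=\frac{K-K^{-1}}{v-v^{-1}}$), both sitting compatibly inside $U_h\otimes_{\mathbb Q[[h]]}\mathbb Q((h))$. $\mathcal U_1$ is the two-sided ideal of $\mathcal U$ generated by $e$ and the elements $v^mK-v^{-m}K^{-1}$, $m\in\mathbb Z$ (equivalently, by $v-v^{-1}$, $K-K^{-1}$ and $e$). One has $\mathcal U_1\subset hU_h$. Set $\dot{\mathcal U}=\varprojlim_n\mathcal U/(\mathcal U_1)^n$; since $\mathcal U_1\subset hU_h$,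 the inclusion $\mathcal U\subset U_h$ induces the homomorphism $i_{\dot{\mathcal U}}$, which is an algebra homomorphism over $\dot{\mathcal A}=\varprojlim_n\mathcal A/((v-v^{-1})^n)$. *)

theory Defs
  imports
    "HOL-Library.Poly_Mapping"
    "HOL-Computational_Algebra.Formal_Power_Series"
    "HOL-Algebra.Algebraic_Closure_Type"
    "HOL-Algebra.Generated_Rings"
    "HOL-Algebra.Ideal_Product"
    "HOL-Algebra.QuotRing"
begin

section \<open>Adic completion of a (not necessarily commutative) ring\<close>

primrec ideal_power :: "('a, 'b) ring_scheme \<Rightarrow> 'a set \<Rightarrow> nat \<Rightarrow> 'a set" where
  "ideal_power R I 0 = carrier R"
| "ideal_power R I (Suc n) = ideal_prod R (ideal_power R I n) I"

text \<open>The inverse limit of the quotients \<open>R / I^n\<close>: sequences of cosets \<open>x n\<close> of \<open>I^n\<close> such that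
  the transition map \<open>R / I^(n+1) \<rightarrow> R / I^n\<close>, \<open>C \<mapsto> I^n + C\<close>, sends \<open>x (n+1)\<close> to \<open>x n\<close>.\<close>

definition adic_completion :: "('a, 'b) ring_scheme \<Rightarrow> 'a set \<Rightarrow> (nat \<Rightarrow> 'a set) ring" where
  "adic_completion R I =
    \<lparr> carrier = {x. (\<forall>n. x n \<in> carrier (R Quot ideal_power R I n)) \<and>
                    (\<forall>n. ideal_power R I n <+>\<^bsub>R\<^esub> x (Suc n) = x n)},
      monoid.mult = (\<lambda>x y n. x n \<otimes>\<^bsub>R Quot ideal_power R I n\<^esub> y n),
      monoid.one = (\<lambda>n. \<one>\<^bsub>R Quot ideal_power R I n\<^esub>),
      ring.zero = (\<lambda>n. \<zero>\<^bsub>R Quot ideal_power R I n\<^esub>),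
      ring.add = (\<lambda>x y n. x n \<oplus>\<^bsub>R Quot ideal_power R I n\<^esub> y n) \<rparr>"

section \<open>The completed free algebra on H, E, F\<close>

datatype gen = GenH | GenE | GenF

text \<open>The free monoid on the generators. It is written additively because the convolution product
  on \<open>poly_mapping\<close> requires an additive monoid of exponents; \<open>word \<Rightarrow>\<^sub>0 rat\<close> is thus the free
  associative unital rational algebra on three generators.\<close>

datatype word = Word "gen list"

instantiation word :: monoid_add
begin

definition zero_word :: word where
  "zero_word = Word []"

fun plus_word :: "word \<Rightarrow> word \<Rightarrow> word" where
  "plus_word (Word xs) (Word ys) = Word (xs @ ys)"

instance
proof
  fix a b c :: word
  show "a + b + c = a + (b + c)" by (cases a; cases b; cases c) simp
  show "0 + a = a" by (cases a) (simp add: zero_word_def)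
  show "a + 0 = a" by (cases a) (simp add: zero_word_def)
qed

end

type_synonym free_alg = "word \<Rightarrow>\<^sub>0 rat"

definition gen_elem :: "gen \<Rightarrow> free_alg" where
  "gen_elem g = Poly_Mapping.single (Word [g]) 1"

text \<open>The formal variable \<open>fps_X\<close> plays the role of \<open>h\<close>: \<open>rat fps\<close> is the base ring of power series
  in \<open>h\<close>, and \<open>free_alg fps\<close> is the \<open>h\<close>-adically complete algebra topologically freely generated by
  H, E, F.\<close>

definition scalar :: "rat fps \<Rightarrow> free_alg fps" where
  "scalar f = Abs_fps (\<lambda>n. Poly_Mapping.single 0 (fps_nth f n))"

definition free_H :: "free_alg fps" where "free_H = fps_const (gen_elem GenH)"
definition free_E :: "free_alg fps" where "free_E = fps_const (gen_elem GenE)"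
definition free_F :: "free_alg fps" where "free_F = fps_const (gen_elem GenF)"

text \<open>\<open>exp (c h H)\<close>\<close>

definition exp_hH :: "rat \<Rightarrow> free_alg fps" where
  "exp_hH c = Abs_fps (\<lambda>n. Poly_Mapping.single 0 (c ^ n / fact n) * gen_elem GenH ^ n)"

definition free_K :: "free_alg fps" where "free_K = exp_hH (1/2)"
definition free_K_inv :: "free_alg fps" where "free_K_inv = exp_hH (- 1/2)"

section \<open>The parameter v and quantum integers\<close>

definition v :: "rat fps" where "v = fps_exp (1/2)"

definition qint :: "nat \<Rightarrow> rat fps" where
  "qint i = (v ^ i - inverse v ^ i) / (v - inverse v)"

definition qfact :: "nat \<Rightarrow> rat fps" where
  "qfact n = (\<Prod>i=1..n. qint i)"

text \<open>The ring of Laurent polynomials in \<open>v\<close>, as a subring of the ring of power series.\<close>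

definition laurent_v :: "rat fps set" where
  "laurent_v = generate_ring ring_of_type_algebra {v, inverse v}"

text \<open>\<open>(K - K\<^sup>-\<^sup>1) / (v - v\<^sup>-\<^sup>1)\<close>: numerator and denominator are both divided by \<open>h\<close>, after which the
  denominator is an invertible power series.\<close>

definition free_K_quot :: "free_alg fps" where
  "free_K_quot = scalar (inverse (fps_shift 1 (v - inverse v))) * fps_shift 1 (free_K - free_K_inv)"

section \<open>The h-adic quantized enveloping algebra of sl2\<close>

definition free_ring :: "free_alg fps ring" where
  "free_ring = ring_of_type_algebra"

definition Uh_relations :: "free_alg fps set" where
  "Uh_relations =
    {free_H * free_E - free_E * (free_H + 2),
     free_H * free_F - free_F * (free_H - 2),
     free_E * free_F - free_F * free_E - free_K_quot}"

text \<open>The \<open>h\<close>-adic closure of the two-sided ideal generated by the relations.\<close>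

definition Uh_ideal :: "free_alg fps set" where
  "Uh_ideal = {x. \<forall>n. \<exists>y \<in> genideal free_ring Uh_relations. \<forall>k<n. fps_nth x k = fps_nth y k}"

definition Uh :: "free_alg fps set ring" where
  "Uh = free_ring Quot Uh_ideal"

definition to_Uh :: "free_alg fps \<Rightarrow> free_alg fps set" where
  "to_Uh x = Uh_ideal +>\<^bsub>free_ring\<^esub> x"

text \<open>The ideal \<open>h^n U\<^sub>h\<close>.\<close>

definition h_power_Uh :: "nat \<Rightarrow> free_alg fps set set" where
  "h_power_Uh n = {to_Uh (fps_X ^ n) \<otimes>\<^bsub>Uh\<^esub> y | y. y \<in> carrier Uh}"

section \<open>The integral form and its completion\<close>

definition U_gens :: "free_alg fps set set" where
  "U_gens = to_Uh ` ({free_K, free_K_inv, scalar (v - inverse v) * free_E} \<union>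
     {scalar (inverse (qfact n)) * free_F ^ n | n. n \<ge> 1})"

text \<open>The subalgebra over \<open>laurent_v\<close> generated by a set is the subring generated by that set
  together with the scalars in \<open>laurent_v\<close>.\<close>

definition U :: "free_alg fps set ring" where
  "U = Uh \<lparr> carrier := generate_ring Uh (to_Uh ` scalar ` laurent_v \<union> U_gens) \<rparr>"

definition U1_gens :: "free_alg fps set set" where
  "U1_gens = to_Uh `
     (insert (scalar (v - inverse v) * free_E)
       {scalar (v powi m) * free_K - scalar (v powi (- m)) * free_K_inv | m :: int. True})"

definition U1 :: "free_alg fps set set" where
  "U1 = genideal U U1_gens"

definition dotU :: "(nat \<Rightarrow> free_alg fps set set) ring" where
  "dotU = adic_completion U U1"

text \<open>The map from \<open>dotU = lim U / U1^n\<close> to \<open>U\<^sub>h = lim U\<^sub>h / h^n U\<^sub>h\<close> induced by the inclusion of \<open>U\<close>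
  into \<open>U\<^sub>h\<close>: the image \<open>y\<close> of \<open>x\<close> is determined by the condition that, for each \<open>n\<close>, the map
  \<open>U / U1^n \<rightarrow> U\<^sub>h / h^n U\<^sub>h\<close>, \<open>C \<mapsto> h^n U\<^sub>h + C\<close>, sends \<open>x n\<close> to the class of \<open>y\<close>.\<close>

definition i_dotU :: "(nat \<Rightarrow> free_alg fps set set) \<Rightarrow> free_alg fps set" where
  "i_dotU x = (THE y. y \<in> carrier Uh \<and>
     (\<forall>n. h_power_Uh n <+>\<^bsub>Uh\<^esub> x n = h_power_Uh n +>\<^bsub>Uh\<^esub> y))"

section \<open>Well-definedness of the induced map\<close>

text \<open>The rest of this theory justifies the definite description in \<open>i_dotU\<close>: \<open>U1^n\<close> is contained in
  \<open>h^n U\<^sub>h\<close>, and \<open>U\<^sub>h\<close> is \<open>h\<close>-adically separated and complete, so that the described element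
  exists and is unique (\<open>i_dotU\<close>), and the resulting map is a homomorphism (\<open>i_dotU_hom\<close>).\<close>

lemma single_sum_aux: "Poly_Mapping.single k (sum f A) = (\<Sum>x\<in>A. Poly_Mapping.single k (f x))"
  by (induction A rule: infinite_finite_induct) (simp_all add: single_add)

lemma scalar_mult: "scalar (f * g) = scalar f * scalar g"
  by (rule fps_ext) (simp add: scalar_def fps_mult_nth mult_single single_sum_aux)

lemma scalar_1: "scalar 1 = 1"
  by (rule fps_ext) (simp add: scalar_def)

lemma scalar_add: "scalar (f + g) = scalar f + scalar g"
  by (rule fps_ext) (simp add: scalar_def single_add)

lemma scalar_X: "scalar fps_X = fps_X"
  by (rule fps_ext) (simp add: scalar_def fps_X_def)

lemma X_times_shift: "fps_nth f 0 = 0 \<Longrightarrow> fps_X * fps_shift 1 f = f"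
  for f :: "'a :: ring_1 fps"
  by (rule fps_ext) (auto simp: fps_mult_fps_X_plus_1_nth not_gr0)

lemma v_nth: "fps_nth v n = (1/2) ^ n / fact n" "fps_nth (inverse v) n = (-1/2) ^ n / fact n"
  by (simp_all add: v_def flip: fps_exp_neg)

text \<open>The defining property of \<open>(K - K\<^sup>-\<^sup>1) / (v - v\<^sup>-\<^sup>1)\<close>.\<close>

lemma free_K_quot: "scalar (v - inverse v) * free_K_quot = free_K - free_K_inv"
proof -
  have 1: "fps_X * fps_shift 1 (v - inverse v) = v - inverse v"
    by (rule X_times_shift) (simp add: v_nth)
  have 2: "fps_X * fps_shift 1 (free_K - free_K_inv) = free_K - free_K_inv"
    by (rule X_times_shift) (simp add: free_K_def free_K_inv_def exp_hH_def)
  have 3: "fps_shift 1 (v - inverse v) * inverse (fps_shift 1 (v - inverse v)) = 1"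
    by (rule inverse_mult_eq_1') (simp add: v_nth)
  have "scalar (v - inverse v) * free_K_quot =
      scalar (fps_X * (fps_shift 1 (v - inverse v) * inverse (fps_shift 1 (v - inverse v))))
        * fps_shift 1 (free_K - free_K_inv)"
    unfolding free_K_quot_def by (simp only: mult.assoc[symmetric] scalar_mult[symmetric] 1)
  also have "\<dots> = free_K - free_K_inv"
    by (simp only: 3 scalar_X mult_1_right 2)
  finally show ?thesis .
qed

lemma free_ring_simps [simp]:
  "carrier free_ring = UNIV"
  "x \<otimes>\<^bsub>free_ring\<^esub> y = x * y"
  "x \<oplus>\<^bsub>free_ring\<^esub> y = x + y"
  "\<one>\<^bsub>free_ring\<^esub> = 1"
  "\<zero>\<^bsub>free_ring\<^esub> = 0"
  by (simp_all add: free_ring_def ring_of_type_algebra_def)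

interpretation free: ring free_ring
proof (rule ringI)
  show "abelian_group free_ring"
    by (rule abelian_groupI) (auto simp: algebra_simps intro: exI[of _ "- _"] ab_left_minus)
  show "Group.monoid free_ring"
    by (rule monoidI) (auto simp: algebra_simps)
qed (auto simp: algebra_simps)

lemma free_a_inv [simp]: "\<ominus>\<^bsub>free_ring\<^esub> x = - x"
  by (rule free.minus_equality) auto

lemma free_a_minus [simp]: "x \<ominus>\<^bsub>free_ring\<^esub> y = x - y"
  by (simp add: a_minus_def)

lemma Idl_ideal: "ideal (genideal free_ring Uh_relations) free_ring"
  by (rule free.genideal_ideal) simp

lemma Uh_ideal_ideal: "ideal Uh_ideal free_ring"
proof (rule idealI)
  interpret I: ideal "genideal free_ring Uh_relations" free_ring by (rule Idl_ideal)
  show "ring free_ring" by (rule free.ring_axioms)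
  show "subgroup Uh_ideal (add_monoid free_ring)"
  proof (rule free.add.subgroupI)
    show "Uh_ideal \<noteq> {}"
      using I.zero_closed by (auto simp: Uh_ideal_def)
    fix a assume a: "a \<in> Uh_ideal"
    have "\<exists>y \<in> genideal free_ring Uh_relations. \<forall>k<n. fps_nth (-a) k = fps_nth y k" for n
    proof -
      obtain y where y: "y \<in> genideal free_ring Uh_relations" "\<forall>k<n. fps_nth a k = fps_nth y k"
        using a by (auto simp: Uh_ideal_def)
      then show ?thesis using I.a_inv_closed[OF y(1)] by (intro bexI[of _ "-y"]) auto
    qed
    then show "\<ominus>\<^bsub>free_ring\<^esub> a \<in> Uh_ideal" by (auto simp: Uh_ideal_def)
    fix b assume b: "b \<in> Uh_ideal"
    have "\<exists>y \<in> genideal free_ring Uh_relations. \<forall>k<n. fps_nth (a + b) k = fps_nth y k" for n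
    proof -
      obtain y where y: "y \<in> genideal free_ring Uh_relations" "\<forall>k<n. fps_nth a k = fps_nth y k"
        using a by (auto simp: Uh_ideal_def)
      obtain z where z: "z \<in> genideal free_ring Uh_relations" "\<forall>k<n. fps_nth b k = fps_nth z k"
        using b by (auto simp: Uh_ideal_def)
      show ?thesis using I.a_closed[OF y(1) z(1)] y z by (intro bexI[of _ "y+z"]) auto
    qed
    then show "a \<oplus>\<^bsub>free_ring\<^esub> b \<in> Uh_ideal" by (auto simp: Uh_ideal_def)
  qed auto
  fix a x assume a: "a \<in> Uh_ideal"
  have "\<exists>y \<in> genideal free_ring Uh_relations. \<forall>k<n. fps_nth (x * a) k = fps_nth y k"
       "\<exists>y \<in> genideal free_ring Uh_relations. \<forall>k<n. fps_nth (a * x) k = fps_nth y k" for n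
  proof -
    obtain y where y: "y \<in> genideal free_ring Uh_relations" "\<forall>k<n. fps_nth a k = fps_nth y k"
      using a by (auto simp: Uh_ideal_def)
    show "\<exists>y \<in> genideal free_ring Uh_relations. \<forall>k<n. fps_nth (x * a) k = fps_nth y k"
      using I.I_l_closed[OF y(1), of x] y
      by (intro bexI[of _ "x * y"]) (auto simp: fps_mult_nth intro!: sum.cong)
    show "\<exists>y \<in> genideal free_ring Uh_relations. \<forall>k<n. fps_nth (a * x) k = fps_nth y k"
      using I.I_r_closed[OF y(1), of x] y
      by (intro bexI[of _ "y * x"]) (auto simp: fps_mult_nth intro!: sum.cong)
  qed
  then show "x \<otimes>\<^bsub>free_ring\<^esub> a \<in> Uh_ideal" "a \<otimes>\<^bsub>free_ring\<^esub> x \<in> Uh_ideal" 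
    by (auto simp: Uh_ideal_def)
qed

interpretation Uh: ring Uh
  unfolding Uh_def by (rule ideal.quotient_is_ring[OF Uh_ideal_ideal])

lemma to_Uh_hom: "to_Uh \<in> ring_hom free_ring Uh"
proof -
  have "to_Uh = (+>\<^bsub>free_ring\<^esub>) Uh_ideal" by (auto simp: to_Uh_def)
  then show ?thesis unfolding Uh_def using ideal.rcos_ring_hom[OF Uh_ideal_ideal] by simp
qed

lemma to_Uh_closed [simp, intro]: "to_Uh x \<in> carrier Uh"
  using ring_hom_closed[OF to_Uh_hom, of x] by simp
lemma to_Uh_add: "to_Uh (x + y) = to_Uh x \<oplus>\<^bsub>Uh\<^esub> to_Uh y"
  using ring_hom_add[OF to_Uh_hom, of x y] by simp
lemma to_Uh_mult: "to_Uh (x * y) = to_Uh x \<otimes>\<^bsub>Uh\<^esub> to_Uh y"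
  using ring_hom_mult[OF to_Uh_hom, of x y] by simp
lemma to_Uh_1: "to_Uh 1 = \<one>\<^bsub>Uh\<^esub>"
  using ring_hom_one[OF to_Uh_hom] by simp
lemma to_Uh_0: "to_Uh 0 = \<zero>\<^bsub>Uh\<^esub>"
  using to_Uh_add[of 0 0] by (metis Uh.add.l_cancel_one' add_0 to_Uh_closed)
lemma to_Uh_uminus: "to_Uh (- x) = \<ominus>\<^bsub>Uh\<^esub> to_Uh x"
  by (rule Uh.minus_equality[symmetric]) (simp_all flip: to_Uh_add to_Uh_0)
lemma to_Uh_diff: "to_Uh (x - y) = to_Uh x \<ominus>\<^bsub>Uh\<^esub> to_Uh y"
  using to_Uh_add[of x "-y"] by (simp add: to_Uh_uminus a_minus_def)

lemma carrier_Uh: "carrier Uh = range to_Uh"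
  by (auto simp: Uh_def FactRing_def A_RCOSETS_defs to_Uh_def a_r_coset_def r_coset_def)

lemma to_Uh_eq_iff: "to_Uh x = to_Uh y \<longleftrightarrow> x - y \<in> Uh_ideal"
  using free.quotient_eq_iff_same_a_r_cos[OF Uh_ideal_ideal, of x y] by (simp add: to_Uh_def)

lemma h_power_Uh_eq: "h_power_Uh n = {to_Uh (fps_X ^ n * z) | z. True}"
  by (auto simp: h_power_Uh_def carrier_Uh to_Uh_mult)

lemma fps_X_power_comm: "(fps_X :: free_alg fps) ^ n * z = z * fps_X ^ n"
  by (simp add: fps_eq_iff fps_X_power_mult_nth fps_X_power_mult_right_nth)

lemma h_power_ideal: "ideal (h_power_Uh n) Uh"
proof (rule idealI)
  show "ring Uh" by (rule Uh.ring_axioms)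
  show "subgroup (h_power_Uh n) (add_monoid Uh)"
  proof (rule Uh.add.subgroupI)
    fix a b assume "a \<in> h_power_Uh n" "b \<in> h_power_Uh n"
    then obtain z w where *: "a = to_Uh (fps_X ^ n * z)" "b = to_Uh (fps_X ^ n * w)"
      by (auto simp: h_power_Uh_eq)
    have "\<ominus>\<^bsub>Uh\<^esub> a = to_Uh (fps_X ^ n * (-z))" "a \<oplus>\<^bsub>Uh\<^esub> b = to_Uh (fps_X ^ n * (z + w))"
      by (simp_all add: * to_Uh_uminus to_Uh_add distrib_left)
    then show "\<ominus>\<^bsub>Uh\<^esub> a \<in> h_power_Uh n" "a \<oplus>\<^bsub>Uh\<^esub> b \<in> h_power_Uh n"
      unfolding h_power_Uh_eq by blast+
  qed (auto simp: h_power_Uh_eq)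
  fix a x assume "a \<in> h_power_Uh n" "x \<in> carrier Uh"
  then obtain z w where *: "a = to_Uh (fps_X ^ n * z)" "x = to_Uh w"
    by (auto simp: h_power_Uh_eq carrier_Uh)
  have "a \<otimes>\<^bsub>Uh\<^esub> x = to_Uh (fps_X ^ n * (z * w))" 
    by (simp add: * to_Uh_mult[symmetric] mult.assoc)
  moreover have "x \<otimes>\<^bsub>Uh\<^esub> a = to_Uh (fps_X ^ n * (w * z))" 
    by (metis * to_Uh_mult mult.assoc fps_X_power_comm)
  ultimately show "x \<otimes>\<^bsub>Uh\<^esub> a \<in> h_power_Uh n" "a \<otimes>\<^bsub>Uh\<^esub> x \<in> h_power_Uh n"
    unfolding h_power_Uh_eq by blast+
qed

lemma Uh_separated:
  assumes "a \<in> carrier Uh" "\<And>n. a \<in> h_power_Uh n"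
  shows "a = \<zero>\<^bsub>Uh\<^esub>"
proof -
  obtain x where x: "a = to_Uh x" using assms by (auto simp: carrier_Uh)
  have "\<exists>y \<in> genideal free_ring Uh_relations. \<forall>k<n. fps_nth x k = fps_nth y k" for n
  proof -
    obtain z where "to_Uh x = to_Uh (fps_X ^ n * z)"
      using assms(2)[of n] by (auto simp: x h_power_Uh_eq)
    then have "x - fps_X ^ n * z \<in> Uh_ideal" by (simp add: to_Uh_eq_iff)
    then obtain y where y: "y \<in> genideal free_ring Uh_relations"
        "\<forall>k<n. fps_nth (x - fps_X ^ n * z) k = fps_nth y k" by (auto simp: Uh_ideal_def)
    then show ?thesis by (intro bexI[of _ y]) (auto simp: fps_X_power_mult_nth)
  qed
  then have "x \<in> Uh_ideal" by (auto simp: Uh_ideal_def)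
  then show ?thesis using to_Uh_eq_iff[of x 0] by (simp add: x to_Uh_0)
qed

lemma Uh_complete:
  assumes u: "\<And>n. u n \<in> carrier Uh" and step: "\<And>n. u (Suc n) \<ominus>\<^bsub>Uh\<^esub> u n \<in> h_power_Uh n"
  shows "\<exists>y \<in> carrier Uh. \<forall>n. u n \<ominus>\<^bsub>Uh\<^esub> y \<in> h_power_Uh n"
proof -
  interpret J: ideal Uh_ideal free_ring by (rule Uh_ideal_ideal)
  have "\<exists>x. u n = to_Uh x" for n using u[of n] by (auto simp: carrier_Uh)
  then obtain c where c: "\<And>n. u n = to_Uh (c n)" by metis
  have "\<exists>d. to_Uh (c (Suc n) - c n) = to_Uh (fps_X ^ n * d)" for n
    using step[of n] by (auto simp: c h_power_Uh_eq to_Uh_diff)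
  then obtain d where d: "\<And>n. to_Uh (c (Suc n) - c n) = to_Uh (fps_X ^ n * d n)" by metis
  define T where "T n = Abs_fps (\<lambda>k. \<Sum>m\<le>k. fps_nth (d (n + m)) (k - m))" for n
  have T: "T n = d n + fps_X * T (Suc n)" for n
  proof (rule fps_ext)
    fix k show "fps_nth (T n) k = fps_nth (d n + fps_X * T (Suc n)) k"
      by (cases k) (simp_all add: T_def sum.atMost_Suc_shift del: sum.atMost_Suc)
  qed
  define y where "y = c 0 + T 0"
  have y: "y - c n - fps_X ^ n * T n \<in> Uh_ideal" for n
  proof (induction n)
    case 0
    show ?case using J.zero_closed by (simp add: y_def)
  next
    case (Suc n)
    have "c (Suc n) - c n - fps_X ^ n * d n \<in> Uh_ideal"
      using d[of n] by (simp add: to_Uh_eq_iff)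
    moreover have "p - q \<in> Uh_ideal" if "p \<in> Uh_ideal" "q \<in> Uh_ideal" for p q
      using J.a_closed[OF that(1) J.a_inv_closed[OF that(2)]] by simp
    ultimately have 1: "(y - c n - fps_X ^ n * T n) - (c (Suc n) - c n - fps_X ^ n * d n) \<in> Uh_ideal"
      using Suc by blast
    have "fps_X ^ n * T n = fps_X ^ n * d n + fps_X ^ Suc n * T (Suc n)"
      by (subst T[of n]) (simp only: distrib_left mult.assoc power_Suc2)
    then have 2: "(y - c n - fps_X ^ n * T n) - (c (Suc n) - c n - fps_X ^ n * d n)
      = y - c (Suc n) - fps_X ^ Suc n * T (Suc n)"
      by simp
    show ?case using 1 by (simp only: 2)
  qed
  have "u n \<ominus>\<^bsub>Uh\<^esub> to_Uh y \<in> h_power_Uh n" for n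
  proof -
    have "to_Uh (y - c n) = to_Uh (fps_X ^ n * T n)"
      using y[of n] by (simp add: to_Uh_eq_iff)
    then have "to_Uh (c n - y) = to_Uh (fps_X ^ n * (- T n))"
      by (metis minus_diff_eq mult_minus_right to_Uh_uminus)
    then show ?thesis unfolding h_power_Uh_eq c to_Uh_diff[symmetric] by blast
  qed
  then show ?thesis by blast
qed

lemma divisible_by_X: "\<exists>g. f = fps_X * g" if "fps_nth f 0 = 0" for f :: "'a :: ring_1 fps"
  using X_times_shift[OF that] by metis

lemma h_power_Uh_1I: "fps_nth x 0 = 0 \<Longrightarrow> to_Uh x \<in> h_power_Uh 1"
  using divisible_by_X[of x] by (auto simp: h_power_Uh_eq)

lemma U_simps [simp]:
  "x \<otimes>\<^bsub>U\<^esub> y = x \<otimes>\<^bsub>Uh\<^esub> y" "x \<oplus>\<^bsub>U\<^esub> y = x \<oplus>\<^bsub>Uh\<^esub> y" "\<one>\<^bsub>U\<^esub> = \<one>\<^bsub>Uh\<^esub>" "\<zero>\<^bsub>U\<^esub> = \<zero>\<^bsub>Uh\<^esub>"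
  by (simp_all add: U_def)

lemma U_gens_subset: "to_Uh ` scalar ` laurent_v \<union> U_gens \<subseteq> carrier Uh"
  by (auto simp: U_gens_def)

lemma U_subring: "subring (carrier U) Uh"
  using Uh.generate_ring_is_subring[OF U_gens_subset] by (simp add: U_def)

lemma U_subset: "carrier U \<subseteq> carrier Uh"
  using Uh.generate_ring_incl[OF U_gens_subset] by (simp add: U_def)

interpretation U: ring U
  unfolding U_def by (rule Uh.generate_ring_is_ring[OF U_gens_subset])

lemma U_a_inv [simp]: "x \<in> carrier U \<Longrightarrow> \<ominus>\<^bsub>U\<^esub> x = \<ominus>\<^bsub>Uh\<^esub> x"
proof (rule sym, rule Uh.minus_equality)
  assume x: "x \<in> carrier U"
  show "\<ominus>\<^bsub>U\<^esub> x \<oplus>\<^bsub>Uh\<^esub> x = \<zero>\<^bsub>Uh\<^esub>" using U.l_neg[OF x] by simp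
  show "x \<in> carrier Uh" "\<ominus>\<^bsub>U\<^esub> x \<in> carrier Uh" using x U.a_inv_closed[OF x] U_subset by auto
qed

lemma U_a_minus [simp]: "y \<in> carrier U \<Longrightarrow> x \<ominus>\<^bsub>U\<^esub> y = x \<ominus>\<^bsub>Uh\<^esub> y"
  by (simp add: a_minus_def)

lemma in_U: "x \<in> to_Uh ` scalar ` laurent_v \<union> U_gens \<Longrightarrow> x \<in> carrier U"
  by (simp add: U_def generate_ring.incl)

lemma U_scalar: "a \<in> laurent_v \<Longrightarrow> to_Uh (scalar a) \<in> carrier U"
  by (rule in_U) blast

lemma v_powi_laurent: "v powi m \<in> laurent_v"
proof -
  have *: "x ^ n \<in> laurent_v" if "x \<in> {v, inverse v}" for n x
    unfolding laurent_v_def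
  proof (induction n)
    case 0
    show ?case using generate_ring.one[of ring_of_type_algebra] by (simp add: ring_of_type_algebra_def)
  next
    case (Suc n)
    show ?case 
      using generate_ring.eng_mult[OF generate_ring.incl[of x "{v, inverse v}" ring_of_type_algebra] Suc] that
      by (simp add: ring_of_type_algebra_def)
  qed
  show ?thesis using *[of v "nat m"] *[of "inverse v" "nat (-m)"] by (auto simp: power_int_def)
qed

lemma U1_gens_U: "U1_gens \<subseteq> carrier U"
proof -
  have K: "to_Uh free_K \<in> carrier U" "to_Uh free_K_inv \<in> carrier U"
    "to_Uh (scalar (v - inverse v) * free_E) \<in> carrier U"
    by (rule in_U; auto simp: U_gens_def)+
  have "to_Uh (scalar (v powi m) * free_K - scalar (v powi (- m)) * free_K_inv) \<in> carrier U" for m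
  proof -
    have "to_Uh (scalar (v powi m)) \<otimes>\<^bsub>U\<^esub> to_Uh free_K \<ominus>\<^bsub>U\<^esub> to_Uh (scalar (v powi (-m))) \<otimes>\<^bsub>U\<^esub> to_Uh free_K_inv
       \<in> carrier U"
      by (intro U.minus_closed U.m_closed U_scalar v_powi_laurent K)
    moreover have "to_Uh (scalar (v powi (-m))) \<otimes>\<^bsub>U\<^esub> to_Uh free_K_inv \<in> carrier U"
      by (intro U.minus_closed U.m_closed U_scalar v_powi_laurent K)
    ultimately show ?thesis by (simp add: to_Uh_diff to_Uh_mult)
  qed
  with K show ?thesis by (auto simp: U1_gens_def)
qed

lemma U1_ideal: "ideal U1 U"
  using U.genideal_ideal[OF U1_gens_U] by (simp add: U1_def)

lemma U1_powers_ideal: "ideal (ideal_power U U1 n) U"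
  by (induction n) (auto intro: U.oneideal U.ideal_prod_is_ideal U1_ideal)

lemma U1_gens_h: "U1_gens \<subseteq> h_power_Uh 1"
proof -
  have v0: "fps_nth (v powi m) 0 = 1" for m
    by (auto simp: power_int_def v_nth fps_power_zeroth)
  have "to_Uh (scalar (v - inverse v) * free_E) \<in> h_power_Uh 1"
    by (rule h_power_Uh_1I) (simp add: scalar_def v_nth)
  moreover have "to_Uh (scalar (v powi m) * free_K - scalar (v powi (- m)) * free_K_inv) \<in> h_power_Uh 1" for m
    by (rule h_power_Uh_1I) (simp add: scalar_def v0 free_K_def free_K_inv_def exp_hH_def)
  ultimately show ?thesis by (auto simp: U1_gens_def)
qed

lemma U1_h: "U1 \<subseteq> h_power_Uh 1"
proof -
  interpret h: ideal "h_power_Uh 1" Uh by (rule h_power_ideal)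
  have "ideal (h_power_Uh 1 \<inter> carrier U) U"
  proof (rule idealI)
    show "ring U" by (rule U.ring_axioms)
    show "subgroup (h_power_Uh 1 \<inter> carrier U) (add_monoid U)"
    proof (rule U.add.subgroupI)
      show "h_power_Uh 1 \<inter> carrier U \<noteq> {}"
        using h.zero_closed U.zero_closed by auto
    qed (use U.a_inv_closed U.a_closed h.a_closed h.a_inv_closed in \<open>auto simp del: One_nat_def\<close>)
  qed (use h.I_l_closed h.I_r_closed U_subset U.m_closed in \<open>auto simp: subset_iff simp del: One_nat_def\<close>)
  then have "genideal U U1_gens \<subseteq> h_power_Uh 1 \<inter> carrier U"
    using U1_gens_h U1_gens_U by (intro U.genideal_minimal) auto
  then show ?thesis by (auto simp: U1_def)
qed

lemma U1_powers_h: "ideal_power U U1 n \<subseteq> h_power_Uh n"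
proof (induction n)
  case 0
  then show ?case using U_subset by (auto simp: h_power_Uh_eq carrier_Uh)
next
  case (Suc n)
  interpret h: ideal "h_power_Uh (Suc n)" Uh by (rule h_power_ideal)
  have "x \<in> h_power_Uh (Suc n)" if "x \<in> ideal_prod U (ideal_power U U1 n) U1" for x
    using that
  proof (induction rule: ideal_prod.induct)
    case (prod i j)
    then have "i \<in> h_power_Uh n" "j \<in> h_power_Uh 1" using Suc U1_h by auto
    then obtain a b where ab: "i = to_Uh (fps_X ^ n * a)" "j = to_Uh (fps_X ^ 1 * b)"
      unfolding h_power_Uh_eq by blast
    have "fps_X ^ n * a * (fps_X ^ 1 * b) = fps_X ^ Suc n * (a * b)"
      using fps_X_power_comm[of 1 a] by (simp add: power_Suc2 mult.assoc del: power_Suc)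
        (simp flip: mult.assoc)
    then have "i \<otimes>\<^bsub>U\<^esub> j = to_Uh (fps_X ^ Suc n * (a * b))"
      by (simp only: ab U_simps to_Uh_mult[symmetric])
    then show ?case unfolding h_power_Uh_eq by blast
  next
    case (sum s1 s2)
    then show ?case using h.a_closed by simp
  qed
  then show ?case by auto
qed

text \<open>The congruence modulo \<open>h^n\<close>.\<close>

definition hcong :: "nat \<Rightarrow> free_alg fps set \<Rightarrow> free_alg fps set \<Rightarrow> bool" where
  "hcong n a b \<longleftrightarrow> h_power_Uh n +>\<^bsub>Uh\<^esub> a = h_power_Uh n +>\<^bsub>Uh\<^esub> b"

lemma hcong_iff:
  "a \<in> carrier Uh \<Longrightarrow> b \<in> carrier Uh \<Longrightarrow> hcong n a b \<longleftrightarrow> a \<ominus>\<^bsub>Uh\<^esub> b \<in> h_power_Uh n"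
  using Uh.quotient_eq_iff_same_a_r_cos[OF h_power_ideal] by (auto simp: hcong_def)

lemma coset_absorb:
  assumes "u \<in> carrier U"
  shows "h_power_Uh n <+>\<^bsub>Uh\<^esub> (ideal_power U U1 n +>\<^bsub>U\<^esub> u) = h_power_Uh n +>\<^bsub>Uh\<^esub> u"
proof -
  interpret h: ideal "h_power_Uh n" Uh by (rule h_power_ideal)
  interpret I: ideal "ideal_power U U1 n" U by (rule U1_powers_ideal)
  have u: "u \<in> carrier Uh" using assms U_subset by auto
  show ?thesis
  proof (intro equalityI subsetI)
    fix x assume "x \<in> h_power_Uh n <+>\<^bsub>Uh\<^esub> (ideal_power U U1 n +>\<^bsub>U\<^esub> u)"
    then obtain a b where ab: "a \<in> h_power_Uh n" "b \<in> ideal_power U U1 n" "x = a \<oplus>\<^bsub>Uh\<^esub> (b \<oplus>\<^bsub>Uh\<^esub> u)"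
      by (auto simp: set_add_def' a_r_coset_def')
    have b: "b \<in> h_power_Uh n" using ab U1_powers_h by auto
    have "x = (a \<oplus>\<^bsub>Uh\<^esub> b) \<oplus>\<^bsub>Uh\<^esub> u" using ab b u by (simp add: Uh.a_assoc h.a_Hcarr)
    then show "x \<in> h_power_Uh n +>\<^bsub>Uh\<^esub> u"
      using h.a_closed[OF ab(1) b] by (auto simp: a_r_coset_def')
  next
    fix x assume "x \<in> h_power_Uh n +>\<^bsub>Uh\<^esub> u"
    then obtain a where a: "a \<in> h_power_Uh n" "x = a \<oplus>\<^bsub>Uh\<^esub> u" by (auto simp: a_r_coset_def')
    moreover have "u \<in> ideal_power U U1 n +>\<^bsub>U\<^esub> u" using I.a_rcos_self assms by simp
    ultimately show "x \<in> h_power_Uh n <+>\<^bsub>Uh\<^esub> (ideal_power U U1 n +>\<^bsub>U\<^esub> u)"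
      by (auto simp: set_add_def')
  qed
qed

lemma dotU_rep:
  assumes "x \<in> carrier dotU"
  shows "\<exists>u. \<forall>n. u n \<in> carrier U \<and> x n = ideal_power U U1 n +>\<^bsub>U\<^esub> u n \<and>
    hcong n (u (Suc n)) (u n)"
proof -
  have "\<exists>u. u \<in> carrier U \<and> x n = ideal_power U U1 n +>\<^bsub>U\<^esub> u" for n
  proof -
    have "x n \<in> carrier (U Quot ideal_power U U1 n)"
      using assms by (simp add: dotU_def adic_completion_def)
    then show ?thesis by (auto simp: FactRing_def A_RCOSETS_defs a_r_coset_def r_coset_def)
  qed
  then obtain u where u: "\<And>n. u n \<in> carrier U" "\<And>n. x n = ideal_power U U1 n +>\<^bsub>U\<^esub> u n" by metis
  have "hcong n (u (Suc n)) (u n)" for n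
  proof -
    interpret I: ideal "ideal_power U U1 n" U by (rule U1_powers_ideal)
    interpret I': ideal "ideal_power U U1 (Suc n)" U by (rule U1_powers_ideal)
    have "u (Suc n) \<in> x (Suc n)" using I'.a_rcos_self[OF u(1)] u(2) by simp
    moreover have "\<zero>\<^bsub>U\<^esub> \<in> ideal_power U U1 n" by (rule I.zero_closed)
    ultimately have "\<zero>\<^bsub>Uh\<^esub> \<oplus>\<^bsub>Uh\<^esub> u (Suc n) \<in> ideal_power U U1 n <+>\<^bsub>U\<^esub> x (Suc n)"
      unfolding set_add_def' by auto
    also have "ideal_power U U1 n <+>\<^bsub>U\<^esub> x (Suc n) = x n"
      using assms by (simp add: dotU_def adic_completion_def)
    finally have "u (Suc n) \<in> ideal_power U U1 n +>\<^bsub>U\<^esub> u n"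
      using u U_subset by (auto simp: subset_iff)
    then obtain b where b: "b \<in> ideal_power U U1 n" "u (Suc n) = b \<oplus>\<^bsub>Uh\<^esub> u n"
      by (auto simp: a_r_coset_def')
    have "b \<in> carrier Uh" "u n \<in> carrier Uh"  "u (Suc n) \<in> carrier Uh"
      using I.a_Hcarr[OF b(1)] u(1) U_subset by auto
    moreover from this have "u (Suc n) \<ominus>\<^bsub>Uh\<^esub> u n = b"
      unfolding b(2) a_minus_def by (simp add: Uh.a_assoc Uh.r_neg)
    ultimately show ?thesis using b(1) U1_powers_h by (auto simp: hcong_iff)
  qed
  with u show ?thesis by blast
qed

lemma hcong_unique:
  assumes "a \<in> carrier Uh" "b \<in> carrier Uh" "\<And>n. hcong n a b"
  shows "a = b"
proof -
  have "a \<ominus>\<^bsub>Uh\<^esub> b = \<zero>\<^bsub>Uh\<^esub>" using assms by (intro Uh_separated) (auto simp: hcong_iff)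
  then show ?thesis using assms by simp
qed

lemma i_dotU_eqI:
  assumes "y \<in> carrier Uh"
    and "\<And>n. h_power_Uh n <+>\<^bsub>Uh\<^esub> x n = h_power_Uh n +>\<^bsub>Uh\<^esub> y"
  shows "i_dotU x = y"
  unfolding i_dotU_def
proof (rule the_equality)
  fix z assume "z \<in> carrier Uh \<and> (\<forall>n. h_power_Uh n <+>\<^bsub>Uh\<^esub> x n = h_power_Uh n +>\<^bsub>Uh\<^esub> z)"
  then show "z = y" using assms by (intro hcong_unique) (auto simp: hcong_def)
qed (use assms in auto)

lemma i_dotU:
  assumes "x \<in> carrier dotU"
  shows i_dotU_closed: "i_dotU x \<in> carrier Uh"
    and i_dotU_coset: "h_power_Uh n <+>\<^bsub>Uh\<^esub> x n = h_power_Uh n +>\<^bsub>Uh\<^esub> i_dotU x"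
proof -
  obtain u where u: "\<And>n. u n \<in> carrier U" "\<And>n. x n = ideal_power U U1 n +>\<^bsub>U\<^esub> u n"
    "\<And>n. hcong n (u (Suc n)) (u n)" using dotU_rep[OF assms] by metis
  have uU: "u n \<in> carrier Uh" for n using u U_subset by auto
  obtain y where y: "y \<in> carrier Uh" "\<And>n. u n \<ominus>\<^bsub>Uh\<^esub> y \<in> h_power_Uh n"
    using Uh_complete[of u] u(3) uU by (auto simp: hcong_iff)
  have *: "h_power_Uh n <+>\<^bsub>Uh\<^esub> x n = h_power_Uh n +>\<^bsub>Uh\<^esub> y" for n
    using y uU u(1) hcong_iff[of "u n" y n] by (simp add: u(2) coset_absorb hcong_def)
  then have "i_dotU x = y" using y by (intro i_dotU_eqI) auto
  with y * show "i_dotU x \<in> carrier Uh" "h_power_Uh n <+>\<^bsub>Uh\<^esub> x n = h_power_Uh n +>\<^bsub>Uh\<^esub> i_dotU x"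
    by auto
qed

theorem i_dotU_hom: "i_dotU \<in> ring_hom dotU Uh"
proof (rule ring_hom_memI)
  fix x y assume x: "x \<in> carrier dotU" and y: "y \<in> carrier dotU"
  obtain a where a: "\<And>n. a n \<in> carrier U" "\<And>n. x n = ideal_power U U1 n +>\<^bsub>U\<^esub> a n"
    using dotU_rep[OF x] by metis
  obtain b where b: "\<And>n. b n \<in> carrier U" "\<And>n. y n = ideal_power U U1 n +>\<^bsub>U\<^esub> b n"
    using dotU_rep[OF y] by metis
  note cl = i_dotU_closed[OF x] i_dotU_closed[OF y]
  have carr: "a n \<in> carrier Uh" "b n \<in> carrier Uh" for n using a b U_subset by auto
  have ax: "h_power_Uh n +>\<^bsub>Uh\<^esub> a n = h_power_Uh n +>\<^bsub>Uh\<^esub> i_dotU x"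
    and bx: "h_power_Uh n +>\<^bsub>Uh\<^esub> b n = h_power_Uh n +>\<^bsub>Uh\<^esub> i_dotU y" for n
    using i_dotU_coset[OF x, of n] i_dotU_coset[OF y, of n] a b by (simp_all add: coset_absorb)
  show "i_dotU (x \<otimes>\<^bsub>dotU\<^esub> y) = i_dotU x \<otimes>\<^bsub>Uh\<^esub> i_dotU y"
  proof (rule i_dotU_eqI)
    fix n
    interpret h: ideal "h_power_Uh n" Uh by (rule h_power_ideal)
    interpret I: ideal "ideal_power U U1 n" U by (rule U1_powers_ideal)
    have "(x \<otimes>\<^bsub>dotU\<^esub> y) n = ideal_power U U1 n +>\<^bsub>U\<^esub> (a n \<otimes>\<^bsub>U\<^esub> b n)"
      using I.rcoset_mult_add[OF a(1) b(1)] by (simp add: dotU_def adic_completion_def FactRing_def a b)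
    then have "h_power_Uh n <+>\<^bsub>Uh\<^esub> (x \<otimes>\<^bsub>dotU\<^esub> y) n = h_power_Uh n +>\<^bsub>Uh\<^esub> (a n \<otimes>\<^bsub>Uh\<^esub> b n)"
      using coset_absorb[OF U.m_closed[OF a(1) b(1)]] by simp
    also have "\<dots> = h_power_Uh n +>\<^bsub>Uh\<^esub> (i_dotU x \<otimes>\<^bsub>Uh\<^esub> i_dotU y)"
      using h.rcoset_mult_add[OF carr(1)[of n] carr(2)[of n]] h.rcoset_mult_add[OF cl] ax bx by metis
    finally show "h_power_Uh n <+>\<^bsub>Uh\<^esub> (x \<otimes>\<^bsub>dotU\<^esub> y) n
      = h_power_Uh n +>\<^bsub>Uh\<^esub> (i_dotU x \<otimes>\<^bsub>Uh\<^esub> i_dotU y)" .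
  qed (use cl in auto)
  show "i_dotU (x \<oplus>\<^bsub>dotU\<^esub> y) = i_dotU x \<oplus>\<^bsub>Uh\<^esub> i_dotU y"
  proof (rule i_dotU_eqI)
    fix n
    interpret h: ideal "h_power_Uh n" Uh by (rule h_power_ideal)
    interpret I: ideal "ideal_power U U1 n" U by (rule U1_powers_ideal)
    have "(x \<oplus>\<^bsub>dotU\<^esub> y) n = ideal_power U U1 n +>\<^bsub>U\<^esub> (a n \<oplus>\<^bsub>U\<^esub> b n)"
      using I.a_rcos_sum[OF a(1) b(1)] by (simp add: dotU_def adic_completion_def FactRing_def a b)
    then have "h_power_Uh n <+>\<^bsub>Uh\<^esub> (x \<oplus>\<^bsub>dotU\<^esub> y) n = h_power_Uh n +>\<^bsub>Uh\<^esub> (a n \<oplus>\<^bsub>Uh\<^esub> b n)"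
      using coset_absorb[OF U.a_closed[OF a(1) b(1)]] by simp
    also have "\<dots> = h_power_Uh n +>\<^bsub>Uh\<^esub> (i_dotU x \<oplus>\<^bsub>Uh\<^esub> i_dotU y)"
      using h.a_rcos_sum[OF carr(1)[of n] carr(2)[of n]] h.a_rcos_sum[OF cl] ax bx by metis
    finally show "h_power_Uh n <+>\<^bsub>Uh\<^esub> (x \<oplus>\<^bsub>dotU\<^esub> y) n
      = h_power_Uh n +>\<^bsub>Uh\<^esub> (i_dotU x \<oplus>\<^bsub>Uh\<^esub> i_dotU y)" .
  qed (use cl in auto)
next
  show "i_dotU \<one>\<^bsub>dotU\<^esub> = \<one>\<^bsub>Uh\<^esub>"
    by (rule i_dotU_eqI) 
       (use coset_absorb[OF U.one_closed] in \<open>auto simp: dotU_def adic_completion_def FactRing_def\<close>)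
qed (rule i_dotU_closed)

end

theory Submission
  imports Defs "HOL-Library.Product_Plus"
begin

text \<open>
  Write \<open>B = \<int>[v, v^-1, K, K^-1]\<close> and \<open>I = (v^2 - 1, K^2 - 1)\<close>, an ideal of \<open>B\<close>. The
  integral form is spanned by the elements \<open>F^(i) f e^k\<close> with \<open>f\<close> in \<open>B\<close>, and since \<open>e\<close>
  commutes with \<open>F^(i)\<close> up to a term with an extra factor \<open>v^-n K - v^n K^-1\<close> from \<open>I\<close>, the power
  \<open>U1^n\<close> is exactly the span of those \<open>F^(i) f e^k\<close> with \<open>f \<in> I^(n - k)\<close>
  (\<open>U1_power_eq_pbw_filt\<close>, where \<open>sign_ideal\<close> stands for the powers of \<open>I\<close>).

  A sequence of representatives of an element of the kernel lies, modulo \<open>U1^n\<close>, in \<open>h^m U\<^sub>h\<close> for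
  every \<open>m\<close>. So injectivity follows once \<open>U1^n\<close> is closed in the integral form for the \<open>h\<close>-adic topology
  of \<open>U\<^sub>h\<close> (\<open>ideal_power_closed\<close>). This topology is coarser than the \<open>U1\<close>-adic one: the point
  \<open>v = K = 1\<close> is the only one that it sees, whereas \<open>I\<close> vanishes at all four points
  \<open>v = \<plusminus>1\<close>, \<open>K = \<plusminus>1\<close> (whence the name \<open>sign_ideal\<close>).

  The proof of closedness has two steps. The first reduces it to \<open>B\<close>: if a combination of the
  \<open>F^(i) f e^k\<close> lies in \<open>h^m U\<^sub>h\<close>, then each coefficient \<open>f\<close> vanishes to order \<open>m - k\<close> at
  \<open>h = 0\<close> after \<open>v = exp (h/2)\<close>, \<open>K = exp (\<lambda>h/2)\<close>, for all large rational \<open>\<lambda>\<close>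
  (\<open>pbw_h_power\<close>). This is read off from the action on the Verma module of highest weight \<open>\<lambda>\<close>:
  \<open>e^k\<close> annihilates the first \<open>k\<close> basis vectors and maps the next one to the highest weight vector,
  with a factor that is \<open>h^k\<close> times a unit. The second step is commutative algebra in \<open>B\<close>
  (\<open>sign_ideal_closed\<close>): the four sign points are congruent modulo 2, so a Laurent polynomial that
  vanishes to high order at \<open>(1, 1)\<close> has Taylor coefficients at the other sign points that are
  divisible by high powers of 2. If \<open>f\<close> is approximated to arbitrary order at \<open>(1, 1)\<close> by elements of
  \<open>I^n\<close>, all its Taylor coefficients of order below \<open>n\<close> at all four points are therefore divisible by every
  power of 2, hence zero, and then \<open>f \<in> I^n\<close>. All of this is tested on curves
  \<open>v = (\<epsilon> exp h)^\<mu>\<close>, \<open>K = (\<epsilon> exp h)^p\<close> with \<open>\<epsilon> = \<plusminus>1\<close>; half-integral highest weights \<open>p/2\<close>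
  are what makes the point \<open>(1, -1)\<close> accessible.
\<close>

section \<open>Linear extension from a monoid to its integral monoid ring\<close>

lemma poly_mapping_sum_single: "f = (\<Sum>k\<in>Poly_Mapping.keys f. Poly_Mapping.single k (Poly_Mapping.lookup f k))"
  by (rule poly_mapping_eqI)
     (auto simp: lookup_sum lookup_single when_def sum.delta in_keys_iff)

lemma poly_mapping_additive_induct [case_names zero single add]:
  assumes "P (0 :: _ \<Rightarrow>\<^sub>0 _ :: comm_monoid_add)" "\<And>k c. P (Poly_Mapping.single k c)" "\<And>f g. P f \<Longrightarrow> P g \<Longrightarrow> P (f + g)"
  shows "P f"
proof -
  have "P (\<Sum>k\<in>A. Poly_Mapping.single k (Poly_Mapping.lookup f k))" for A
    by (induction A rule: infinite_finite_induct) (use assms in auto)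
  then show ?thesis using poly_mapping_sum_single[of f] by metis
qed

text \<open>For multiplicative \<open>\<chi>\<close> this is the ring homomorphism from the integral monoid ring that extends
  \<open>\<chi>\<close>. The target may be noncommutative; this is used both for power series and for \<open>U\<^sub>h\<close>.\<close>

definition lin_ext :: "('k \<Rightarrow> 'r::ring_1) \<Rightarrow> ('k \<Rightarrow>\<^sub>0 int) \<Rightarrow> 'r" where
  "lin_ext \<chi> f = (\<Sum>k\<in>Poly_Mapping.keys f. of_int (Poly_Mapping.lookup f k) * \<chi> k)"

lemma lin_ext_superset:
  "finite A \<Longrightarrow> Poly_Mapping.keys f \<subseteq> A \<Longrightarrow> lin_ext \<chi> f = (\<Sum>k\<in>A. of_int (Poly_Mapping.lookup f k) * \<chi> k)"
  unfolding lin_ext_def by (rule sum.mono_neutral_left) (auto simp: in_keys_iff)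

lemma lin_ext_0 [simp]: "lin_ext \<chi> 0 = 0"
  by (simp add: lin_ext_def)

lemma lin_ext_add: "lin_ext \<chi> (f + g) = lin_ext \<chi> f + lin_ext \<chi> g"
proof -
  let ?A = "Poly_Mapping.keys f \<union> Poly_Mapping.keys g"
  have "finite ?A" "Poly_Mapping.keys (f + g) \<subseteq> ?A" by (auto dest!: keys_add[THEN subsetD])
  then show ?thesis
    by (simp add: lin_ext_superset[of ?A] lookup_add distrib_right sum.distrib)
qed

lemma lin_ext_single [simp]: "lin_ext \<chi> (Poly_Mapping.single k c) = of_int c * \<chi> k"
  by (auto simp: lin_ext_def)

lemma lin_ext_uminus: "lin_ext \<chi> (- f) = - lin_ext \<chi> f"
  using lin_ext_add[of \<chi> f "- f"] by (simp add: eq_neg_iff_add_eq_0 add.commute)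

lemma lin_ext_diff: "lin_ext \<chi> (f - g) = lin_ext \<chi> f - lin_ext \<chi> g"
  using lin_ext_add[of \<chi> f "- g"] by (simp add: lin_ext_uminus)

lemma lin_ext_sum: "lin_ext \<chi> (\<Sum>i\<in>A. f i) = (\<Sum>i\<in>A. lin_ext \<chi> (f i))"
  by (induction A rule: infinite_finite_induct) (auto simp: lin_ext_add)

lemma lin_ext_mult:
  assumes "\<And>a b. \<chi> (a + b) = \<chi> a * \<chi> b"
  shows "lin_ext \<chi> (f * g) = lin_ext \<chi> f * lin_ext \<chi> g"
proof (induction f rule: poly_mapping_additive_induct)
  case (single k c)
  show ?case
  proof (induction g rule: poly_mapping_additive_induct)
    case (single k' c')
    have "of_int c * (of_int c' * (\<chi> k * \<chi> k')) = of_int c * \<chi> k * (of_int c' * \<chi> k')"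
      by (metis mult.assoc mult_of_int_commute)
    then show ?case by (simp add: mult_single assms mult.assoc)
  qed (auto simp: lin_ext_add distrib_left)
qed (auto simp: lin_ext_add distrib_right)

lemma lin_ext_one: "\<chi> 0 = 1 \<Longrightarrow> lin_ext \<chi> 1 = 1"
  using lin_ext_single[of \<chi> 0 1] by simp

section \<open>The powers of the ideal generated by \<open>v^2 - 1\<close> and \<open>K^2 - 1\<close> in \<open>\<int>[v, v^-1, K, K^-1]\<close>\<close>

type_synonym laurent = "int \<times> int \<Rightarrow>\<^sub>0 int"

text \<open>The monomial \<open>v^a K^b\<close>.\<close>

definition vK :: "int \<Rightarrow> int \<Rightarrow> laurent" where
  "vK a b = Poly_Mapping.single (a, b) 1"

lemma vK_mult: "vK a b * vK c d = vK (a + c) (b + d)"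
  by (simp add: vK_def mult_single)

lemma vK_0: "vK 0 0 = 1"
  by (simp add: vK_def flip: zero_prod_def)

definition v2_minus_1 :: laurent where "v2_minus_1 = vK 2 0 - 1"
definition K2_minus_1 :: laurent where "K2_minus_1 = vK 0 2 - 1"

text \<open>The \<open>n\<close>-th power of the ideal generated by \<open>v^2 - 1\<close> and \<open>K^2 - 1\<close>, that is, of the ideal of
  the four points \<open>v = \<plusminus>1\<close>, \<open>K = \<plusminus>1\<close>. Since \<open>I^(n+1)\<close> is \<open>(v^2 - 1) I^n + (K^2 - 1) I^n\<close>, no
  spans are needed.\<close>

primrec sign_ideal :: "nat \<Rightarrow> laurent set" where
  "sign_ideal 0 = UNIV"
| "sign_ideal (Suc n) = {v2_minus_1 * a + K2_minus_1 * b | a b. a \<in> sign_ideal n \<and> b \<in> sign_ideal n}"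

lemma sign_ideal_SucI: "a \<in> sign_ideal n \<Longrightarrow> b \<in> sign_ideal n \<Longrightarrow> v2_minus_1 * a + K2_minus_1 * b \<in> sign_ideal (Suc n)"
  by auto

lemma sign_ideal_SucE:
  assumes "f \<in> sign_ideal (Suc n)"
  obtains a b where "f = v2_minus_1 * a + K2_minus_1 * b" "a \<in> sign_ideal n" "b \<in> sign_ideal n"
  using assms by auto

declare sign_ideal.simps(2) [simp del]

lemma sign_ideal_zero [simp]: "0 \<in> sign_ideal n"
proof (induction n)
  case (Suc n)
  then show ?case using sign_ideal_SucI[of 0 n 0] by simp
qed simp

lemma sign_ideal_add: "f \<in> sign_ideal n \<Longrightarrow> g \<in> sign_ideal n \<Longrightarrow> f + g \<in> sign_ideal n"
proof (induction n arbitrary: f g)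
  case (Suc n)
  obtain a b c d where *: "f = v2_minus_1 * a + K2_minus_1 * b" "a \<in> sign_ideal n" "b \<in> sign_ideal n"
    "g = v2_minus_1 * c + K2_minus_1 * d" "c \<in> sign_ideal n" "d \<in> sign_ideal n" using Suc.prems by (auto elim!: sign_ideal_SucE)
  have "f + g = v2_minus_1 * (a + c) + K2_minus_1 * (b + d)" by (simp add: * algebra_simps)
  then show ?case using Suc.IH * sign_ideal_SucI by metis
qed simp

lemma sign_ideal_mult: "f \<in> sign_ideal n \<Longrightarrow> r * f \<in> sign_ideal n"
proof (induction n arbitrary: f)
  case (Suc n)
  obtain a b where *: "f = v2_minus_1 * a + K2_minus_1 * b" "a \<in> sign_ideal n" "b \<in> sign_ideal n"
    using Suc.prems by (auto elim!: sign_ideal_SucE)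
  have "r * f = v2_minus_1 * (r * a) + K2_minus_1 * (r * b)" by (simp add: * algebra_simps)
  then show ?case using Suc.IH * sign_ideal_SucI by metis
qed simp

lemma sign_ideal_uminus: "f \<in> sign_ideal n \<Longrightarrow> - f \<in> sign_ideal n"
  using sign_ideal_mult[of f n "-1"] by simp

lemma sign_ideal_sum: "(\<And>i. i \<in> A \<Longrightarrow> f i \<in> sign_ideal n) \<Longrightarrow> sum f A \<in> sign_ideal n"
  by (induction A rule: infinite_finite_induct) (auto intro: sign_ideal_add)

lemma sign_ideal_prod: "f \<in> sign_ideal m \<Longrightarrow> g \<in> sign_ideal n \<Longrightarrow> f * g \<in> sign_ideal (m + n)"
proof (induction m arbitrary: f)
  case 0
  then show ?case by (simp add: sign_ideal_mult)
next
  case (Suc m)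
  obtain a b where *: "f = v2_minus_1 * a + K2_minus_1 * b" "a \<in> sign_ideal m" "b \<in> sign_ideal m"
    using Suc.prems by (auto elim!: sign_ideal_SucE)
  have "f * g = v2_minus_1 * (a * g) + K2_minus_1 * (b * g)" by (simp add: * algebra_simps)
  then show ?case using Suc.IH Suc.prems * sign_ideal_SucI by (metis add_Suc)
qed

lemma sign_ideal_Suc_subset: "sign_ideal (Suc n) \<subseteq> sign_ideal n"
  by (auto elim!: sign_ideal_SucE intro!: sign_ideal_add sign_ideal_mult)

lemma sign_ideal_antimono: "m \<le> n \<Longrightarrow> sign_ideal n \<subseteq> sign_ideal m"
  using lift_Suc_antimono_le[of sign_ideal m n] sign_ideal_Suc_subset by blast

lemma v2_minus_1_sign_ideal: "v2_minus_1 \<in> sign_ideal 1" and K2_minus_1_sign_ideal: "K2_minus_1 \<in> sign_ideal 1"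
  using sign_ideal_SucI[of 1 0 0] sign_ideal_SucI[of 0 0 1] by auto

lemma sign_ideal_generator_powers: "v2_minus_1 ^ i * K2_minus_1 ^ j \<in> sign_ideal (i + j)"
proof -
  have "v2_minus_1 ^ i \<in> sign_ideal i" "K2_minus_1 ^ i \<in> sign_ideal i" for i
    by (induction i) (use sign_ideal_prod[OF v2_minus_1_sign_ideal] sign_ideal_prod[OF K2_minus_1_sign_ideal] in auto)
  then show ?thesis by (intro sign_ideal_prod)
qed

lemma sign_ideal_expand:
  assumes "f \<in> sign_ideal n"
  shows "\<exists>c. f = (\<Sum>i\<le>n. v2_minus_1 ^ i * K2_minus_1 ^ (n - i) * c i)"
  using assms
proof (induction n arbitrary: f)
  case 0
  then show ?case by (intro exI[of _ "\<lambda>_. f"]) simp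
next
  case (Suc n)
  obtain a b where *: "f = v2_minus_1 * a + K2_minus_1 * b" "a \<in> sign_ideal n" "b \<in> sign_ideal n"
    using Suc.prems by (auto elim!: sign_ideal_SucE)
  obtain c d where c: "a = (\<Sum>i\<le>n. v2_minus_1 ^ i * K2_minus_1 ^ (n - i) * c i)"
    and d: "b = (\<Sum>i\<le>n. v2_minus_1 ^ i * K2_minus_1 ^ (n - i) * d i)"
    using Suc.IH[OF *(2)] Suc.IH[OF *(3)] by blast
  define g where "g i = (if i = 0 then 0 else c (i - 1)) + (if i \<le> n then d i else 0)" for i
  have "(\<Sum>i\<le>Suc n. v2_minus_1 ^ i * K2_minus_1 ^ (Suc n - i) * g i)
     = (\<Sum>i\<le>Suc n. v2_minus_1 ^ i * K2_minus_1 ^ (Suc n - i) * (if i = 0 then 0 else c (i - 1)))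
     + (\<Sum>i\<le>Suc n. v2_minus_1 ^ i * K2_minus_1 ^ (Suc n - i) * (if i \<le> n then d i else 0))"
    by (simp only: g_def distrib_left sum.distrib)
  also have "(\<Sum>i\<le>Suc n. v2_minus_1 ^ i * K2_minus_1 ^ (Suc n - i) * (if i = 0 then 0 else c (i - 1))) = v2_minus_1 * a"
    by (subst sum.atMost_Suc_shift) (simp add: c sum_distrib_left mult.assoc)
  also have "(\<Sum>i\<le>Suc n. v2_minus_1 ^ i * K2_minus_1 ^ (Suc n - i) * (if i \<le> n then d i else 0)) = K2_minus_1 * b"
    by (auto simp: d sum_distrib_left Suc_diff_le mult_ac intro!: sum.cong)
  finally have "f = (\<Sum>i\<le>Suc n. v2_minus_1 ^ i * K2_minus_1 ^ (Suc n - i) * g i)" by (simp only: *(1))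
  then show ?case by blast
qed

lemma vK_pow_sign_ideal: "vK (2 * a) 0 - 1 \<in> sign_ideal 1" "vK 0 (2 * a) - 1 \<in> sign_ideal 1"
proof -
  have nat: "vK (2 * int n) 0 - 1 \<in> sign_ideal 1" "vK 0 (2 * int n) - 1 \<in> sign_ideal 1" for n
  proof (induction n)
    case (Suc n)
    { case 1
      have "vK (2 * int (Suc n)) 0 - 1 = (vK (2 * int n) 0 - 1) + vK (2 * int n) 0 * v2_minus_1"
        by (simp add: v2_minus_1_def right_diff_distrib vK_mult algebra_simps)
      then show ?case using sign_ideal_add[OF Suc(1) sign_ideal_mult[OF v2_minus_1_sign_ideal, of "vK (2 * int n) 0"]] by (simp only:)
    next
      case 2
      have "vK 0 (2 * int (Suc n)) - 1 = (vK 0 (2 * int n) - 1) + vK 0 (2 * int n) * K2_minus_1"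
        by (simp add: K2_minus_1_def right_diff_distrib vK_mult algebra_simps)
      then show ?case using sign_ideal_add[OF Suc(2) sign_ideal_mult[OF K2_minus_1_sign_ideal, of "vK 0 (2 * int n)"]] by (simp only:) }
  qed (simp_all add: vK_0)
  have neg: "vK (- (2 * int n)) 0 - 1 \<in> sign_ideal 1" "vK 0 (- (2 * int n)) - 1 \<in> sign_ideal 1" for n
  proof -
    have "vK (- (2 * int n)) 0 - 1 = - (vK (- (2 * int n)) 0 * (vK (2 * int n) 0 - 1))"
      "vK 0 (- (2 * int n)) - 1 = - (vK 0 (- (2 * int n)) * (vK 0 (2 * int n) - 1))"
      by (simp_all add: right_diff_distrib vK_mult vK_0)
    then show "vK (- (2 * int n)) 0 - 1 \<in> sign_ideal 1" "vK 0 (- (2 * int n)) - 1 \<in> sign_ideal 1"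
      using sign_ideal_uminus[OF sign_ideal_mult[OF nat(1)]] sign_ideal_uminus[OF sign_ideal_mult[OF nat(2)]] by simp_all
  qed
  show "vK (2 * a) 0 - 1 \<in> sign_ideal 1" "vK 0 (2 * a) - 1 \<in> sign_ideal 1"
    by (cases a rule: int_cases2; use nat neg in simp)+
qed

text \<open>Modulo the ideal \<open>v^2 = K^2 = 1\<close>, so the quotient is the group ring of the Klein four-group, and a
  monomial depends only on the parities of its exponents.\<close>

lemma vK_mod2: "vK a b - vK (a mod 2) (b mod 2) \<in> sign_ideal 1"
proof -
  have "vK a b = vK (a mod 2) (b mod 2) * vK (2 * (a div 2)) 0 * vK 0 (2 * (b div 2))"
    by (simp add: vK_mult)
  then have "vK a b - vK (a mod 2) (b mod 2) = vK (a mod 2) (b mod 2) *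
     (vK (2 * (a div 2)) 0 * (vK 0 (2 * (b div 2)) - 1) + (vK (2 * (a div 2)) 0 - 1))"
    by (simp add: algebra_simps)
  then show ?thesis using vK_pow_sign_ideal by (simp add: sign_ideal_mult sign_ideal_add)
qed

lemma single_vK: "Poly_Mapping.single (a, b) c = of_int c * vK a b"
proof -
  have "of_int c = (Poly_Mapping.single 0 c :: laurent)"
    by (simp add: poly_mapping_eq_iff fun_eq_iff lookup_of_int lookup_single)
  then show ?thesis by (simp add: vK_def mult_single)
qed

text \<open>The sum of the coefficients whose exponents have the given residues modulo 2: the coordinates of
  the class of \<open>f\<close> in the group ring of the Klein four-group.\<close>

definition parity_part :: "int \<Rightarrow> int \<Rightarrow> laurent \<Rightarrow> int" where
  "parity_part r s f = lin_ext (\<lambda>k. if fst k mod 2 = r \<and> snd k mod 2 = s then 1 else 0) f"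

lemma parity_reduction:
  "f - (\<Sum>r\<in>{0,1}. \<Sum>s\<in>{0,1}. of_int (parity_part r s f) * vK r s) \<in> sign_ideal 1"
proof (induction f rule: poly_mapping_additive_induct)
  case zero
  then show ?case by (simp add: parity_part_def)
next
  case (single k c)
  obtain a b where k: "k = (a, b)" by (cases k)
  have "(\<Sum>r\<in>{0,1}. \<Sum>s\<in>{0,1}. of_int (parity_part r s (Poly_Mapping.single k c)) * vK r s)
     = of_int c * vK (a mod 2) (b mod 2)"
    using mod2_eq_if[of a] mod2_eq_if[of b] by (auto simp: parity_part_def k split: if_splits)
  moreover have "of_int c * (vK a b - vK (a mod 2) (b mod 2)) \<in> sign_ideal 1"
    by (rule sign_ideal_mult[OF vK_mod2])
  ultimately show ?case by (simp add: k single_vK right_diff_distrib)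
next
  case (add f g)
  have "parity_part r s (f + g) = parity_part r s f + parity_part r s g" for r s
    by (simp add: parity_part_def lin_ext_add)
  then have "f + g - (\<Sum>r\<in>{0,1}. \<Sum>s\<in>{0,1}. of_int (parity_part r s (f + g)) * vK r s) =
     (f - (\<Sum>r\<in>{0,1}. \<Sum>s\<in>{0,1}. of_int (parity_part r s f) * vK r s)) +
     (g - (\<Sum>r\<in>{0,1}. \<Sum>s\<in>{0,1}. of_int (parity_part r s g) * vK r s))"
    by (simp add: distrib_right)
  then show ?case using sign_ideal_add[OF add] by (simp only:)
qed

text \<open>The value at \<open>v = \<epsilon>\<close>, \<open>K = \<delta>\<close> for signs \<open>\<epsilon>\<close> and \<open>\<delta>\<close>; as a sign is its own inverse, absolute
  values turn the exponents into natural numbers.\<close>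

definition at_signs :: "int \<Rightarrow> int \<Rightarrow> laurent \<Rightarrow> int" where
  "at_signs \<epsilon> \<delta> f = lin_ext (\<lambda>k. \<epsilon> ^ nat \<bar>fst k\<bar> * \<delta> ^ nat \<bar>snd k\<bar>) f"

lemma sign_power_abs_add:
  assumes "\<epsilon> \<in> {1, -1 :: int}"
  shows "\<epsilon> ^ nat \<bar>a + b\<bar> = \<epsilon> ^ nat \<bar>a\<bar> * \<epsilon> ^ nat \<bar>b\<bar>"
  using assms by (auto simp: minus_one_power_iff even_nat_iff)

lemma at_signs_parity:
  assumes "\<epsilon> \<in> {1, -1}" "\<delta> \<in> {1, -1}"
  shows "at_signs \<epsilon> \<delta> f = (\<Sum>r\<in>{0,1}. \<Sum>s\<in>{0,1}. parity_part r s f * (\<epsilon> ^ nat r * \<delta> ^ nat s))"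
proof (induction f rule: poly_mapping_additive_induct)
  case (single k c)
  obtain a b where k: "k = (a, b)" by (cases k)
  have sg: "\<zeta> ^ nat \<bar>n\<bar> = \<zeta> ^ nat (n mod 2)" if "\<zeta> \<in> {1, -1}" for \<zeta> n :: int
    using that by (cases "even n") (auto simp: even_nat_iff odd_iff_mod_2_eq_one)
  have "(a mod 2 = 0 \<or> a mod 2 = 1) \<and> (b mod 2 = 0 \<or> b mod 2 = 1)" by presburger
  then show ?case
    by (auto simp: at_signs_def parity_part_def k sg[OF assms(1)] sg[OF assms(2)])
next
  case (add f g)
  then show ?case
    by (simp add: at_signs_def parity_part_def lin_ext_add distrib_right)
qed (simp_all add: at_signs_def parity_part_def)

text \<open>The four values are the values of the four characters of the Klein four-group on the class of \<open>f\<close>,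
  and over the integers the character table is injective.\<close>

lemma sign_ideal_1I:
  assumes "\<And>\<epsilon> \<delta>. \<epsilon> \<in> {1, -1} \<Longrightarrow> \<delta> \<in> {1, -1} \<Longrightarrow> at_signs \<epsilon> \<delta> f = 0"
  shows "f \<in> sign_ideal 1"
proof -
  let ?p = "\<lambda>r s. parity_part r s f"
  have "?p 0 0 + ?p 0 1 + ?p 1 0 + ?p 1 1 = 0" "?p 0 0 - ?p 0 1 + ?p 1 0 - ?p 1 1 = 0"
    "?p 0 0 + ?p 0 1 - ?p 1 0 - ?p 1 1 = 0" "?p 0 0 - ?p 0 1 - ?p 1 0 + ?p 1 1 = 0"
    using assms[of 1 1] assms[of 1 "-1"] assms[of "-1" 1] assms[of "-1" "-1"]
    by (simp_all add: at_signs_parity)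
  then have "?p 0 0 = 0" "?p 0 1 = 0" "?p 1 0 = 0" "?p 1 1 = 0" by linarith+
  then show ?thesis using parity_reduction[of f] by simp
qed

section \<open>Power moments of alternating sums and divisibility by powers of 2\<close>

lemma binomial_step: "int (Suc k) * int (n choose Suc k) = (int n - int k) * int (n choose k)"
proof (cases "k \<le> n")
  case True
  then have "Suc k * (n choose Suc k) = (n - k) * (n choose k)"
    by (metis binomial_absorption binomial_absorb_comp)
  with True show ?thesis by (metis of_nat_diff of_nat_mult)
next
  case False
  then show ?thesis by (simp add: binomial_eq_0)
qed

text \<open>\<open>binomial n k * n ^ r\<close> is a rational polynomial in \<open>n\<close> of degree \<open>k + r\<close>. Induction along
  \<open>binomial_step\<close> avoids expanding it.\<close>

lemma moments_binomial_vanish: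
  fixes c :: "'a \<Rightarrow> int" and N :: "'a \<Rightarrow> nat"
  assumes "\<And>r. r < m \<Longrightarrow> (\<Sum>a\<in>A. c a * int (N a) ^ r) = 0" and "k + r < m"
  shows "(\<Sum>a\<in>A. c a * int (N a choose k) * int (N a) ^ r) = 0"
  using assms(2)
proof (induction k arbitrary: r)
  case 0
  then show ?case using assms(1) by simp
next
  case (Suc k)
  have "int (Suc k) * (\<Sum>a\<in>A. c a * int (N a choose Suc k) * int (N a) ^ r)
      = (\<Sum>a\<in>A. c a * (int (Suc k) * int (N a choose Suc k)) * int (N a) ^ r)"
    by (simp add: sum_distrib_left algebra_simps)
  also have "\<dots> = (\<Sum>a\<in>A. c a * int (N a choose k) * int (N a) ^ Suc r)
      - int k * (\<Sum>a\<in>A. c a * int (N a choose k) * int (N a) ^ r)"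
    unfolding binomial_step by (simp add: sum_distrib_left algebra_simps sum_subtractf)
  also have "\<dots> = 0" using Suc.IH[of "Suc r"] Suc.IH[of r] Suc.prems by simp
  finally show ?case by simp
qed

text \<open>If the Laurent polynomial with coefficients \<open>c a\<close> at \<open>u ^ N a\<close> vanishes to order \<open>m\<close> at \<open>u = 1\<close>, its
  derivatives at \<open>u = -1\<close> are divisible by high powers of 2. The reason is the expansion of
  \<open>(-1) ^ N = (1 - 2) ^ N\<close> in powers of 2: the vanishing moments remove all terms with \<open>2 ^ k\<close>
  for \<open>k < m - r\<close>.\<close>

lemma alternating_moment_dvd_nat:
  fixes c :: "'a \<Rightarrow> int" and N :: "'a \<Rightarrow> nat"
  assumes fin: "finite A" and mom: "\<And>r. r < m \<Longrightarrow> (\<Sum>a\<in>A. c a * int (N a) ^ r) = 0" and "r < m"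
  shows "2 ^ (m - r) dvd (\<Sum>a\<in>A. c a * (-1) ^ N a * int (N a) ^ r)"
proof -
  define L where "L = (\<Sum>a\<in>A. N a)"
  have sign: "(-1) ^ N a = (\<Sum>k\<le>L. int (N a choose k) * (-2) ^ k)" if "a \<in> A" for a
  proof -
    have "N a \<le> L" unfolding L_def using member_le_sum[OF that, of N] fin by simp
    have "(-1 :: int) ^ N a = (-2 + 1) ^ N a" by simp
    also have "\<dots> = (\<Sum>k\<le>N a. int (N a choose k) * (-2) ^ k)" by (subst binomial_ring) simp
    also have "\<dots> = (\<Sum>k\<le>L. int (N a choose k) * (-2) ^ k)"
      using \<open>N a \<le> L\<close> by (intro sum.mono_neutral_left) auto
    finally show ?thesis .
  qed
  have "(\<Sum>a\<in>A. c a * (-1) ^ N a * int (N a) ^ r)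
      = (\<Sum>a\<in>A. \<Sum>k\<le>L. (-2) ^ k * (c a * int (N a choose k) * int (N a) ^ r))"
    by (rule sum.cong) (simp_all add: sign sum_distrib_left sum_distrib_right algebra_simps)
  also have "\<dots> = (\<Sum>k\<le>L. (-2) ^ k * (\<Sum>a\<in>A. c a * int (N a choose k) * int (N a) ^ r))"
    by (subst sum.swap) (simp add: sum_distrib_left)
  also have "2 ^ (m - r) dvd \<dots>"
  proof (rule dvd_sum)
    fix k
    show "2 ^ (m - r) dvd (-2) ^ k * (\<Sum>a\<in>A. c a * int (N a choose k) * int (N a) ^ r)"
    proof (cases "k + r < m")
      case True
      then show ?thesis using moments_binomial_vanish[OF mom] by simp
    next
      case False
      then have "(2 :: int) ^ (m - r) dvd 2 ^ k" by (intro le_imp_power_dvd) simp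
      moreover have "(2 :: int) ^ k dvd (-2) ^ k" by (simp add: power_minus[of "2::int"])
      ultimately show ?thesis using dvd_trans dvd_mult2 by blast
    qed
  qed
  finally show ?thesis .
qed

lemma alternating_moment_dvd:
  fixes c N :: "'a \<Rightarrow> int"
  assumes fin: "finite A" and mom: "\<And>r. r < m \<Longrightarrow> (\<Sum>a\<in>A. c a * N a ^ r) = 0" and "r < m"
  shows "2 ^ (m - r) dvd (\<Sum>a\<in>A. c a * (-1) ^ nat \<bar>N a\<bar> * N a ^ r)"
proof -
  \<comment> \<open>Shifting all exponents by \<open>M\<close> makes them natural numbers. Vanishing moments are translation
    invariant, and as \<open>M\<close> is even and divisible by \<open>2 ^ m\<close>, the alternating sum changes only by a multiple of \<open>2 ^ m\<close>.\<close>
  define M where "M = 2 ^ Suc m * (\<Sum>a\<in>A. \<bar>N a\<bar>)"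
  have nonneg: "N a + M \<ge> 0" if "a \<in> A" for a
  proof -
    have *: "\<bar>N a\<bar> \<le> (\<Sum>a\<in>A. \<bar>N a\<bar>)" using that fin by (intro member_le_sum) auto
    moreover have "(1 :: int) \<le> 2 ^ Suc m" by (rule one_le_power) simp
    then have "1 * (\<Sum>a\<in>A. \<bar>N a\<bar>) \<le> M" unfolding M_def by (intro mult_right_mono) (auto intro: sum_nonneg)
    ultimately show ?thesis by linarith
  qed
  have M: "2 ^ m dvd M" "even M" by (auto simp: M_def)
  define N' where "N' a = nat (N a + M)" for a
  have N': "int (N' a) = N a + M" if "a \<in> A" for a using nonneg[OF that] by (simp add: N'_def)
  have sgn: "(-1 :: int) ^ N' a = (-1) ^ nat \<bar>N a\<bar>" if "a \<in> A" for a
  proof -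
    have "even (N' a) \<longleftrightarrow> even (N a)" using N'[OF that] M(2) by (metis even_add even_of_nat)
    then show ?thesis by (simp add: minus_one_power_iff even_nat_iff)
  qed
  have "(\<Sum>a\<in>A. c a * int (N' a) ^ s) = 0" if "s < m" for s
  proof -
    have "(\<Sum>a\<in>A. c a * int (N' a) ^ s) = (\<Sum>a\<in>A. c a * (\<Sum>j\<le>s. of_nat (s choose j) * N a ^ j * M ^ (s - j)))"
      by (intro sum.cong) (simp_all add: N' binomial_ring)
    also have "\<dots> = (\<Sum>j\<le>s. (of_nat (s choose j) * M ^ (s - j)) * (\<Sum>a\<in>A. c a * N a ^ j))"
      unfolding sum_distrib_left by (subst sum.swap) (simp add: mult_ac)
    also have "\<dots> = 0" using mom that by (intro sum.neutral) auto
    finally show ?thesis .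
  qed
  from alternating_moment_dvd_nat[OF fin this \<open>r < m\<close>]
  have 1: "2 ^ (m - r) dvd (\<Sum>a\<in>A. c a * (-1) ^ N' a * int (N' a) ^ r)" by simp
  have "2 ^ (m - r) dvd (\<Sum>a\<in>A. c a * (-1) ^ N' a * int (N' a) ^ r - c a * (-1) ^ nat \<bar>N a\<bar> * N a ^ r)"
  proof (rule dvd_sum)
    fix a assume a: "a \<in> A"
    have "int (N' a) - N a dvd int (N' a) ^ r - N a ^ r" by (simp add: power_diff_sumr2)
    then have "2 ^ m dvd int (N' a) ^ r - N a ^ r" using M(1) a by (auto simp: N' intro: dvd_trans)
    then have "2 ^ (m - r) dvd int (N' a) ^ r - N a ^ r"
      by (meson diff_le_self dvd_trans le_imp_power_dvd)
    then have "2 ^ (m - r) dvd c a * (-1) ^ nat \<bar>N a\<bar> * (int (N' a) ^ r - N a ^ r)" by simp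
    then show "2 ^ (m - r) dvd c a * (-1) ^ N' a * int (N' a) ^ r - c a * (-1) ^ nat \<bar>N a\<bar> * N a ^ r"
      by (simp add: sgn[OF a] right_diff_distrib)
  qed
  then show ?thesis using 1 unfolding sum_subtractf by (simp add: dvd_diff_right_iff)
qed

section \<open>Evaluation along curves, and closedness of the ideal powers\<close>

text \<open>Evaluation at \<open>v = exp (\<alpha> h)\<close>, \<open>K = exp (\<beta> h)\<close>.\<close>

definition exp_eval :: "rat \<Rightarrow> rat \<Rightarrow> laurent \<Rightarrow> rat fps" where
  "exp_eval \<alpha> \<beta> = lin_ext (\<lambda>k. fps_exp (\<alpha> * of_int (fst k) + \<beta> * of_int (snd k)))"

text \<open>Evaluation at \<open>v = (\<epsilon> exp h) ^ \<mu>\<close>, \<open>K = (\<epsilon> exp h) ^ p\<close> for a sign \<open>\<epsilon>\<close>: the restriction to a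
  parametrized curve through one of the four sign points. The coefficient of \<open>h ^ r\<close> is an integer divided by
  \<open>r!\<close>, which keeps track of 2-divisibility.\<close>

definition curve_eval :: "int \<Rightarrow> int \<Rightarrow> int \<Rightarrow> laurent \<Rightarrow> rat fps" where
  "curve_eval \<epsilon> \<mu> p = lin_ext (\<lambda>k. of_int (\<epsilon> ^ nat \<bar>\<mu> * fst k + p * snd k\<bar>) * fps_exp (of_int (\<mu> * fst k + p * snd k)))"

definition h_divides :: "nat \<Rightarrow> rat fps \<Rightarrow> bool" where
  "h_divides m F \<longleftrightarrow> (\<forall>r<m. fps_nth F r = 0)"

lemma curve_eval_mult: "\<epsilon> \<in> {1, -1} \<Longrightarrow> curve_eval \<epsilon> \<mu> p (f * g) = curve_eval \<epsilon> \<mu> p f * curve_eval \<epsilon> \<mu> p g"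
  unfolding curve_eval_def
proof (rule lin_ext_mult)
  fix a b :: "int \<times> int" assume "\<epsilon> \<in> {1, -1}"
  have *: "\<mu> * fst (a + b) + p * snd (a + b) = (\<mu> * fst a + p * snd a) + (\<mu> * fst b + p * snd b)"
    by (simp add: algebra_simps)
  show "of_int (\<epsilon> ^ nat \<bar>\<mu> * fst (a + b) + p * snd (a + b)\<bar>) * fps_exp (of_int (\<mu> * fst (a + b) + p * snd (a + b))) =
       of_int (\<epsilon> ^ nat \<bar>\<mu> * fst a + p * snd a\<bar>) * fps_exp (of_int (\<mu> * fst a + p * snd a)) *
       (of_int (\<epsilon> ^ nat \<bar>\<mu> * fst b + p * snd b\<bar>) * (fps_exp (of_int (\<mu> * fst b + p * snd b)) :: rat fps))"
    unfolding * sign_power_abs_add[OF \<open>\<epsilon> \<in> {1, -1}\<close>] of_int_add fps_exp_add_mult of_int_mult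
    by (simp only: mult_ac)
qed

lemma curve_eval_one: "curve_eval \<epsilon> \<mu> p 1 = 1"
  unfolding curve_eval_def by (rule lin_ext_one) simp

lemma curve_eval_power: "\<epsilon> \<in> {1, -1} \<Longrightarrow> curve_eval \<epsilon> \<mu> p (f ^ n) = curve_eval \<epsilon> \<mu> p f ^ n"
  by (induction n) (auto simp: curve_eval_one curve_eval_mult)

lemma curve_eval_sum: "curve_eval \<epsilon> \<mu> p (\<Sum>i\<in>A. f i) = (\<Sum>i\<in>A. curve_eval \<epsilon> \<mu> p (f i))"
  unfolding curve_eval_def by (rule lin_ext_sum)

lemma curve_eval_add: "curve_eval \<epsilon> \<mu> p (f + g) = curve_eval \<epsilon> \<mu> p f + curve_eval \<epsilon> \<mu> p g"
  unfolding curve_eval_def by (rule lin_ext_add)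

lemma curve_eval_diff: "curve_eval \<epsilon> \<mu> p (f - g) = curve_eval \<epsilon> \<mu> p f - curve_eval \<epsilon> \<mu> p g"
  unfolding curve_eval_def by (rule lin_ext_diff)

lemma fps_nth_of_int_mult: "fps_nth (of_int c * F) r = of_int c * (fps_nth F r :: 'a :: comm_ring_1)"
  by (metis fps_mult_left_const_nth fps_of_int)

lemma curve_eval_nth:
  "fps_nth (curve_eval \<epsilon> \<mu> p f) r = of_int (\<Sum>k\<in>Poly_Mapping.keys f. Poly_Mapping.lookup f k *
     \<epsilon> ^ nat \<bar>\<mu> * fst k + p * snd k\<bar> * (\<mu> * fst k + p * snd k) ^ r) / fact r"
proof -
  have "fps_nth (of_int c * (of_int s * fps_exp (of_int N))) r = of_int (c * s * N ^ r) / (fact r :: rat)" for c s N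
    by (simp only: fps_nth_of_int_mult fps_exp_nth) simp
  then show ?thesis
    by (simp only: curve_eval_def lin_ext_def fps_sum_nth of_int_sum sum_divide_distrib)
qed

text \<open>Up to rescaling \<open>h\<close>, the evaluation at \<open>v = exp (h/2)\<close>, \<open>K = exp (\<lambda>h/2)\<close> with \<open>\<lambda> = p / \<mu>\<close> is the
  restriction to a curve through \<open>(1, 1)\<close>.\<close>

lemma exp_eval_nth:
  assumes "\<mu> \<noteq> 0"
  shows "fps_nth (exp_eval (1/2) (of_int p / of_int \<mu> / 2) f) r = (1 / (2 * of_int \<mu>)) ^ r * fps_nth (curve_eval 1 \<mu> p f) r"
proof -
  have "((1/2) * of_int (fst k) + (of_int p / of_int \<mu> / 2) * of_int (snd k) :: rat)
     = (1 / (2 * of_int \<mu>)) * of_int (\<mu> * fst k + p * snd k)" for k :: "int \<times> int"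
    using assms by (simp add: field_simps)
  then show ?thesis
    unfolding exp_eval_def curve_eval_nth
    by (simp add: lin_ext_def fps_sum_nth fps_nth_of_int_mult power_mult_distrib power_divide sum_distrib_left
        sum_divide_distrib mult_ac)
qed

lemma h_divides_exp_eval:
  assumes "\<mu> \<noteq> 0"
  shows "h_divides m (exp_eval (1/2) (of_int p / of_int \<mu> / 2) f) \<longleftrightarrow> h_divides m (curve_eval 1 \<mu> p f)"
  unfolding h_divides_def exp_eval_nth[OF assms] using assms by simp

lemma h_divides_iff: "h_divides m F \<longleftrightarrow> (\<exists>G. F = fps_X ^ m * G)"
proof
  assume "h_divides m F"
  then have "F = fps_X ^ m * fps_shift m F"
    by (intro fps_ext) (auto simp: h_divides_def fps_X_power_mult_nth)
  then show "\<exists>G. F = fps_X ^ m * G" by blast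
qed (auto simp: h_divides_def fps_X_power_mult_nth)

lemma h_divides_mult: "h_divides m F \<Longrightarrow> h_divides m (G * F)"
  unfolding h_divides_iff by (metis mult.left_commute)

lemma h_divides_diff: "h_divides m F \<Longrightarrow> h_divides m G \<Longrightarrow> h_divides m (F - G)"
  by (auto simp: h_divides_def)

lemma h_divides_sum: "(\<And>i. i \<in> A \<Longrightarrow> h_divides m (F i)) \<Longrightarrow> h_divides m (\<Sum>i\<in>A. F i)"
  by (simp add: h_divides_def fps_sum_nth)

lemma h_divides_unit_cancel:
  assumes "fps_nth u 0 \<noteq> 0" "h_divides m (u * F)"
  shows "h_divides m F"
proof -
  have eq: "inverse u * (u * F) = F" using inverse_mult_eq_1[OF assms(1)] by (metis mult.assoc mult_1_left)
  show ?thesis using h_divides_mult[OF assms(2), of "inverse u"] by (simp only: eq)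
qed

lemma curve_eval_vK: "curve_eval \<epsilon> \<mu> p (vK a b) = of_int (\<epsilon> ^ nat \<bar>\<mu> * a + p * b\<bar>) * fps_exp (of_int (\<mu> * a + p * b))"
  by (simp add: curve_eval_def vK_def)

lemma curve_eval_gens:
  assumes "\<epsilon> \<in> {1, -1}"
  shows "curve_eval \<epsilon> \<mu> p v2_minus_1 = fps_exp (2 * of_int \<mu>) - 1" "curve_eval \<epsilon> \<mu> p K2_minus_1 = fps_exp (2 * of_int p) - 1"
proof -
  have "\<epsilon> ^ nat \<bar>n * 2\<bar> = 1" for n
    using assms by (auto simp: minus_one_power_iff even_nat_iff)
  then show "curve_eval \<epsilon> \<mu> p v2_minus_1 = fps_exp (2 * of_int \<mu>) - 1" "curve_eval \<epsilon> \<mu> p K2_minus_1 = fps_exp (2 * of_int p) - 1"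
    by (simp_all add: v2_minus_1_def K2_minus_1_def curve_eval_diff curve_eval_one curve_eval_vK mult.commute)
qed

lemma curve_eval_sign_ideal_h_divides:
  assumes "\<epsilon> \<in> {1, -1}" "f \<in> sign_ideal n"
  shows "h_divides n (curve_eval \<epsilon> \<mu> p f)"
  using assms(2)
proof (induction n arbitrary: f)
  case 0
  then show ?case by (simp add: h_divides_def)
next
  case (Suc n)
  obtain a b where *: "f = v2_minus_1 * a + K2_minus_1 * b" "a \<in> sign_ideal n" "b \<in> sign_ideal n"
    using Suc.prems by (auto elim!: sign_ideal_SucE)
  have "h_divides 1 (curve_eval \<epsilon> \<mu> p v2_minus_1)" "h_divides 1 (curve_eval \<epsilon> \<mu> p K2_minus_1)"
    using assms(1) by (simp_all add: h_divides_def curve_eval_gens)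
  with Suc.IH[OF *(2)] Suc.IH[OF *(3)] obtain F G H J where
    "curve_eval \<epsilon> \<mu> p v2_minus_1 = fps_X * F" "curve_eval \<epsilon> \<mu> p K2_minus_1 = fps_X * G"
    "curve_eval \<epsilon> \<mu> p a = fps_X ^ n * H" "curve_eval \<epsilon> \<mu> p b = fps_X ^ n * J"
    by (auto simp: h_divides_iff)
  then have "curve_eval \<epsilon> \<mu> p f = fps_X ^ Suc n * (F * H + G * J)"
    using assms(1) by (simp add: * curve_eval_add curve_eval_mult algebra_simps)
  then show ?case unfolding h_divides_iff by blast
qed

text \<open>Along the curve, \<open>v^2 - 1\<close> and \<open>K^2 - 1\<close> vanish at \<open>h = 0\<close>, with derivatives \<open>2 \<mu>\<close> and
  \<open>2 p\<close> there.\<close>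

lemma curve_eval_leading_coeff:
  assumes "\<epsilon> \<in> {1, -1}"
  shows "fps_nth (curve_eval \<epsilon> \<mu> p (\<Sum>i\<le>n. v2_minus_1 ^ i * K2_minus_1 ^ (n - i) * c i)) n
    = (\<Sum>i\<le>n. (2 * of_int \<mu>) ^ i * (2 * of_int p) ^ (n - i) * fps_nth (curve_eval \<epsilon> \<mu> p (c i)) 0)"
proof -
  define F where "F a = fps_shift 1 (fps_exp (2 * of_int a) - 1 :: rat fps)" for a
  have F: "fps_exp (2 * of_int a) - 1 = fps_X * F a" "fps_nth (F a) 0 = 2 * of_int a" for a
    unfolding F_def by (rule X_times_shift[symmetric]) simp_all
  have "curve_eval \<epsilon> \<mu> p (\<Sum>i\<le>n. v2_minus_1 ^ i * K2_minus_1 ^ (n - i) * c i)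
    = (\<Sum>i\<le>n. fps_X ^ n * (F \<mu> ^ i * F p ^ (n - i) * curve_eval \<epsilon> \<mu> p (c i)))"
    unfolding curve_eval_sum
  proof (rule sum.cong)
    fix i assume "i \<in> {..n}"
    then have X: "fps_X ^ n = (fps_X ^ i * fps_X ^ (n - i) :: rat fps)"
      by (metis power_add le_add_diff_inverse atMost_iff)
    show "curve_eval \<epsilon> \<mu> p (v2_minus_1 ^ i * K2_minus_1 ^ (n - i) * c i)
        = fps_X ^ n * (F \<mu> ^ i * F p ^ (n - i) * curve_eval \<epsilon> \<mu> p (c i))"
      unfolding curve_eval_mult[OF assms] curve_eval_power[OF assms] curve_eval_gens[OF assms] F(1) X
      by (simp only: power_mult_distrib mult_ac)
  qed simp
  then show ?thesis
    by (simp add: fps_sum_nth fps_X_power_mult_nth fps_power_zeroth F(2))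
qed

lemma curve_eval_nth_0:
  assumes "\<epsilon> \<in> {1, -1}"
  shows "fps_nth (curve_eval \<epsilon> \<mu> p f) 0 = of_int (at_signs (\<epsilon> ^ nat \<bar>\<mu>\<bar>) (\<epsilon> ^ nat \<bar>p\<bar>) f)"
  unfolding curve_eval_nth at_signs_def lin_ext_def using assms
  by (simp add: sign_power_abs_add abs_mult nat_mult_distrib power_mult del: insert_iff singleton_iff)

lemma polynomial_identity:
  fixes a :: "nat \<Rightarrow> int"
  assumes "infinite S" "\<And>p. p \<in> S \<Longrightarrow> (\<Sum>i\<le>n. a i * p ^ (n - i)) = 0" and "i \<le> n"
  shows "a i = 0"
proof -
  define Q where "Q = (\<Sum>k\<le>n. monom (a (n - k)) k)"
  have "poly Q p = (\<Sum>i\<le>n. a i * p ^ (n - i))" for p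
    unfolding Q_def poly_sum poly_monom
    by (rule sum.reindex_bij_witness[of _ "\<lambda>i. n - i" "\<lambda>i. n - i"]) auto
  then have "S \<subseteq> {p. poly Q p = 0}" using assms(2) by auto
  then have "Q = 0" using poly_roots_finite[of Q] assms(1) finite_subset by blast
  then have "coeff Q (n - i) = 0" by simp
  then show ?thesis using assms(3) by (simp add: Q_def coeff_sum)
qed

lemma infinite_parity_class: "infinite {p :: int. p \<ge> P \<and> (even p \<longleftrightarrow> b)}"
proof
  assume fin: "finite {p :: int. p \<ge> P \<and> (even p \<longleftrightarrow> b)}"
  define g where "g j = 2 * (\<bar>P\<bar> + int j) + (if b then 0 else 1)" for j
  have "range g \<subseteq> {p :: int. p \<ge> P \<and> (even p \<longleftrightarrow> b)}" by (auto simp: g_def)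
  moreover have "inj g" by (auto simp: g_def inj_def)
  ultimately show False using fin finite_subset range_inj_infinite by blast
qed

text \<open>Every sign point lies on one of the curves, with \<open>\<mu> \<le> 2\<close> and \<open>p\<close> ranging over a whole parity
  class: \<open>\<mu> = 2\<close> is needed only for \<open>(1, -1)\<close>, where the parameter must be \<open>-1\<close> with \<open>\<mu>\<close> even
  and \<open>p\<close> odd.\<close>

lemma sign_curve_eval:
  assumes "\<epsilon> \<in> {1, -1 :: int}" "\<delta> \<in> {1, -1 :: int}"
  obtains \<zeta> \<mu> b where "\<zeta> \<in> {1, -1}" "\<mu> \<in> {1, 2}"
    "\<And>p. (even p \<longleftrightarrow> b) \<Longrightarrow> \<zeta> ^ nat \<bar>\<mu>\<bar> = \<epsilon> \<and> \<zeta> ^ nat \<bar>p\<bar> = \<delta>"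
proof -
  consider "\<epsilon> = 1" "\<delta> = 1" | "\<epsilon> = -1" | "\<epsilon> = 1" "\<delta> = -1" using assms by auto
  then show ?thesis
  proof cases
    case 1 then show ?thesis using that[of 1 1 True] by simp
  next
    case 2 then show ?thesis
      using assms that[of "-1" 1 "\<delta> = 1"] by (auto simp: minus_one_power_iff even_nat_iff)
  next
    case 3 then show ?thesis
      using that[of "-1" 2 False] by (auto simp: minus_one_power_iff even_nat_iff)
  qed
qed

text \<open>A Laurent polynomial is in the \<open>n\<close>-th ideal power as soon as it vanishes to order \<open>n\<close> along the
  curves. By induction it is a form of degree \<open>n\<close> in \<open>v^2 - 1\<close> and \<open>K^2 - 1\<close>. Its leading
  coefficient along a curve is a polynomial in \<open>p\<close>, with infinitely many zeros since the values at a sign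
  point depend only on the parity of \<open>p\<close>; so the coefficients of the form vanish at all sign points and lie in the ideal.\<close>

lemma sign_ideal_criterion:
  assumes "\<And>\<epsilon> \<mu> p. \<epsilon> \<in> {1, -1} \<Longrightarrow> \<mu> \<in> {1, 2} \<Longrightarrow> p \<ge> P \<Longrightarrow> h_divides n (curve_eval \<epsilon> \<mu> p f)"
  shows "f \<in> sign_ideal n"
  using assms
proof (induction n)
  case (Suc n)
  have "f \<in> sign_ideal n" using Suc.prems by (intro Suc.IH) (auto simp: h_divides_def)
  then obtain c where c: "f = (\<Sum>i\<le>n. v2_minus_1 ^ i * K2_minus_1 ^ (n - i) * c i)" using sign_ideal_expand by blast
  have "c i \<in> sign_ideal 1" if i: "i \<le> n" for i
  proof (rule sign_ideal_1I)
    fix \<epsilon> \<delta> :: int assume "\<epsilon> \<in> {1, -1}" "\<delta> \<in> {1, -1}"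
    then obtain \<zeta> \<mu> b where z: "\<zeta> \<in> {1, -1}" and m: "\<mu> \<in> {1, 2}" and
      *: "\<And>p. (even p \<longleftrightarrow> b) \<Longrightarrow> \<zeta> ^ nat \<bar>\<mu>\<bar> = \<epsilon> \<and> \<zeta> ^ nat \<bar>p\<bar> = \<delta>"
      by (rule sign_curve_eval) blast
    define a where "a i = (2 * \<mu>) ^ i * 2 ^ (n - i) * at_signs \<epsilon> \<delta> (c i)" for i
    have "(\<Sum>i\<le>n. a i * p ^ (n - i)) = 0" if p: "p \<in> {p. p \<ge> P \<and> (even p \<longleftrightarrow> b)}" for p
    proof -
      have "0 = fps_nth (curve_eval \<zeta> \<mu> p f) n" using Suc.prems[OF z m] p by (simp add: h_divides_def)
      also have "\<dots> = of_int (\<Sum>i\<le>n. a i * p ^ (n - i))"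
        unfolding c curve_eval_leading_coeff[OF z] curve_eval_nth_0[OF z] using *[of p] p
        by (simp add: a_def power_mult_distrib mult_ac)
      finally show ?thesis by (metis of_int_0_eq_iff)
    qed
    from polynomial_identity[OF infinite_parity_class this i] have "a i = 0" .
    then show "at_signs \<epsilon> \<delta> (c i) = 0" using m by (auto simp: a_def)
  qed
  then have "v2_minus_1 ^ i * K2_minus_1 ^ (n - i) * c i \<in> sign_ideal (Suc n)" if "i \<le> n" for i
    using sign_ideal_prod[OF sign_ideal_generator_powers[of i "n - i"], of "c i" 1] that by simp
  then show ?case unfolding c by (intro sign_ideal_sum) auto
qed simp

text \<open>Closedness of the ideal powers for the topology of vanishing order at \<open>v = K = 1\<close>. On curves with
  \<open>\<epsilon> = 1\<close> the approximation is itself good enough. On curves with \<open>\<epsilon> = -1\<close> the coefficients of order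
  \<open>r < n\<close> of \<open>g\<close> vanish, so those of \<open>f\<close> equal those of \<open>f - g\<close>, which are divisible by ever higher
  powers of 2.\<close>

lemma sign_ideal_closed:
  assumes "\<And>m. \<exists>g\<in>sign_ideal n. \<forall>l\<ge>L. h_divides m (exp_eval (1/2) (l/2) (f - g))"
  shows "f \<in> sign_ideal n"
proof (rule sign_ideal_criterion[of "max 0 (2 * \<lceil>L\<rceil>)"])
  fix \<epsilon> \<mu> p :: int
  assume e: "\<epsilon> \<in> {1, -1}" and mu: "\<mu> \<in> {1, 2}" and p: "p \<ge> max 0 (2 * \<lceil>L\<rceil>)"
  have "L \<le> of_int \<lceil>L\<rceil>" by (rule le_of_int_ceiling)
  moreover have "2 * of_int \<lceil>L\<rceil> \<le> (of_int p :: rat)" using p by linarith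
  moreover have "0 \<le> (of_int p :: rat)" using p by simp
  ultimately have "L \<le> of_int p" "L \<le> of_int p / 2" by linarith+
  then have "of_int p / of_int \<mu> \<ge> L" using mu by auto
  have approx: "\<exists>g\<in>sign_ideal n. h_divides m (curve_eval 1 \<mu> p (f - g))" for m
    using assms[of m] \<open>of_int p / of_int \<mu> \<ge> L\<close> h_divides_exp_eval[of \<mu> m p] mu by force
  show "h_divides n (curve_eval \<epsilon> \<mu> p f)"
  proof (cases "\<epsilon> = 1")
    case True
    obtain g where g: "g \<in> sign_ideal n" "h_divides n (curve_eval 1 \<mu> p (f - g))" using approx by blast
    then show ?thesis using curve_eval_sign_ideal_h_divides[of 1 g n \<mu> p] True by (simp add: curve_eval_diff h_divides_def)
  next
    case False
    then have e: "\<epsilon> = -1" using e by simp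
    define T where "T h r = (\<Sum>k\<in>Poly_Mapping.keys h. Poly_Mapping.lookup h k *
     (-1) ^ nat \<bar>\<mu> * fst k + p * snd k\<bar> * (\<mu> * fst k + p * snd k) ^ r)" for h r
    have T: "fps_nth (curve_eval \<epsilon> \<mu> p h) r = of_int (T h r) / fact r" for h r
      unfolding curve_eval_nth T_def e ..
    have "T f r = 0" if r: "r < n" for r
    proof -
      have "2 ^ s dvd T f r" for s
      proof -
        obtain g where g: "g \<in> sign_ideal n" "h_divides (s + n) (curve_eval 1 \<mu> p (f - g))" using approx by blast
        have "h_divides n (curve_eval \<epsilon> \<mu> p g)" using curve_eval_sign_ideal_h_divides[of \<epsilon> g n \<mu> p] g(1) e by simp
        then have "T g r = 0" using T[of g r] r by (simp add: h_divides_def)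
        moreover have "fps_nth (curve_eval \<epsilon> \<mu> p (f - g)) r = fps_nth (curve_eval \<epsilon> \<mu> p f) r - fps_nth (curve_eval \<epsilon> \<mu> p g) r"
          by (simp add: curve_eval_diff)
        then have "(of_int (T (f - g) r) :: rat) = of_int (T f r - T g r)" 
          by (simp add: T diff_divide_distrib[symmetric])
        then have "T (f - g) r = T f r - T g r" by (simp only: of_int_eq_iff)
        moreover have "2 ^ (s + n - r) dvd T (f - g) r"
          unfolding T_def
        proof (rule alternating_moment_dvd)
          fix q assume "q < s + n"
          then show "(\<Sum>k\<in>Poly_Mapping.keys (f - g). Poly_Mapping.lookup (f - g) k * (\<mu> * fst k + p * snd k) ^ q) = 0"
            using g(2) unfolding h_divides_def curve_eval_nth
            by (simp del: of_int_sum)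
        qed (use r in auto)
        moreover have "(2 :: int) ^ s dvd 2 ^ (s + n - r)" using r by (intro le_imp_power_dvd) simp
        ultimately show ?thesis by (simp add: dvd_trans)
      qed
      from this[of "nat \<bar>T f r\<bar>"] show ?thesis
      proof (rule contrapos_pp)
        assume "T f r \<noteq> 0"
        moreover have "\<bar>T f r\<bar> < 2 ^ nat \<bar>T f r\<bar>" using of_nat_less_two_power[of "nat \<bar>T f r\<bar>", where 'a = int] by simp
        ultimately show "\<not> 2 ^ nat \<bar>T f r\<bar> dvd T f r" using dvd_imp_le_int[of "T f r" "2 ^ nat \<bar>T f r\<bar>"] by (auto simp del: dvd_refl)
      qed
    qed
    then show ?thesis by (simp add: h_divides_def T)
  qed
qed

section \<open>Quantum numbers with rational argument\<close>

text \<open>The quantum number \<open>[\<alpha>]\<close>, that is, \<open>exp (\<alpha>h/2) - exp (-\<alpha>h/2)\<close> divided by \<open>v - v^-1\<close>; as in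
  the definition of \<open>free_K_quot\<close>, both are divided by \<open>h\<close> first.\<close>

definition qnum :: "rat \<Rightarrow> rat fps" where
  "qnum \<alpha> = inverse (fps_shift 1 (v - inverse v)) * fps_shift 1 (fps_exp (\<alpha>/2) - fps_exp (- \<alpha>/2))"

lemma v_minus_inverse: "v - inverse v = fps_exp (1/2) - fps_exp (- 1/2)"
  by (simp add: v_def flip: fps_exp_neg)

lemma v_diff_neq_0: "v - inverse v \<noteq> 0"
proof
  assume "v - inverse v = 0"
  then have "fps_nth (v - inverse v) 1 = 0" by simp
  then show False by (simp add: v_nth)
qed

lemma qnum: "(v - inverse v) * qnum \<alpha> = fps_exp (\<alpha>/2) - fps_exp (- \<alpha>/2)"
proof -
  let ?s = "fps_shift 1 (v - inverse v)"
  have 1: "fps_X * ?s = v - inverse v"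
    by (rule X_times_shift) (simp add: v_nth)
  have 2: "fps_X * fps_shift 1 (fps_exp (\<alpha>/2) - fps_exp (- \<alpha>/2)) = fps_exp (\<alpha>/2) - fps_exp (- \<alpha>/2)"
    by (rule X_times_shift) simp
  have 3: "?s * inverse ?s = 1"
    by (rule inverse_mult_eq_1') (simp add: v_nth)
  have "(v - inverse v) * qnum \<alpha> = (?s * inverse ?s) * (fps_X * fps_shift 1 (fps_exp (\<alpha>/2) - fps_exp (- \<alpha>/2)))"
    by (subst 1[symmetric]) (simp only: qnum_def mult_ac)
  then show ?thesis by (simp only: 2 3 mult_1_left)
qed

lemma qnum_eqI: "(v - inverse v) * F = fps_exp (\<alpha>/2) - fps_exp (- \<alpha>/2) \<Longrightarrow> F = qnum \<alpha>"
  using v_diff_neq_0 by (metis qnum mult_left_cancel)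

lemma qnum_1: "qnum 1 = 1"
  by (rule qnum_eqI[symmetric]) (simp add: v_minus_inverse)

text \<open>The identity behind the Verma module: it says that \<open>EF - FE\<close> acts on a basis vector by
  the quantum number of its weight.\<close>

lemma qnum_shift:
  "qnum (a + 1) * qnum (l - a) - qnum a * qnum (l - a + 1) = qnum (l - 2 * a)"
proof (rule qnum_eqI)
  let ?D = "v - inverse v"
  have dist: "d * (d * (A * B - C * G)) = (d * A) * (d * B) - (d * C) * (d * G)" for d A B C G :: "rat fps"
    by (simp add: algebra_simps)
  have "?D * (?D * (qnum (a + 1) * qnum (l - a) - qnum a * qnum (l - a + 1)))
    = (?D * qnum (a + 1)) * (?D * qnum (l - a)) - (?D * qnum a) * (?D * qnum (l - a + 1))"
    by (rule dist)
  also have "\<dots> = ?D * (fps_exp ((l - 2 * a)/2) - fps_exp (- (l - 2 * a)/2))"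
    unfolding qnum unfolding v_minus_inverse
    by (simp add: algebra_simps add_divide_distrib diff_divide_distrib flip: fps_exp_add_mult)
  finally show "?D * (qnum (a + 1) * qnum (l - a) - qnum a * qnum (l - a + 1))
     = fps_exp ((l - 2 * a)/2) - fps_exp (- (l - 2 * a)/2)"
    using v_diff_neq_0 mult_left_cancel by blast
qed

section \<open>Verma modules\<close>

text \<open>Coordinates with respect to the basis \<open>m 0, m 1, \<dots>\<close> of the Verma module with highest weight
  \<open>l\<close>, where \<open>F (m j) = m (j + 1)\<close> and \<open>E (m (j + 1)) = [j + 1] [l - j] m j\<close>. Infinite sums of
  basis vectors are allowed, which is harmless because \<open>H\<close>, \<open>E\<close> and \<open>F\<close> act by matrices with
  finitely many entries in each row. Rational weights are needed, since the half-integral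
  ones carry information about the point \<open>v = 1\<close>, \<open>K = -1\<close>.\<close>

type_synonym verma = "nat \<Rightarrow> rat fps"

definition weight_E :: "rat \<Rightarrow> nat \<Rightarrow> rat fps" where
  "weight_E l j = qnum (of_nat j + 1) * qnum (l - of_nat j)"

fun act_gen :: "rat \<Rightarrow> gen \<Rightarrow> verma \<Rightarrow> verma" where
  "act_gen l GenH a = (\<lambda>j. fps_const (l - 2 * of_nat j) * a j)"
| "act_gen l GenE a = (\<lambda>j. weight_E l j * a (Suc j))"
| "act_gen l GenF a = (\<lambda>j. if j = 0 then 0 else a (j - 1))"

fun act_word :: "rat \<Rightarrow> word \<Rightarrow> verma \<Rightarrow> verma" where
  "act_word l (Word xs) = foldr (act_gen l) xs"

lemma act_word_add: "act_word l (x + y) a = act_word l x (act_word l y a)"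
  by (cases x; cases y) simp

lemma act_word_0: "act_word l 0 a = a"
  by (simp add: zero_word_def)

definition lin_op :: "(verma \<Rightarrow> verma) \<Rightarrow> bool" where
  "lin_op T \<longleftrightarrow> (\<forall>a b. T (\<lambda>j. a j + b j) = (\<lambda>j. T a j + T b j)) \<and> (\<forall>c a. T (\<lambda>j. c * a j) = (\<lambda>j. c * T a j))"

lemma lin_op_add: "lin_op T \<Longrightarrow> T (\<lambda>j. a j + b j) = (\<lambda>j. T a j + T b j)"
  and lin_op_scale: "lin_op T \<Longrightarrow> T (\<lambda>j. c * a j) = (\<lambda>j. c * T a j)"
  by (auto simp: lin_op_def)

lemma lin_op_zero: "lin_op T \<Longrightarrow> T (\<lambda>j. 0) = (\<lambda>j. 0)"
  using lin_op_scale[of T 0 "\<lambda>j. 0"] by simp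

lemma lin_op_gen: "lin_op (act_gen l g)"
  by (cases g) (auto simp: lin_op_def algebra_simps)

lemma lin_op_word: "lin_op (act_word l w)"
proof (cases w)
  case (Word xs)
  have "lin_op (foldr (act_gen l) xs)"
  proof (induction xs)
    case (Cons g xs)
    then show ?case using lin_op_gen[of l g] by (simp add: lin_op_def)
  qed (simp add: lin_op_def)
  then show ?thesis by (simp add: Word)
qed

definition act_poly :: "rat \<Rightarrow> free_alg \<Rightarrow> verma \<Rightarrow> verma" where
  "act_poly l x a = (\<lambda>j. \<Sum>w\<in>Poly_Mapping.keys x. fps_const (Poly_Mapping.lookup x w) * act_word l w a j)"

lemma act_poly_superset:
  "finite A \<Longrightarrow> Poly_Mapping.keys x \<subseteq> A \<Longrightarrow>
    act_poly l x a = (\<lambda>j. \<Sum>w\<in>A. fps_const (Poly_Mapping.lookup x w) * act_word l w a j)"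
  unfolding act_poly_def by (intro ext sum.mono_neutral_left) (auto simp: in_keys_iff)

lemma act_poly_zero [simp]: "act_poly l 0 a = (\<lambda>j. 0)"
  by (simp add: act_poly_def)

lemma act_poly_add: "act_poly l (x + y) a = (\<lambda>j. act_poly l x a j + act_poly l y a j)"
proof -
  let ?A = "Poly_Mapping.keys x \<union> Poly_Mapping.keys y"
  have "finite ?A" "Poly_Mapping.keys (x + y) \<subseteq> ?A" by (auto dest!: keys_add[THEN subsetD])
  then show ?thesis
    by (simp add: act_poly_superset[of ?A] lookup_add distrib_right sum.distrib flip: fps_const_add)
qed

lemma act_poly_single: "act_poly l (Poly_Mapping.single w c) a = (\<lambda>j. fps_const c * act_word l w a j)"
  by (auto simp: act_poly_def)

lemma act_poly_sum: "act_poly l (\<Sum>i\<in>A. x i) a = (\<lambda>j. \<Sum>i\<in>A. act_poly l (x i) a j)"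
  by (induction A rule: infinite_finite_induct) (auto simp: act_poly_add)

lemma lin_op_poly: "lin_op (act_poly l x)"
  using lin_op_word[of l]
  by (auto simp: lin_op_def act_poly_def distrib_left sum.distrib sum_distrib_left mult_ac)

lemma act_poly_mult: "act_poly l (x * y) a = act_poly l x (act_poly l y a)"
proof (induction x rule: poly_mapping_additive_induct)
  case (single w c)
  show ?case
  proof (induction y rule: poly_mapping_additive_induct)
    case zero
    show ?case by (simp add: lin_op_zero lin_op_poly)
  next
    case (single w' c')
    show ?case
      by (simp add: mult_single act_poly_single act_word_add lin_op_scale[OF lin_op_word] mult.assoc
          flip: fps_const_mult)
  next
    case (add y z)
    then show ?case by (simp add: distrib_left act_poly_add lin_op_add[OF lin_op_poly])
  qed
qed (simp_all add: distrib_right act_poly_add)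

lemma act_poly_one: "act_poly l 1 a = a"
  using act_poly_single[of l 0 1 a] by (simp add: act_word_0)

text \<open>The sum of the terms \<open>h ^ n * b n\<close>.\<close>

definition h_series :: "(nat \<Rightarrow> verma) \<Rightarrow> verma" where
  "h_series b = (\<lambda>j. Abs_fps (\<lambda>N. \<Sum>n\<le>N. fps_nth (b n j) (N - n)))"

lemma h_series_rec: "h_series b = (\<lambda>j. b 0 j + fps_X * h_series (\<lambda>n. b (Suc n)) j)"
proof (intro ext fps_ext)
  fix j N show "fps_nth (h_series b j) N = fps_nth (b 0 j + fps_X * h_series (\<lambda>n. b (Suc n)) j) N"
    by (cases N) (simp_all add: h_series_def sum.atMost_Suc_shift del: sum.atMost_Suc)
qed

text \<open>Linearity over power series in \<open>h\<close> already implies \<open>h\<close>-adic continuity: splitting off the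
  first term leaves \<open>h\<close> times another series, so the coefficients can be compared one by one.\<close>

lemma lin_op_h_series:
  assumes "lin_op T"
  shows "T (h_series b) = h_series (\<lambda>n. T (b n))"
proof -
  have "fps_nth (T (h_series b) j) N = fps_nth (h_series (\<lambda>n. T (b n)) j) N" for j N
  proof (induction N arbitrary: b)
    case 0
    show ?case
      by (subst h_series_rec, subst (2) h_series_rec) (simp add: lin_op_add[OF assms] lin_op_scale[OF assms])
  next
    case (Suc N)
    show ?case
      by (subst h_series_rec, subst (2) h_series_rec)
        (simp add: lin_op_add[OF assms] lin_op_scale[OF assms] Suc)
  qed
  then show ?thesis by (intro ext fps_ext)
qed

lemma h_series_nested: "h_series (\<lambda>n. h_series (c n)) = h_series (\<lambda>s j. \<Sum>n\<le>s. c n (s - n) j)"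
proof (intro ext fps_ext)
  fix j N
  have "(\<Sum>n\<le>N. \<Sum>k\<le>N - n. fps_nth (c n k j) (N - n - k)) = (\<Sum>s\<le>N. \<Sum>n\<le>s. fps_nth (c n (s - n) j) (N - s))"
    unfolding sum.Sigma[OF finite_atMost ballI[OF finite_atMost]]
    by (rule sum.reindex_bij_witness[of _ "\<lambda>(s, n). (n, s - n)" "\<lambda>(n, k). (n + k, n)"]) auto
  then show "fps_nth (h_series (\<lambda>n. h_series (c n)) j) N = fps_nth (h_series (\<lambda>s j. \<Sum>n\<le>s. c n (s - n) j) j) N"
    by (simp add: h_series_def fps_sum_nth)
qed

definition act :: "rat \<Rightarrow> free_alg fps \<Rightarrow> verma \<Rightarrow> verma" where
  "act l x a = h_series (\<lambda>n. act_poly l (fps_nth x n) a)"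

lemma act_nth: "fps_nth (act l x a j) N = (\<Sum>n\<le>N. fps_nth (act_poly l (fps_nth x n) a j) (N - n))"
  by (simp add: act_def h_series_def)

lemma act_add: "act l (x + y) a = (\<lambda>j. act l x a j + act l y a j)"
  by (intro ext fps_ext) (simp add: act_nth act_poly_add sum.distrib)

lemma act_zero [simp]: "act l 0 a = (\<lambda>j. 0)"
  by (intro ext fps_ext) (simp add: act_nth)

lemma act_uminus: "act l (- x) a = (\<lambda>j. - act l x a j)"
  using act_add[of l x "- x" a] by (simp add: fun_eq_iff eq_neg_iff_add_eq_0 add.commute)

lemma act_diff: "act l (x - y) a = (\<lambda>j. act l x a j - act l y a j)"
  using act_add[of l x "- y" a] by (simp add: act_uminus)

lemma act_mult: "act l (x * y) a = act l x (act l y a)"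
proof -
  have "act l x (act l y a) = h_series (\<lambda>n. h_series (\<lambda>k. act_poly l (fps_nth x n * fps_nth y k) a))"
    unfolding act_def[of l x] by (simp add: act_def lin_op_h_series[OF lin_op_poly] act_poly_mult)
  also have "\<dots> = act l (x * y) a"
    unfolding h_series_nested act_def
    by (simp add: fps_mult_nth act_poly_sum atMost_atLeast0)
  finally show ?thesis by simp
qed

lemma lin_op_act: "lin_op (act l x)"
proof -
  have add: "act l x (\<lambda>j. a j + b j) = (\<lambda>j. act l x a j + act l x b j)" for a b
    by (intro ext fps_ext) (simp add: act_nth lin_op_add[OF lin_op_poly] sum.distrib)
  have "lin_op (\<lambda>a j. c * a j)" for c
    by (auto simp: lin_op_def algebra_simps)
  from lin_op_h_series[OF this] have scale: "act l x (\<lambda>j. c * a j) = (\<lambda>j. c * act l x a j)" for c a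
    by (simp add: act_def lin_op_scale[OF lin_op_poly])
  show ?thesis using add scale by (simp add: lin_op_def)
qed

lemma act_const: "act l (fps_const p) a = act_poly l p a"
proof (intro ext fps_ext)
  fix j N
  have "fps_nth (act l (fps_const p) a j) N = (\<Sum>n\<le>N. if n = 0 then fps_nth (act_poly l p a j) N else 0)"
    unfolding act_nth by (rule sum.cong) auto
  then show "fps_nth (act l (fps_const p) a j) N = fps_nth (act_poly l p a j) N" by simp
qed

lemma act_diagonal:
  assumes "\<And>n. act_poly l (fps_nth x n) a j = fps_const (fps_nth f n) * a j"
  shows "act l x a j = f * a j"
  by (rule fps_ext) (simp add: act_nth assms fps_mult_nth[of f] atMost_atLeast0)

lemma act_one: "act l 1 a = a"
  using act_const[of l 1 a] by (simp add: act_poly_one)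

lemma act_gens:
  "act l free_H a = act_gen l GenH a" "act l free_E a = act_gen l GenE a" "act l free_F a = act_gen l GenF a"
  by (simp_all add: free_H_def free_E_def free_F_def act_const gen_elem_def act_poly_single)

lemma act_scalar: "act l (scalar f) a j = f * a j"
  by (rule act_diagonal) (simp add: scalar_def act_poly_single act_word_0)

lemma act_poly_H_power:
  "act_poly l (Poly_Mapping.single 0 c * gen_elem GenH ^ n) a j = fps_const (c * (l - 2 * of_nat j) ^ n) * a j"
proof -
  have "act_poly l (gen_elem GenH ^ n) a j = fps_const ((l - 2 * of_nat j) ^ n) * a j" for j
  proof (induction n arbitrary: j)
    case 0
    show ?case by (simp add: act_poly_one)
  next
    case (Suc n)
    have "act_poly l (gen_elem GenH) b j = fps_const (l - 2 * of_nat j) * b j" for b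
      by (simp add: gen_elem_def act_poly_single)
    then show ?case by (simp add: act_poly_mult Suc flip: fps_const_mult mult.assoc)
  qed
  then show ?thesis
    by (simp add: act_poly_mult act_poly_single act_word_0 flip: fps_const_mult mult.assoc)
qed

lemma act_exp_hH: "act l (exp_hH c) a j = fps_exp (c * (l - 2 * of_nat j)) * a j"
  by (rule act_diagonal) (simp add: exp_hH_def act_poly_H_power power_mult_distrib)

lemma act_K_quot: "act l free_K_quot a j = qnum (l - 2 * of_nat j) * a j"
proof -
  let ?d = "l - 2 * of_nat j :: rat"
  have "act l (fps_shift 1 (free_K - free_K_inv)) a j = fps_shift 1 (fps_exp (?d/2) - fps_exp (- ?d/2)) * a j"
  proof (rule act_diagonal)
    fix n
    have "fps_nth (fps_shift 1 (free_K - free_K_inv)) n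
        = Poly_Mapping.single 0 ((1/2) ^ Suc n / fact (Suc n) - (- 1/2) ^ Suc n / fact (Suc n)) * gen_elem GenH ^ Suc n"
      unfolding single_diff left_diff_distrib
      by (simp add: free_K_def free_K_inv_def exp_hH_def del: power_Suc fact_Suc)
    also have "act_poly l \<dots> a j = fps_const (fps_nth (fps_shift 1 (fps_exp (?d/2) - fps_exp (- ?d/2))) n) * a j"
    proof -
      have "(x ^ m / q - y ^ m / q) * d ^ m = (x * d) ^ m / q - (y * d) ^ m / q" for x y d q :: rat and m
        by (simp add: power_mult_distrib left_diff_distrib)
      from this[of "1/2" "Suc n" "fact (Suc n)" "- 1/2" ?d] show ?thesis
        unfolding act_poly_H_power by (simp del: power_Suc fact_Suc minus_diff_eq)
    qed
    finally show "act_poly l (fps_nth (fps_shift 1 (free_K - free_K_inv)) n) a j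
      = fps_const (fps_nth (fps_shift 1 (fps_exp (?d/2) - fps_exp (- ?d/2))) n) * a j" .
  qed
  then show ?thesis by (simp add: free_K_quot_def act_mult act_scalar qnum_def mult.assoc)
qed

lemma act_relations:
  assumes "r \<in> Uh_relations"
  shows "act l r a = (\<lambda>j. 0)"
proof -
  have two: "act l 2 b = (\<lambda>j. 2 * b j)" for b
    using act_add[of l 1 1 b] by (simp add: act_one)
  have "act l (free_H * free_E - free_E * (free_H + 2)) a j = 0" for j
  proof -
    define c d where "c = fps_const (l - 2 * of_nat (Suc j))" and "d = fps_const (l - 2 * of_nat j)"
    have d: "d = c + 2"
      by (simp add: c_def d_def numeral_fps_const)
    have "act l (free_H * free_E - free_E * (free_H + 2)) a j
        = d * (weight_E l j * a (Suc j)) - weight_E l j * (c * a (Suc j) + 2 * a (Suc j))"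
      by (simp add: act_diff act_mult act_gens act_add two c_def d_def del: of_nat_Suc)
    then show ?thesis by (simp add: d algebra_simps)
  qed
  moreover have "act l (free_H * free_F - free_F * (free_H - 2)) a j = 0" for j
  proof (cases j)
    case (Suc i)
    define c d where "c = fps_const (l - 2 * of_nat j)" and "d = fps_const (l - 2 * of_nat i)"
    have c: "c = d - 2"
      by (simp add: c_def d_def Suc numeral_fps_const)
    have "act l (free_H * free_F - free_F * (free_H - 2)) a j = c * a i - (d * a i - 2 * a i)"
      by (simp add: Suc act_diff act_mult act_gens two c_def d_def del: of_nat_Suc)
    then show ?thesis by (simp add: c algebra_simps)
  qed (simp add: act_diff act_mult act_gens two)
  moreover have "act l (free_E * free_F - free_F * free_E - free_K_quot) a j = 0" for j
  proof (cases j)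
    case 0
    then show ?thesis
      by (simp add: act_diff act_mult act_gens act_K_quot weight_E_def qnum_1)
  next
    case (Suc i)
    have "act l (free_E * free_F - free_F * free_E - free_K_quot) a j
        = weight_E l j * a j - weight_E l i * a j - qnum (l - 2 * of_nat j) * a j"
      by (simp add: Suc act_diff act_mult act_gens act_K_quot del: of_nat_Suc)
    also have "weight_E l i = qnum (of_nat j) * qnum (l - of_nat j + 1)"
      by (simp add: weight_E_def Suc add.commute)
    also have "weight_E l j = qnum (of_nat j) * qnum (l - of_nat j + 1) + qnum (l - 2 * of_nat j)"
      using qnum_shift[of "of_nat j" l] by (simp add: weight_E_def diff_eq_eq add.commute)
    finally show ?thesis by (simp add: algebra_simps)
  qed
  ultimately show ?thesis using assms by (auto simp: Uh_relations_def)
qed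

lemma act_genideal:
  assumes "x \<in> genideal free_ring Uh_relations"
  shows "act l x a = (\<lambda>j. 0)"
proof -
  define J where "J = {x. \<forall>a. act l x a = (\<lambda>j. 0)}"
  have "ideal J free_ring"
  proof (rule idealI)
    show "ring free_ring" by (rule free.ring_axioms)
    show "subgroup J (add_monoid free_ring)"
      by (rule free.add.subgroupI) (auto simp: J_def act_add act_uminus intro: exI[of _ 0])
  qed (auto simp: J_def act_mult lin_op_zero[OF lin_op_act])
  moreover have "Uh_relations \<subseteq> J" using act_relations by (auto simp: J_def)
  ultimately have "genideal free_ring Uh_relations \<subseteq> J" by (rule free.genideal_minimal)
  then show ?thesis using assms by (auto simp: J_def)
qed

text \<open>A coefficient of the action depends on finitely many coefficients of the acting element, so that the
  action factors through the \<open>h\<close>-adic closure of the ideal of relations.\<close>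

lemma act_Uh_ideal:
  assumes "x \<in> Uh_ideal"
  shows "act l x a = (\<lambda>j. 0)"
proof (intro ext fps_ext)
  fix j N
  obtain y where y: "y \<in> genideal free_ring Uh_relations" "\<forall>k<Suc N. fps_nth x k = fps_nth y k"
    using assms by (auto simp: Uh_ideal_def)
  then have "fps_nth (act l x a j) N = fps_nth (act l y a j) N" by (simp add: act_nth)
  then show "fps_nth (act l x a j) N = fps_nth 0 N" using act_genideal[OF y(1)] by simp
qed

lemma one_notin_Uh_ideal: "1 \<notin> Uh_ideal"
proof
  assume "1 \<in> Uh_ideal"
  from act_Uh_ideal[OF this, of 0 "\<lambda>_. 1"] have "(\<lambda>_. 1 :: rat fps) = (\<lambda>_ :: nat. 0)" by (simp add: act_one)
  then show False by (simp add: fun_eq_iff)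
qed

section \<open>The quantized enveloping algebra as a type\<close>

text \<open>\<open>U\<^sub>h\<close> as a type of class \<open>ring_1\<close>, where the simplifier can calculate without carriers. The
  class requires \<open>0 \<noteq> 1\<close>, which is known because Verma modules are nonzero.\<close>

typedef uh = "carrier Uh" morphisms rep_uh abs_uh
  by (auto intro: exI[of _ "to_Uh 0"])

instantiation uh :: ring_1
begin

definition zero_uh :: uh where "0 = abs_uh \<zero>\<^bsub>Uh\<^esub>"
definition one_uh :: uh where "1 = abs_uh \<one>\<^bsub>Uh\<^esub>"
definition plus_uh :: "uh \<Rightarrow> uh \<Rightarrow> uh" where "x + y = abs_uh (rep_uh x \<oplus>\<^bsub>Uh\<^esub> rep_uh y)"
definition times_uh :: "uh \<Rightarrow> uh \<Rightarrow> uh" where "x * y = abs_uh (rep_uh x \<otimes>\<^bsub>Uh\<^esub> rep_uh y)"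
definition uminus_uh :: "uh \<Rightarrow> uh" where "- x = abs_uh (\<ominus>\<^bsub>Uh\<^esub> rep_uh x)"
definition minus_uh :: "uh \<Rightarrow> uh \<Rightarrow> uh" where "x - y = x + (- y :: uh)"

lemma rep_uh_0: "rep_uh 0 = \<zero>\<^bsub>Uh\<^esub>"
  and rep_uh_1: "rep_uh 1 = \<one>\<^bsub>Uh\<^esub>"
  and rep_uh_add: "rep_uh (x + y) = rep_uh x \<oplus>\<^bsub>Uh\<^esub> rep_uh y"
  and rep_uh_mult: "rep_uh (x * y) = rep_uh x \<otimes>\<^bsub>Uh\<^esub> rep_uh y"
  and rep_uh_uminus: "rep_uh (- x) = \<ominus>\<^bsub>Uh\<^esub> rep_uh x"
  using rep_uh[of x] rep_uh[of y]
  by (simp_all add: zero_uh_def one_uh_def plus_uh_def times_uh_def uminus_uh_def abs_uh_inverse)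

lemma one_neq_zero_Uh: "\<one>\<^bsub>Uh\<^esub> \<noteq> \<zero>\<^bsub>Uh\<^esub>"
  using to_Uh_eq_iff[of 1 0] one_notin_Uh_ideal by (simp add: to_Uh_0 to_Uh_1)

instance
proof
  fix a b c :: uh
  note reps = rep_uh_0 rep_uh_1 rep_uh_add rep_uh_mult rep_uh_uminus rep_uh_inject[symmetric]
  note cl = rep_uh[of a] rep_uh[of b] rep_uh[of c]
  show "a * b * c = a * (b * c)" "1 * a = a" "a * 1 = a" "a + b + c = a + (b + c)"
    "0 + a = a" "- a + a = 0" "(a + b) * c = a * c + b * c" "a * (b + c) = a * b + a * c"
    using cl by (simp_all add: reps Uh.m_assoc Uh.a_assoc Uh.l_neg Uh.l_distr Uh.r_distr)
  show "a + b = b + a"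
    using cl by (simp add: reps Uh.a_comm)
  show "a - b = a + - b" by (simp add: minus_uh_def)
  show "(0 :: uh) \<noteq> 1" using one_neq_zero_Uh by (simp add: reps)
qed

end

lemma rep_uh_diff: "rep_uh (x - y) = rep_uh x \<ominus>\<^bsub>Uh\<^esub> rep_uh y"
  by (simp only: minus_uh_def rep_uh_add rep_uh_uminus a_minus_def)

definition to_uh :: "free_alg fps \<Rightarrow> uh" where "to_uh x = abs_uh (to_Uh x)"

lemma rep_to_uh: "rep_uh (to_uh x) = to_Uh x"
  by (simp add: to_uh_def abs_uh_inverse)

lemma to_uh_add: "to_uh (x + y) = to_uh x + to_uh y"
  and to_uh_mult: "to_uh (x * y) = to_uh x * to_uh y"
  and to_uh_diff: "to_uh (x - y) = to_uh x - to_uh y"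
  and to_uh_0: "to_uh 0 = 0" and to_uh_1: "to_uh 1 = 1"
  by (simp_all add: rep_uh_inject[symmetric] rep_to_uh rep_uh_0 rep_uh_1 rep_uh_add rep_uh_mult
      rep_uh_uminus rep_uh_diff to_Uh_add to_Uh_mult to_Uh_uminus to_Uh_diff to_Uh_0 to_Uh_1)

lemma to_uh_power: "to_uh (x ^ n) = to_uh x ^ n"
  by (induction n) (simp_all add: to_uh_1 to_uh_mult)

lemma to_uh_eq_iff: "to_uh x = to_uh y \<longleftrightarrow> x - y \<in> Uh_ideal"
  by (simp add: rep_uh_inject[symmetric] rep_to_uh to_Uh_eq_iff)

lemma to_uh_surj: "\<exists>y. x = to_uh y"
proof -
  obtain y where "rep_uh x = to_Uh y" using rep_uh[of x] by (auto simp: carrier_Uh)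
  then show ?thesis by (metis rep_to_uh rep_uh_inject)
qed

definition uh_scalar :: "rat fps \<Rightarrow> uh" where "uh_scalar f = to_uh (scalar f)"

lemma uh_scalar_add: "uh_scalar (f + g) = uh_scalar f + uh_scalar g" and uh_scalar_mult: "uh_scalar (f * g) = uh_scalar f * uh_scalar g" and uh_scalar_1: "uh_scalar 1 = 1"
  by (simp_all add: uh_scalar_def scalar_add scalar_mult scalar_1 to_uh_add to_uh_mult to_uh_1)

lemma uh_scalar_0: "uh_scalar 0 = 0"
  using uh_scalar_add[of 0 0] by simp

lemma uh_scalar_uminus: "uh_scalar (- f) = - uh_scalar f"
  using uh_scalar_add[of "- f" f] by (simp add: uh_scalar_0 eq_neg_iff_add_eq_0)

lemma uh_scalar_of_int: "uh_scalar (of_int c) = of_int c"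
proof -
  have "uh_scalar (of_nat n) = of_nat n" for n
    by (induction n) (simp_all add: uh_scalar_0 uh_scalar_add uh_scalar_1)
  then show ?thesis by (cases c rule: int_cases2) (simp_all add: uh_scalar_uminus)
qed

lemma single_0_central: "Poly_Mapping.single 0 (c :: rat) * a = a * Poly_Mapping.single (0 :: word) c"
  by (induction a rule: poly_mapping_additive_induct) (auto simp: mult_single distrib_left distrib_right mult.commute)

lemma single_0_left_comm:
  "a * (Poly_Mapping.single (0 :: word) (c :: rat) * b) = Poly_Mapping.single 0 c * (a * b)"
  unfolding mult.assoc[symmetric] by (simp only: single_0_central[of c a])

lemma scalar_central: "scalar f * x = x * scalar f"
proof (rule fps_ext)
  fix n
  have "(\<Sum>i\<le>n. fps_nth (scalar f) i * fps_nth x (n - i)) = (\<Sum>i\<le>n. fps_nth x i * fps_nth (scalar f) (n - i))"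
    by (rule sum.reindex_bij_witness[of _ "\<lambda>i. n - i" "\<lambda>i. n - i"]) (auto simp: scalar_def single_0_central)
  then show "fps_nth (scalar f * x) n = fps_nth (x * scalar f) n"
    by (simp add: fps_mult_nth atMost_atLeast0)
qed

lemma uh_scalar_comm: "uh_scalar f * x = x * uh_scalar f"
  using to_uh_surj[of x] by (auto simp: uh_scalar_def scalar_central simp flip: to_uh_mult)

lemma uh_scalar_left_comm: "x * (uh_scalar f * y) = uh_scalar f * (x * y)"
  by (metis mult.assoc uh_scalar_comm)

section \<open>Exponentials of \<open>H\<close> and their commutation with \<open>E\<close> and \<open>F\<close>\<close>

lemma binomial_commuting:
  fixes x y :: "'a :: ring_1"
  assumes "x * y = y * x"
  shows "(x + y) ^ n = (\<Sum>k\<le>n. of_nat (n choose k) * x ^ k * y ^ (n - k))"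
proof (induction n)
  case (Suc n)
  let ?t = "\<lambda>n k. of_nat (n choose k) * x ^ k * y ^ (n - k) :: 'a"
  have yx: "y * x ^ k = x ^ k * y" for k
    by (induction k) (simp_all add: mult.assoc[symmetric] assms[symmetric], simp add: mult.assoc)
  have xN: "x * (of_nat m * w) = of_nat m * (x * w)" and yN: "y * (of_nat m * w) = of_nat m * (y * w)" for m w
    by (metis mult.assoc mult_of_nat_commute)+
  have yx': "y * (x ^ k * w) = x ^ k * (y * w)" for k w
    by (simp add: yx flip: mult.assoc)
  have "(x + y) ^ Suc n = (\<Sum>k\<le>n. x * ?t n k) + (\<Sum>k\<le>n. y * ?t n k)"
    by (simp add: Suc distrib_right sum_distrib_left sum.distrib)
  also have "(\<Sum>k\<le>n. x * ?t n k) = (\<Sum>k\<le>n. of_nat (n choose k) * x ^ Suc k * y ^ (n - k))"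
    by (intro sum.cong refl) (simp add: mult.assoc xN)
  also have "\<dots> = (\<Sum>k\<le>Suc n. (if k = 0 then 0 else of_nat (n choose (k - 1)) * x ^ k * y ^ (Suc n - k)))"
    by (subst sum.atMost_Suc_shift) simp
  also have "(\<Sum>k\<le>n. y * ?t n k) = (\<Sum>k\<le>n. of_nat (n choose k) * x ^ k * y ^ (Suc n - k))"
  proof (intro sum.cong refl)
    fix k assume "k \<in> {..n}"
    then have "y ^ (Suc n - k) = y * y ^ (n - k)" by (simp add: Suc_diff_le)
    then show "y * ?t n k = of_nat (n choose k) * x ^ k * y ^ (Suc n - k)"
      by (simp add: mult.assoc yN yx')
  qed
  also have "\<dots> = (\<Sum>k\<le>Suc n. of_nat (n choose k) * x ^ k * y ^ (Suc n - k))"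
    by (simp add: binomial_eq_0)
  also have "(\<Sum>k\<le>Suc n. (if k = 0 then 0 else of_nat (n choose (k - 1)) * x ^ k * y ^ (Suc n - k))) + \<dots>
     = (\<Sum>k\<le>Suc n. ?t (Suc n) k)"
    unfolding sum.distrib[symmetric]
  proof (intro sum.cong refl)
    fix k show "(if k = 0 then 0 else of_nat (n choose (k - 1)) * x ^ k * y ^ (Suc n - k))
      + of_nat (n choose k) * x ^ k * y ^ (Suc n - k) = ?t (Suc n) k"
      by (cases k) (simp_all add: distrib_right)
  qed
  finally show ?case .
qed simp

text \<open>The series \<open>exp (c h P)\<close>.\<close>

definition exp_series :: "rat \<Rightarrow> free_alg \<Rightarrow> free_alg fps" where
  "exp_series c P = Abs_fps (\<lambda>n. Poly_Mapping.single 0 (c ^ n / fact n) * P ^ n)"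

lemma exp_hH_series: "exp_hH c = exp_series c (gen_elem GenH)"
  by (simp add: exp_hH_def exp_series_def)

lemma single_0_mult: "Poly_Mapping.single 0 (c * d :: rat) = Poly_Mapping.single (0 :: word) c * Poly_Mapping.single 0 d"
  by (simp add: mult_single)

lemma single_0_power: "Poly_Mapping.single (0 :: word) (c :: rat) ^ n = Poly_Mapping.single 0 (c ^ n)"
  by (induction n) (simp_all add: mult_single)

lemma exp_series_add_scalar:
  "exp_series c (P + Poly_Mapping.single 0 d) = scalar (fps_exp (c * d)) * exp_series c P"
proof (rule fps_ext)
  fix n
  let ?s = "\<lambda>a :: rat. Poly_Mapping.single (0 :: word) a"
  have gen: "x * (y * z * p) = u * (w * p)" if "x * (y * z) = u * w" for x y z u w p :: free_alg
    using that by (metis mult.assoc)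
  have "?s (c ^ n / fact n) * (?s d + P) ^ n
     = (\<Sum>k\<le>n. ?s (c ^ n / fact n) * (of_nat (n choose k) * ?s d ^ k * P ^ (n - k)))"
    by (subst binomial_commuting[OF single_0_central]) (simp add: sum_distrib_left)
  also have "\<dots> = (\<Sum>k\<le>n. ?s ((c * d) ^ k / fact k) * (?s (c ^ (n - k) / fact (n - k)) * P ^ (n - k)))"
  proof (intro sum.cong refl)
    fix k assume "k \<in> {..n}"
    then have k: "k \<le> n" by simp
    then have c: "c ^ n = c ^ k * c ^ (n - k)" by (metis le_add_diff_inverse power_add)
    have "c ^ n / fact n * of_nat (n choose k) * d ^ k = (c * d) ^ k / fact k * (c ^ (n - k) / fact (n - k))"
      unfolding c using k by (simp add: binomial_fact power_mult_distrib field_simps)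
    then have "?s (c ^ n / fact n) * (?s (of_nat (n choose k)) * ?s (d ^ k))
        = ?s ((c * d) ^ k / fact k) * ?s (c ^ (n - k) / fact (n - k))"
      by (simp only: mult_single add_0 mult.assoc)
    moreover have "of_nat (n choose k) = ?s (of_nat (n choose k))" by simp
    ultimately show "?s (c ^ n / fact n) * (of_nat (n choose k) * ?s d ^ k * P ^ (n - k))
        = ?s ((c * d) ^ k / fact k) * (?s (c ^ (n - k) / fact (n - k)) * P ^ (n - k))"
      using gen by (simp only: single_0_power)
  qed
  finally show "fps_nth (exp_series c (P + ?s d)) n = fps_nth (scalar (fps_exp (c * d)) * exp_series c P) n"
    by (simp add: exp_series_def scalar_def fps_mult_nth atMost_atLeast0 add.commute)
qed

lemma exp_hH_add: "exp_hH (c + d) = exp_hH c * exp_hH d"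
proof (rule fps_ext)
  fix n
  let ?s = "\<lambda>a :: rat. Poly_Mapping.single (0 :: word) a" and ?H = "gen_elem GenH"
  have "(\<Sum>k\<le>n. (?s (c ^ k / fact k) * ?H ^ k) * (?s (d ^ (n - k) / fact (n - k)) * ?H ^ (n - k)))
     = (\<Sum>k\<le>n. ?s (c ^ k / fact k * (d ^ (n - k) / fact (n - k))) * ?H ^ n)"
  proof (intro sum.cong refl)
    fix k assume "k \<in> {..n}"
    then have "?H ^ n = ?H ^ k * ?H ^ (n - k)" by (simp flip: power_add)
    then show "(?s (c ^ k / fact k) * ?H ^ k) * (?s (d ^ (n - k) / fact (n - k)) * ?H ^ (n - k))
      = ?s (c ^ k / fact k * (d ^ (n - k) / fact (n - k))) * ?H ^ n"
      by (simp only: single_0_mult mult.assoc single_0_left_comm[of "?H ^ k"])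
  qed
  also have "\<dots> = ?s (\<Sum>k\<le>n. c ^ k / fact k * (d ^ (n - k) / fact (n - k))) * ?H ^ n"
    by (simp add: single_sum_aux sum_distrib_right)
  also have "(\<Sum>k\<le>n. c ^ k / fact k * (d ^ (n - k) / fact (n - k))) = (c + d) ^ n / fact n"
  proof -
    have "fps_nth (fps_exp (c + d)) n = fps_nth (fps_exp c * fps_exp d) n" by (simp only: fps_exp_add_mult)
    then show ?thesis by (simp add: fps_mult_nth atMost_atLeast0)
  qed
  finally show "fps_nth (exp_hH (c + d)) n = fps_nth (exp_hH c * exp_hH d) n"
    by (simp add: exp_hH_def fps_mult_nth atMost_atLeast0)
qed

lemma exp_hH_0: "exp_hH 0 = 1"
  by (rule fps_ext) (auto simp: exp_hH_def power_0_left)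

text \<open>The ideal is \<open>h\<close>-adically closed, and contains the partial sums of \<open>x\<close>.\<close>

lemma Uh_ideal_coeffwise:
  assumes "\<And>n. fps_const (fps_nth x n) \<in> Uh_ideal"
  shows "x \<in> Uh_ideal"
proof -
  interpret J: ideal Uh_ideal free_ring by (rule Uh_ideal_ideal)
  have "\<exists>y \<in> genideal free_ring Uh_relations. \<forall>k<n. fps_nth x k = fps_nth y k" for n
  proof -
    define y where "y = (\<Sum>k<n. fps_const (fps_nth x k) * fps_X ^ k)"
    have "(\<Sum>k\<in>A. fps_const (fps_nth x k) * fps_X ^ k) \<in> Uh_ideal" for A
      by (induction A rule: infinite_finite_induct)
         (use J.zero_closed J.a_closed J.I_r_closed[OF assms] in auto)
    then have "y \<in> Uh_ideal" by (simp add: y_def)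
    then obtain z where z: "z \<in> genideal free_ring Uh_relations" "\<forall>k<n. fps_nth y k = fps_nth z k"
      by (auto simp: Uh_ideal_def)
    have "fps_nth y k = fps_nth x k" if "k < n" for k
      using that by (simp add: y_def fps_sum_nth fps_X_power_mult_right_nth if_distrib sum.delta cong: if_cong)
    with z show ?thesis by auto
  qed
  then show ?thesis by (auto simp: Uh_ideal_def)
qed

text \<open>\<open>P g = g Q\<close> implies \<open>P^n g = g Q^n\<close> and hence the same for the exponential series, term by
  term. For \<open>P = H\<close>, \<open>Q = H \<plusminus> 2\<close> this gives the commutation of \<open>K\<close> with \<open>E\<close> and \<open>F\<close>.\<close>

lemma exp_series_conj:
  assumes "to_uh (fps_const P * fps_const g) = to_uh (fps_const g * fps_const Q)"
  shows "to_uh (exp_series c P * fps_const g) = to_uh (fps_const g * exp_series c Q)"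
  unfolding to_uh_eq_iff
proof (rule Uh_ideal_coeffwise)
  fix n
  have pow: "to_uh (fps_const (P ^ n * g)) = to_uh (fps_const (g * Q ^ n))" for n
  proof (induction n)
    case (Suc n)
    have "to_uh (fps_const (P ^ Suc n * g)) = to_uh (fps_const P) * to_uh (fps_const (P ^ n * g))"
      by (simp add: mult.assoc flip: to_uh_mult)
    also have "\<dots> = to_uh (fps_const P * fps_const g) * to_uh (fps_const (Q ^ n))"
      unfolding Suc by (simp add: mult.assoc flip: to_uh_mult)
    also have "\<dots> = to_uh (fps_const (g * Q ^ Suc n))"
      unfolding assms by (simp add: mult.assoc flip: to_uh_mult)
    finally show ?case .
  qed simp
  let ?s = "Poly_Mapping.single (0 :: word) (c ^ n / fact n)"
  have "fps_nth (exp_series c P * fps_const g - fps_const g * exp_series c Q) n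
     = ?s * (P ^ n * g) - ?s * (g * Q ^ n)"
    by (simp add: exp_series_def mult.assoc single_0_left_comm[of g])
  then have "to_uh (fps_const (fps_nth (exp_series c P * fps_const g - fps_const g * exp_series c Q) n))
    = to_uh (fps_const ?s) * to_uh (fps_const (P ^ n * g)) - to_uh (fps_const ?s) * to_uh (fps_const (g * Q ^ n))"
    by (simp flip: to_uh_mult to_uh_diff)
  also have "\<dots> = to_uh 0" by (simp add: pow to_uh_0)
  finally show "fps_const (fps_nth (exp_series c P * fps_const g - fps_const g * exp_series c Q) n) \<in> Uh_ideal"
    unfolding to_uh_eq_iff by simp
qed

definition uh_E :: uh where "uh_E = to_uh free_E"
definition uh_F :: uh where "uh_F = to_uh free_F"

text \<open>The element \<open>exp (c h H)\<close>; in particular \<open>K\<close> is \<open>exp_H (1/2)\<close>.\<close>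

definition exp_H :: "rat \<Rightarrow> uh" where "exp_H c = to_uh (exp_hH c)"

lemma exp_H_add: "exp_H (c + d) = exp_H c * exp_H d" and exp_H_0: "exp_H 0 = 1"
  by (simp_all add: exp_H_def exp_hH_add exp_hH_0 to_uh_mult to_uh_1)

lemma relation_in_Uh_ideal:
  assumes "r \<in> Uh_relations"
  shows "r \<in> Uh_ideal"
proof -
  have "r \<in> genideal free_ring Uh_relations" using assms free.genideal_self by auto
  then show ?thesis by (auto simp: Uh_ideal_def)
qed

lemma exp_H_E: "exp_H c * uh_E = uh_scalar (fps_exp (2 * c)) * (uh_E * exp_H c)"
  and exp_H_F: "exp_H c * uh_F = uh_scalar (fps_exp (- 2 * c)) * (uh_F * exp_H c)"
proof -
  have two: "fps_const (Poly_Mapping.single 0 2) = (2 :: free_alg fps)"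
    "fps_const (Poly_Mapping.single 0 (- 2)) = (- 2 :: free_alg fps)"
    using numeral_fps_const[of "num.Bit0 num.One"] neg_numeral_fps_const[of "num.Bit0 num.One"]
    by (metis single_numeral, metis single_numeral single_uminus)
  have "free_H * free_E - free_E * (free_H + 2) \<in> Uh_ideal" "free_H * free_F - free_F * (free_H - 2) \<in> Uh_ideal"
    by (rule relation_in_Uh_ideal, simp add: Uh_relations_def)+
  then have rel: "to_uh (free_H * free_E) = to_uh (free_E * fps_const (gen_elem GenH + Poly_Mapping.single 0 2))"
    "to_uh (free_H * free_F) = to_uh (free_F * fps_const (gen_elem GenH + Poly_Mapping.single 0 (-2)))"
    by (simp_all only: to_uh_eq_iff free_H_def two fps_const_add[symmetric]) simp
  have "exp_H c * uh_E = to_uh (free_E * exp_series c (gen_elem GenH + Poly_Mapping.single 0 2))"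
    unfolding exp_H_def uh_E_def exp_hH_series free_E_def to_uh_mult[symmetric]
    by (rule exp_series_conj) (use rel in \<open>simp add: free_H_def free_E_def\<close>)
  also have "\<dots> = uh_E * (uh_scalar (fps_exp (c * 2)) * exp_H c)"
    by (simp only: exp_series_add_scalar to_uh_mult uh_E_def uh_scalar_def exp_H_def exp_hH_series)
  finally show "exp_H c * uh_E = uh_scalar (fps_exp (2 * c)) * (uh_E * exp_H c)"
    by (simp only: uh_scalar_left_comm[of uh_E] mult.commute[of c])
  have "exp_H c * uh_F = to_uh (free_F * exp_series c (gen_elem GenH + Poly_Mapping.single 0 (-2)))"
    unfolding exp_H_def uh_F_def exp_hH_series free_F_def to_uh_mult[symmetric]
    by (rule exp_series_conj) (use rel in \<open>simp add: free_H_def free_F_def\<close>)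
  also have "\<dots> = uh_F * (uh_scalar (fps_exp (c * (- 2))) * exp_H c)"
    by (simp only: exp_series_add_scalar to_uh_mult uh_F_def uh_scalar_def exp_H_def exp_hH_series)
  finally show "exp_H c * uh_F = uh_scalar (fps_exp (- 2 * c)) * (uh_F * exp_H c)"
    by (simp only: uh_scalar_left_comm[of uh_F] mult.commute[of c])
qed

section \<open>Laurent polynomials in \<open>v\<close> and \<open>K\<close> inside \<open>U\<^sub>h\<close>\<close>

text \<open>The ring homomorphism from Laurent polynomials to \<open>U\<^sub>h\<close> with \<open>v = exp (h/2)\<close> and
  \<open>K = exp (hH/2)\<close>.\<close>

definition cartan :: "laurent \<Rightarrow> uh" where
  "cartan = lin_ext (\<lambda>k. uh_scalar (fps_exp (of_int (fst k) / 2)) * exp_H (of_int (snd k) / 2))"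

lemma cartan_add: "cartan (f + g) = cartan f + cartan g" and cartan_diff: "cartan (f - g) = cartan f - cartan g"
  and cartan_0: "cartan 0 = 0"
  by (simp_all add: cartan_def lin_ext_add lin_ext_diff)

lemma cartan_mult: "cartan (f * g) = cartan f * cartan g"
  unfolding cartan_def
proof (rule lin_ext_mult)
  fix a b :: "int \<times> int"
  show "uh_scalar (fps_exp (of_int (fst (a + b)) / 2)) * exp_H (of_int (snd (a + b)) / 2)
    = uh_scalar (fps_exp (of_int (fst a) / 2)) * exp_H (of_int (snd a) / 2) *
      (uh_scalar (fps_exp (of_int (fst b) / 2)) * exp_H (of_int (snd b) / 2))"
    by (simp add: add_divide_distrib fps_exp_add_mult uh_scalar_mult exp_H_add mult.assoc
        uh_scalar_left_comm[of "exp_H (of_int (snd a) / 2)"])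
qed

lemma cartan_vK: "cartan (vK a b) = uh_scalar (fps_exp (of_int a / 2)) * exp_H (of_int b / 2)"
  by (simp add: cartan_def vK_def)

lemma cartan_single: "cartan (Poly_Mapping.single (a, b) c) = of_int c * cartan (vK a b)"
  by (simp add: cartan_def vK_def)

lemma cartan_1: "cartan 1 = 1"
  unfolding vK_0[symmetric] cartan_vK by (simp add: uh_scalar_1 exp_H_0)

text \<open>The substitution \<open>K \<mapsto> v^j K\<close>, which describes how Laurent polynomials move past \<open>E\<close>, \<open>F\<close>
  and their powers.\<close>

definition twist :: "int \<Rightarrow> laurent \<Rightarrow> laurent" where
  "twist j = lin_ext (\<lambda>k. vK (fst k + j * snd k) (snd k))"

lemma twist_add: "twist j (f + g) = twist j f + twist j g"
  by (simp add: twist_def lin_ext_add)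

lemma twist_diff: "twist j (f - g) = twist j f - twist j g"
  by (simp add: twist_def lin_ext_diff)

lemma twist_mult: "twist j (f * g) = twist j f * twist j g"
  unfolding twist_def by (rule lin_ext_mult) (simp add: vK_mult algebra_simps)

lemma twist_vK: "twist j (vK a b) = vK (a + j * b) b"
  by (simp add: twist_def vK_def)

lemma twist_single: "twist j (Poly_Mapping.single (a, b) c) = Poly_Mapping.single (a + j * b, b) c"
  by (simp add: twist_def) (simp add: single_vK)

lemma twist_0: "twist j 0 = 0"
  by (simp add: twist_def)

lemma twist_1: "twist j 1 = 1"
  unfolding vK_0[symmetric] twist_vK by simp

lemma twist_twist: "twist i (twist j f) = twist (i + j) f"
proof (induction f rule: poly_mapping_additive_induct)
  case (single k c)
  then show ?case by (cases k) (simp add: twist_single algebra_simps)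
qed (simp_all add: twist_add twist_0)

lemma vK_even_sign_ideal: "vK (2 * a) (2 * b) - 1 \<in> sign_ideal 1"
  using vK_mod2[of "2 * a" "2 * b"] by (simp add: vK_0)

text \<open>For odd \<open>j\<close>, too, \<open>(v^j K)^2 - 1\<close> involves only even powers, so the four sign points are
  permuted.\<close>

lemma twist_sign_ideal: "f \<in> sign_ideal n \<Longrightarrow> twist j f \<in> sign_ideal n"
proof (induction n arbitrary: f)
  case (Suc n)
  obtain a b where *: "f = v2_minus_1 * a + K2_minus_1 * b" "a \<in> sign_ideal n" "b \<in> sign_ideal n"
    using Suc.prems by (auto elim!: sign_ideal_SucE)
  have "twist j v2_minus_1 = v2_minus_1" by (simp add: v2_minus_1_def twist_diff twist_1 twist_vK)
  moreover have "twist j K2_minus_1 \<in> sign_ideal 1"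
    using vK_even_sign_ideal[of j 1] by (simp add: K2_minus_1_def twist_diff twist_1 twist_vK mult.commute)
  ultimately have "v2_minus_1 * twist j a \<in> sign_ideal (1 + n)" "twist j K2_minus_1 * twist j b \<in> sign_ideal (1 + n)"
    using sign_ideal_prod v2_minus_1_sign_ideal Suc.IH * by blast+
  then show ?case using \<open>twist j v2_minus_1 = v2_minus_1\<close> by (simp add: * twist_add twist_mult sign_ideal_add)
qed simp

lemma cartan_E: "cartan f * uh_E = uh_E * cartan (twist 2 f)"
proof (induction f rule: poly_mapping_additive_induct)
  case (single k c)
  obtain a b where k: "k = (a, b)" by (cases k)
  have "cartan (vK a b) * uh_E = uh_E * cartan (vK (a + 2 * b) b)"
    unfolding cartan_vK
    by (simp add: mult.assoc exp_H_E add_divide_distrib fps_exp_add_mult uh_scalar_mult uh_scalar_left_comm[of uh_E])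
  then show ?case
    by (simp add: k twist_single cartan_single mult.assoc) (metis mult.assoc mult_of_int_commute)
qed (simp_all add: cartan_add twist_add distrib_left distrib_right cartan_0 twist_0)

lemma cartan_F: "cartan f * uh_F = uh_F * cartan (twist (- 2) f)"
proof (induction f rule: poly_mapping_additive_induct)
  case (single k c)
  obtain a b where k: "k = (a, b)" by (cases k)
  have "of_int (a + - 2 * b) / 2 = of_int a / 2 + (- 2 * (of_int b / 2) :: rat)" by simp
  then have "cartan (vK a b) * uh_F = uh_F * cartan (vK (a + - 2 * b) b)"
    unfolding cartan_vK
    by (simp only: mult.assoc exp_H_F fps_exp_add_mult uh_scalar_mult uh_scalar_left_comm[of uh_F])
  then show ?case
    by (simp add: k twist_single cartan_single mult.assoc) (metis mult.assoc mult_of_int_commute)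
qed (simp_all add: cartan_add twist_add distrib_left distrib_right cartan_0 twist_0)

section \<open>Divided powers\<close>

lemma v_power: "v ^ n = fps_exp (of_nat n / 2)" "inverse v ^ n = fps_exp (- of_nat n / 2)"
  by (simp_all add: v_def fps_exp_power_mult flip: fps_exp_neg)

lemma qint_qnum: "qint i = qnum (of_nat i)"
proof -
  have "v ^ i - inverse v ^ i = (v - inverse v) * qnum (of_nat i)"
    by (simp add: qnum v_power)
  then have "qint i = (v - inverse v) * qnum (of_nat i) / (v - inverse v)" by (simp only: qint_def)
  then show ?thesis using nonzero_mult_div_cancel_left[OF v_diff_neq_0, of "qnum (of_nat i)"] by (rule trans)
qed

lemma qnum_nth_0: "fps_nth (qnum \<alpha>) 0 = \<alpha>"
  by (simp add: qnum_def v_nth)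

lemma qfact_0: "qfact 0 = 1" and qfact_Suc: "qfact (Suc n) = qnum (of_nat (Suc n)) * qfact n"
  by (simp_all add: qfact_def qint_qnum mult.commute)

lemma qfact_nth_0: "fps_nth (qfact n) 0 \<noteq> 0"
  by (induction n) (simp_all add: qfact_0 qfact_Suc qnum_nth_0 del: of_nat_Suc)

lemma qfact_inverse: "qfact n * inverse (qfact n) = 1"
  by (rule inverse_mult_eq_1'[OF qfact_nth_0])

definition qbinom :: "nat \<Rightarrow> nat \<Rightarrow> rat fps" where
  "qbinom i j = qfact (i + j) * (inverse (qfact i) * inverse (qfact j))"

lemma qnum_split: "qnum (a + b) = fps_exp (a/2) * qnum b + fps_exp (- b/2) * qnum a"
proof (rule qnum_eqI[symmetric])
  have dist: "d * (x * A + y * B) = x * (d * A) + y * (d * B)" for d x y A B :: "rat fps"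
    by (simp add: algebra_simps)
  show "(v - inverse v) * (fps_exp (a/2) * qnum b + fps_exp (- b/2) * qnum a) = fps_exp ((a + b)/2) - fps_exp (- (a + b)/2)"
    unfolding dist qnum
    by (simp add: algebra_simps add_divide_distrib diff_divide_distrib flip: fps_exp_add_mult)
qed

text \<open>The quantum binomial coefficients are Laurent polynomials in \<open>v\<close> by the quantum Pascal identity
  \<open>[i + j] = v^i [j] + v^-j [i]\<close>.\<close>

lemma qbinom_laurent: "\<exists>g. uh_scalar (qbinom i j) = cartan g"
proof (induction "i + j" arbitrary: i j)
  case 0
  then show ?case by (intro exI[of _ 1]) (simp add: qbinom_def qfact_0 uh_scalar_1 cartan_1)
next
  case (Suc n)
  have sc1: "uh_scalar 1 = cartan 1" by (simp add: uh_scalar_1 cartan_1)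
  show ?case
  proof (cases "i = 0 \<or> j = 0")
    case True
    then have "qbinom i j = 1" using qfact_inverse by (auto simp: qbinom_def qfact_0)
    with sc1 show ?thesis by metis
  next
    case False
    then obtain a b where ij: "i = Suc a" "j = Suc b" by (auto simp: gr0_conv_Suc)
    let ?q = qfact and ?r = "\<lambda>n. inverse (qfact n)" and ?n = "\<lambda>i. qnum (of_nat i)"
    have inv: "?n (Suc m) * ?r (Suc m) = ?r m" for m
    proof -
      have "?n (Suc m) * ?r (Suc m) * qfact m * ?r m = (qfact (Suc m) * ?r (Suc m)) * ?r m"
        unfolding qfact_Suc by (simp only: mult_ac)
      then show ?thesis by (simp only: qfact_inverse mult.assoc mult_1_left mult_1_right)
    qed
    have s: "?n (i + j) = fps_exp (of_nat i / 2) * ?n j + fps_exp (- of_nat j / 2) * ?n i"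
      using qnum_split[of "of_nat i" "of_nat j"] by simp
    have "qbinom i j = ?n (i + j) * ?q (a + j) * (?r i * ?r j)"
      by (simp add: qbinom_def ij qfact_Suc del: of_nat_Suc)
    also have "\<dots> = fps_exp (of_nat i / 2) * (?q (i + b) * (?r i * (?n j * ?r j)))
        + fps_exp (- of_nat j / 2) * (?q (a + j) * ((?n i * ?r i) * ?r j))"
      unfolding s by (simp add: ij algebra_simps del: of_nat_Suc)
    also have "\<dots> = fps_exp (of_nat i / 2) * qbinom i b + fps_exp (- of_nat j / 2) * qbinom a j"
      unfolding ij inv qbinom_def ..
    finally have rec: "qbinom i j = \<dots>" .
    obtain g h where g: "uh_scalar (qbinom i b) = cartan g" and h: "uh_scalar (qbinom a j) = cartan h"
      using Suc.hyps ij by (metis add_Suc add_Suc_right nat.inject)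
    have "uh_scalar (fps_exp (of_int m / 2)) = cartan (vK m 0)" for m
      by (simp add: cartan_vK exp_H_0)
    from this[of "int i"] this[of "- int j"]
    have "uh_scalar (qbinom i j) = cartan (vK (int i) 0 * g + vK (- int j) 0 * h)"
      unfolding rec uh_scalar_add uh_scalar_mult g h cartan_add cartan_mult by simp
    then show ?thesis by blast
  qed
qed

text \<open>The divided power \<open>F^(i)\<close>.\<close>

definition Fdiv :: "nat \<Rightarrow> uh" where
  "Fdiv i = uh_scalar (inverse (qfact i)) * uh_F ^ i"

lemma Fdiv_0: "Fdiv 0 = 1"
  by (simp add: Fdiv_def qfact_0 uh_scalar_1)

lemma F_power: "uh_F ^ i = uh_scalar (qfact i) * Fdiv i"
  by (simp add: Fdiv_def qfact_inverse uh_scalar_1 flip: mult.assoc uh_scalar_mult)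

lemma Fdiv_mult: "Fdiv i * Fdiv j = uh_scalar (qbinom i j) * Fdiv (i + j)"
proof -
  have "Fdiv i * Fdiv j = uh_scalar (inverse (qfact i)) * (uh_scalar (inverse (qfact j)) * (uh_F ^ i * uh_F ^ j))"
    unfolding Fdiv_def by (simp only: mult.assoc uh_scalar_left_comm[of "uh_F ^ i"])
  also have "uh_F ^ i * uh_F ^ j = uh_scalar (qfact (i + j)) * Fdiv (i + j)"
    unfolding power_add[symmetric] by (rule F_power)
  finally have "Fdiv i * Fdiv j = uh_scalar (inverse (qfact i) * (inverse (qfact j) * qfact (i + j))) * Fdiv (i + j)"
    by (simp only: uh_scalar_mult mult.assoc)
  also have "inverse (qfact i) * (inverse (qfact j) * qfact (i + j)) = qbinom i j"
    unfolding qbinom_def by (simp only: mult_ac)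
  finally show ?thesis .
qed

lemma cartan_F_power: "cartan f * uh_F ^ n = uh_F ^ n * cartan (twist (- 2 * int n) f)"
proof (induction n arbitrary: f)
  case 0
  have "twist 0 f = f"
  proof (induction f rule: poly_mapping_additive_induct)
    case (single k c)
    then show ?case by (cases k) (simp add: twist_single)
  qed (simp_all add: twist_add twist_0)
  then show ?case by simp
next
  case (Suc n)
  have "cartan f * uh_F ^ Suc n = uh_F * (cartan (twist (- 2) f) * uh_F ^ n)"
    by (simp add: cartan_F flip: mult.assoc)
  then show ?case by (simp add: Suc twist_twist mult.assoc algebra_simps)
qed

lemma cartan_Fdiv: "cartan f * Fdiv n = Fdiv n * cartan (twist (- 2 * int n) f)"
  unfolding Fdiv_def by (simp only: uh_scalar_left_comm[of "cartan f"] cartan_F_power mult.assoc)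

text \<open>The generator \<open>e = (v - v^-1) E\<close> of the integral form.\<close>

definition uh_e :: uh where "uh_e = to_uh (scalar (v - inverse v) * free_E)"

lemma uh_e_E: "uh_e = uh_scalar (v - inverse v) * uh_E"
  by (simp add: uh_e_def uh_scalar_def uh_E_def to_uh_mult)

lemma e_cartan: "uh_e * cartan f = cartan (twist (- 2) f) * uh_e"
proof -
  have "cartan (twist (- 2) f) * uh_E = uh_E * cartan f"
    using cartan_F_power[of f 0] unfolding cartan_E twist_twist by simp
  then show ?thesis unfolding uh_e_E by (simp only: mult.assoc uh_scalar_left_comm[of "cartan _"])
qed

lemma e_F: "uh_e * uh_F = uh_F * uh_e + cartan (vK 0 1 - vK 0 (- 1))"
proof -
  have "free_E * free_F - free_F * free_E - free_K_quot \<in> Uh_ideal"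
    by (rule relation_in_Uh_ideal) (simp add: Uh_relations_def)
  then have "to_uh (free_E * free_F - free_F * free_E) = to_uh free_K_quot"
    by (simp only: to_uh_eq_iff)
  then have "uh_E * uh_F = uh_F * uh_E + to_uh free_K_quot"
    by (simp add: to_uh_diff to_uh_mult uh_E_def uh_F_def algebra_simps)
  then have "uh_e * uh_F = uh_scalar (v - inverse v) * (uh_F * uh_E) + uh_scalar (v - inverse v) * to_uh free_K_quot"
    by (simp add: uh_e_E mult.assoc distrib_left)
  also have "uh_scalar (v - inverse v) * to_uh free_K_quot = exp_H (1/2) - exp_H (- 1/2)"
    unfolding uh_scalar_def to_uh_mult[symmetric] free_K_quot
    by (simp add: to_uh_diff exp_H_def free_K_def free_K_inv_def)
  also have "\<dots> = cartan (vK 0 1 - vK 0 (- 1))"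
    by (simp add: cartan_diff cartan_vK uh_scalar_1)
  finally show ?thesis by (simp only: uh_e_E uh_scalar_left_comm[of uh_F])
qed

text \<open>The factor \<open>v^-n K - v^n K^-1\<close> that arises when \<open>e\<close> is moved past \<open>F^(n + 1)\<close>. It is in
  the ideal generated by \<open>v^2 - 1\<close> and \<open>K^2 - 1\<close>, so moving \<open>e\<close> to the right preserves the
  filtration degree.\<close>

definition K_bracket :: "nat \<Rightarrow> laurent" where
  "K_bracket n = vK (- int n) 1 - vK (int n) (- 1)"

lemma K_bracket_sign_ideal: "K_bracket n \<in> sign_ideal 1"
proof -
  have "K_bracket n = vK (int n) (- 1) * (vK (2 * (- int n)) (2 * 1) - 1)"
    by (simp add: K_bracket_def right_diff_distrib vK_mult)
  then show ?thesis using sign_ideal_mult[OF vK_even_sign_ideal] by metis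
qed

lemma e_F_power: "uh_e * uh_F ^ Suc n = uh_F ^ Suc n * uh_e + uh_scalar (qnum (of_nat (Suc n))) * (uh_F ^ n * cartan (K_bracket n))"
proof (induction n)
  case 0
  then show ?case by (simp add: e_F qnum_1 uh_scalar_1 K_bracket_def)
next
  case (Suc n)
  let ?q = "\<lambda>n. uh_scalar (qnum (of_nat n))"
  have tw: "twist (- 2) (K_bracket n) = vK (- int n - 2) 1 - vK (int n + 2) (- 1)"
    by (simp add: K_bracket_def twist_diff twist_vK)
  \<comment> \<open>The coefficient of \<open>F^(n+1)\<close>: one new bracket plus the old one moved past \<open>F\<close>. The
    contributions of \<open>K\<close> and \<open>K^-1\<close> are treated separately.\<close>
  have key: "cartan (vK 0 1 - vK 0 (- 1)) + ?q (Suc n) * cartan (twist (- 2) (K_bracket n))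
      = ?q (Suc (Suc n)) * cartan (K_bracket (Suc n))"
  proof -
    let ?m = "of_nat (Suc n) :: rat"
    have p: "1 + qnum ?m * fps_exp (- (?m + 1)/2) = qnum (?m + 1) * fps_exp (- ?m/2)"
      "1 + qnum ?m * fps_exp ((?m + 1)/2) = qnum (?m + 1) * fps_exp (?m/2)"
    proof -
      have "qnum (?m + 1) = fps_exp (?m/2) + fps_exp (- 1/2) * qnum ?m"
        using qnum_split[of ?m 1] by (simp add: qnum_1)
      then show "1 + qnum ?m * fps_exp (- (?m + 1)/2) = qnum (?m + 1) * fps_exp (- ?m/2)"
        by (simp add: algebra_simps add_divide_distrib diff_divide_distrib flip: fps_exp_add_mult)
      have "qnum (?m + 1) = fps_exp (1/2) * qnum ?m + fps_exp (- ?m/2)"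
        using qnum_split[of 1 ?m] by (simp add: qnum_1 add.commute)
      then show "1 + qnum ?m * fps_exp ((?m + 1)/2) = qnum (?m + 1) * fps_exp (?m/2)"
        by (simp add: algebra_simps add_divide_distrib diff_divide_distrib flip: fps_exp_add_mult)
    qed
    have k1: "exp_H (1/2) + ?q (Suc n) * (uh_scalar (fps_exp (- (?m + 1)/2)) * exp_H (1/2))
      = ?q (Suc (Suc n)) * (uh_scalar (fps_exp (- ?m/2)) * exp_H (1/2))"
    proof -
      have "uh_scalar (1 + qnum ?m * fps_exp (- (?m + 1)/2)) * exp_H (1/2) = uh_scalar (qnum (?m + 1) * fps_exp (- ?m/2)) * exp_H (1/2)"
        by (simp only: p)
      then show ?thesis by (simp add: uh_scalar_add uh_scalar_mult uh_scalar_1 distrib_right mult.assoc add.commute)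
    qed
    have k2: "exp_H (- 1/2) + ?q (Suc n) * (uh_scalar (fps_exp ((?m + 1)/2)) * exp_H (- 1/2))
      = ?q (Suc (Suc n)) * (uh_scalar (fps_exp (?m/2)) * exp_H (- 1/2))"
    proof -
      have "uh_scalar (1 + qnum ?m * fps_exp ((?m + 1)/2)) * exp_H (- 1/2) = uh_scalar (qnum (?m + 1) * fps_exp (?m/2)) * exp_H (- 1/2)"
        by (simp only: p)
      then show ?thesis by (simp add: uh_scalar_add uh_scalar_mult uh_scalar_1 distrib_right mult.assoc add.commute)
    qed
    have c1: "cartan (vK 0 1 - vK 0 (- 1)) = exp_H (1/2) - exp_H (- 1/2)"
      by (simp add: cartan_diff cartan_vK uh_scalar_1)
    have c2: "cartan (twist (- 2) (K_bracket n)) = uh_scalar (fps_exp (- (?m + 1)/2)) * exp_H (1/2) - uh_scalar (fps_exp ((?m + 1)/2)) * exp_H (- 1/2)"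
      unfolding tw cartan_diff cartan_vK by (simp add: algebra_simps)
    have c3: "cartan (K_bracket (Suc n)) = uh_scalar (fps_exp (- ?m/2)) * exp_H (1/2) - uh_scalar (fps_exp (?m/2)) * exp_H (- 1/2)"
      unfolding K_bracket_def cartan_diff cartan_vK by simp
    show ?thesis unfolding c1 c2 c3 right_diff_distrib k1[symmetric] k2[symmetric] by simp
  qed
  have "uh_e * uh_F ^ Suc (Suc n) = (uh_e * uh_F ^ Suc n) * uh_F" by (simp only: power_Suc2 mult.assoc)
  also have "\<dots> = uh_F ^ Suc n * (uh_e * uh_F) + ?q (Suc n) * (uh_F ^ n * (cartan (K_bracket n) * uh_F))"
    by (simp only: Suc distrib_right mult.assoc)
  also have "\<dots> = uh_F ^ Suc n * (uh_F * uh_e) + (uh_F ^ Suc n * cartan (vK 0 1 - vK 0 (- 1)) + ?q (Suc n) * (uh_F ^ Suc n * cartan (twist (- 2) (K_bracket n))))"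
    by (simp only: e_F cartan_F distrib_left power_Suc2 mult.assoc add.assoc)
  also have "uh_F ^ Suc n * cartan (vK 0 1 - vK 0 (- 1)) + ?q (Suc n) * (uh_F ^ Suc n * cartan (twist (- 2) (K_bracket n)))
     = uh_F ^ Suc n * (cartan (vK 0 1 - vK 0 (- 1)) + ?q (Suc n) * cartan (twist (- 2) (K_bracket n)))"
    by (simp only: distrib_left uh_scalar_left_comm[of "uh_F ^ Suc n"])
  also have "\<dots> = ?q (Suc (Suc n)) * (uh_F ^ Suc n * cartan (K_bracket (Suc n)))"
    by (simp only: key uh_scalar_left_comm[of "uh_F ^ Suc n"])
  finally show ?case by (simp only: power_Suc2 mult.assoc)
qed

lemma e_Fdiv: "uh_e * Fdiv (Suc n) = Fdiv (Suc n) * uh_e + Fdiv n * cartan (K_bracket n)"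
proof -
  have "inverse (qfact (Suc n)) * qnum (of_nat (Suc n)) = inverse (qfact n)"
  proof -
    have "inverse (qfact (Suc n)) * qnum (of_nat (Suc n)) * qfact n * inverse (qfact n)
       = (qfact (Suc n) * inverse (qfact (Suc n))) * inverse (qfact n)"
      unfolding qfact_Suc by (simp only: mult_ac)
    then show ?thesis by (simp only: qfact_inverse mult.assoc mult_1_left mult_1_right)
  qed
  then have c: "uh_scalar (inverse (qfact (Suc n))) * (uh_scalar (qnum (of_nat (Suc n))) * x) = uh_scalar (inverse (qfact n)) * x" for x
    by (simp only: uh_scalar_mult[symmetric] mult.assoc[symmetric])
  have "uh_e * Fdiv (Suc n) = uh_scalar (inverse (qfact (Suc n))) * (uh_e * uh_F ^ Suc n)"
    unfolding Fdiv_def by (rule uh_scalar_left_comm)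
  then show ?thesis unfolding e_F_power distrib_left c by (simp only: Fdiv_def mult.assoc)
qed

section \<open>The filtration by PBW monomials\<close>

text \<open>The span of the elements \<open>F^(i) f e^k\<close> of degree at least \<open>n\<close>, where \<open>e\<close> and the ideal of
  the sign points have degree 1 and \<open>F^(i)\<close> has degree 0. The difference \<open>n - k\<close> is
  truncated: there is no condition on \<open>f\<close> for \<open>k \<ge> n\<close>. Negatives need no rule of their own since \<open>f\<close> can
  be negated.\<close>

inductive_set pbw_filt :: "nat \<Rightarrow> uh set" for n where
  pbw_filt_0: "0 \<in> pbw_filt n"
| pbw_filt_step: "x \<in> pbw_filt n \<Longrightarrow> f \<in> sign_ideal (n - k) \<Longrightarrow> x + Fdiv i * cartan f * uh_e ^ k \<in> pbw_filt n"

lemma pbw_filt_term: "f \<in> sign_ideal (n - k) \<Longrightarrow> Fdiv i * cartan f * uh_e ^ k \<in> pbw_filt n"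
  using pbw_filt_step[OF pbw_filt_0] by simp

lemma pbw_filt_add: "y \<in> pbw_filt n \<Longrightarrow> x \<in> pbw_filt n \<Longrightarrow> x + y \<in> pbw_filt n"
  by (induction rule: pbw_filt.induct) (simp_all add: pbw_filt_step flip: add.assoc)

lemma pbw_filt_additive_image:
  assumes "x \<in> pbw_filt n" and "\<And>x y. T (x + y) = T x + T y"
    and "\<And>i f k. f \<in> sign_ideal (n - k) \<Longrightarrow> T (Fdiv i * cartan f * uh_e ^ k) \<in> pbw_filt m"
  shows "T x \<in> pbw_filt m"
  using assms(1)
proof (induction rule: pbw_filt.induct)
  case pbw_filt_0
  have "T 0 = 0" using assms(2)[of 0 0] by simp
  then show ?case by (simp add: pbw_filt.pbw_filt_0)
qed (simp add: assms pbw_filt_add)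

lemma pbw_filt_antimono: "m \<le> n \<Longrightarrow> x \<in> pbw_filt n \<Longrightarrow> x \<in> pbw_filt m"
  by (erule pbw_filt_additive_image[of x n "\<lambda>x. x"]) (auto intro!: pbw_filt_term intro: subsetD[OF sign_ideal_antimono, rotated])

lemma pbw_filt_uminus: "x \<in> pbw_filt n \<Longrightarrow> - x \<in> pbw_filt n"
proof (erule pbw_filt_additive_image)
  fix i f k assume "f \<in> sign_ideal (n - k)"
  then have "Fdiv i * cartan (- f) * uh_e ^ k \<in> pbw_filt n" by (intro pbw_filt_term sign_ideal_uminus)
  moreover have "cartan (- f) = - cartan f" using cartan_diff[of 0 f] by (simp add: cartan_0)
  ultimately show "- (Fdiv i * cartan f * uh_e ^ k) \<in> pbw_filt n" by simp
qed simp

lemma cartan_pbw_filt: "f \<in> sign_ideal d \<Longrightarrow> x \<in> pbw_filt n \<Longrightarrow> cartan f * x \<in> pbw_filt (d + n)"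
proof (erule pbw_filt_additive_image)
  fix i g k assume f: "f \<in> sign_ideal d" and g: "g \<in> sign_ideal (n - k)"
  have "twist (- 2 * int i) f * g \<in> sign_ideal (d + n - k)"
  proof (rule subsetD[OF sign_ideal_antimono sign_ideal_prod[OF twist_sign_ideal[OF f] g]])
    show "d + n - k \<le> d + (n - k)" by arith
  qed
  then have "Fdiv i * cartan (twist (- 2 * int i) f * g) * uh_e ^ k \<in> pbw_filt (d + n)" by (rule pbw_filt_term)
  then show "cartan f * (Fdiv i * cartan g * uh_e ^ k) \<in> pbw_filt (d + n)"
    by (simp add: cartan_mult cartan_Fdiv flip: mult.assoc)
qed (simp add: distrib_left)

lemma Fdiv_pbw_filt: "x \<in> pbw_filt n \<Longrightarrow> Fdiv i * x \<in> pbw_filt n"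
proof (erule pbw_filt_additive_image)
  fix j g k assume g: "g \<in> sign_ideal (n - k)"
  obtain b where b: "uh_scalar (qbinom i j) = cartan b" using qbinom_laurent by blast
  have "cartan b * (Fdiv (i + j) * cartan g * uh_e ^ k) \<in> pbw_filt (0 + n)" 
    using g by (intro cartan_pbw_filt pbw_filt_term) auto
  then show "Fdiv i * (Fdiv j * cartan g * uh_e ^ k) \<in> pbw_filt n"
    by (simp add: Fdiv_mult b flip: mult.assoc)
qed (simp add: distrib_left)

text \<open>Moving \<open>e\<close> past \<open>F^(i)\<close> either keeps \<open>e\<close> or replaces it by a bracket; both have
  degree 1.\<close>

lemma e_pbw_filt: "x \<in> pbw_filt n \<Longrightarrow> uh_e * x \<in> pbw_filt (Suc n)"
proof (erule pbw_filt_additive_image)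
  fix i g k assume g: "g \<in> sign_ideal (n - k)"
  have A: "Fdiv i * uh_e * cartan g * uh_e ^ k \<in> pbw_filt (Suc n)"
  proof -
    have "Fdiv i * cartan (twist (- 2) g) * uh_e ^ Suc k \<in> pbw_filt (Suc n)"
      using twist_sign_ideal[OF g] by (intro pbw_filt_term) simp
    then show ?thesis by (simp add: e_cartan mult.assoc)
  qed
  show "uh_e * (Fdiv i * cartan g * uh_e ^ k) \<in> pbw_filt (Suc n)"
  proof (cases i)
    case 0
    then show ?thesis using A by (simp add: Fdiv_0 mult.assoc)
  next
    case (Suc j)
    have "K_bracket j * g \<in> sign_ideal (Suc n - k)"
    proof (rule subsetD[OF sign_ideal_antimono sign_ideal_prod[OF K_bracket_sign_ideal g]])
      show "Suc n - k \<le> 1 + (n - k)" by arith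
    qed
    then have "Fdiv j * cartan (K_bracket j * g) * uh_e ^ k \<in> pbw_filt (Suc n)" by (rule pbw_filt_term)
    with A have "Fdiv i * uh_e * cartan g * uh_e ^ k + Fdiv j * cartan (K_bracket j * g) * uh_e ^ k \<in> pbw_filt (Suc n)"
      by (intro pbw_filt_add)
    moreover have "uh_e * (Fdiv i * cartan g * uh_e ^ k) = Fdiv i * uh_e * cartan g * uh_e ^ k + Fdiv j * cartan (K_bracket j * g) * uh_e ^ k"
      unfolding Suc by (simp add: e_Fdiv cartan_mult distrib_right flip: mult.assoc)
    ultimately show ?thesis by simp
  qed
qed (simp add: distrib_left)

lemma e_power_pbw_filt: "x \<in> pbw_filt n \<Longrightarrow> uh_e ^ k * x \<in> pbw_filt (k + n)"
  by (induction k) (simp_all add: e_pbw_filt mult.assoc)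

lemma pbw_filt_mult:
  assumes "x \<in> pbw_filt m" "y \<in> pbw_filt n"
  shows "x * y \<in> pbw_filt (m + n)"
  using assms(1)
proof (rule pbw_filt_additive_image)
  fix i f k assume f: "f \<in> sign_ideal (m - k)"
  have "Fdiv i * (cartan f * (uh_e ^ k * y)) \<in> pbw_filt (m - k + (k + n))"
    by (intro Fdiv_pbw_filt cartan_pbw_filt e_power_pbw_filt f assms)
  then show "Fdiv i * cartan f * uh_e ^ k * y \<in> pbw_filt (m + n)"
    by (auto simp: mult.assoc intro: pbw_filt_antimono[rotated])
qed (simp add: distrib_right)

section \<open>Reading off PBW coefficients from Verma modules\<close>

text \<open>Any preimage in the completed free algebra acts in the same way, by \<open>act_Uh_ideal\<close>.\<close>

definition act_uh :: "rat \<Rightarrow> uh \<Rightarrow> verma \<Rightarrow> verma" where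
  "act_uh l x = act l (SOME y. to_uh y = x)"

lemma act_uh_to_uh: "act_uh l (to_uh y) a = act l y a"
proof -
  define z where "z = (SOME z. to_uh z = to_uh y)"
  have "to_uh z = to_uh y" unfolding z_def by (rule someI) simp
  then have "act l (z - y) a = (\<lambda>j. 0)" by (intro act_Uh_ideal) (simp add: to_uh_eq_iff)
  then show ?thesis by (simp add: act_uh_def act_diff fun_eq_iff flip: z_def)
qed

lemma act_uh_add: "act_uh l (x + y) a = (\<lambda>j. act_uh l x a j + act_uh l y a j)"
proof -
  obtain p q where "x = to_uh p" "y = to_uh q" using to_uh_surj by metis
  then show ?thesis by (simp add: act_uh_to_uh act_add flip: to_uh_add)
qed

lemma act_uh_mult: "act_uh l (x * y) a = act_uh l x (act_uh l y a)"
proof -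
  obtain p q where "x = to_uh p" "y = to_uh q" using to_uh_surj by metis
  then show ?thesis by (simp add: act_uh_to_uh act_mult flip: to_uh_mult)
qed

lemma act_uh_1: "act_uh l 1 a = a"
  using act_uh_to_uh[of l 1 a] by (simp add: to_uh_1 act_one)

lemma act_uh_0: "act_uh l 0 a = (\<lambda>j. 0)"
  using act_uh_to_uh[of l 0 a] by (simp add: to_uh_0)

lemma act_uh_sum: "act_uh l (\<Sum>i\<in>A. x i) a = (\<lambda>j. \<Sum>i\<in>A. act_uh l (x i) a j)"
  by (induction A rule: infinite_finite_induct) (auto simp: act_uh_0 act_uh_add)

lemma act_uh_scalar: "act_uh l (uh_scalar f) a j = f * a j"
  by (simp add: uh_scalar_def act_uh_to_uh act_scalar)

lemma act_uh_exp_H: "act_uh l (exp_H c) a j = fps_exp (c * (l - 2 * of_nat j)) * a j"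
  by (simp add: exp_H_def act_uh_to_uh act_exp_hH)

lemma act_uh_cartan: "act_uh l (cartan f) a j = exp_eval (1/2) ((l - 2 * of_nat j)/2) f * a j"
proof (induction f rule: poly_mapping_additive_induct)
  case (single k c)
  obtain r s where k: "k = (r, s)" by (cases k)
  show ?case
    by (simp add: k cartan_single uh_scalar_of_int[symmetric] cartan_vK act_uh_mult act_uh_scalar act_uh_exp_H exp_eval_def
        mult.assoc fps_exp_add_mult[symmetric])
next
  case (add f g)
  then show ?case by (simp add: cartan_add act_uh_add exp_eval_def lin_ext_add distrib_right)
qed (simp add: cartan_0 act_uh_0 exp_eval_def)

text \<open>The coefficient with which \<open>e^k\<close> maps the basis vector \<open>m (j + k)\<close> to \<open>m j\<close>.\<close>

definition raise_coeff :: "rat \<Rightarrow> nat \<Rightarrow> nat \<Rightarrow> rat fps" where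
  "raise_coeff l j k = (\<Prod>t<k. (v - inverse v) * weight_E l (j + t))"

lemma act_uh_e: "act_uh l uh_e a j = (v - inverse v) * weight_E l j * a (Suc j)"
  by (simp add: uh_e_def act_uh_to_uh act_mult act_scalar act_gens mult.assoc)

lemma act_uh_e_power: "act_uh l (uh_e ^ k) a j = raise_coeff l j k * a (j + k)"
proof (induction k arbitrary: j)
  case (Suc k)
  have "raise_coeff l j (Suc k) = (v - inverse v) * weight_E l j * raise_coeff l (Suc j) k"
    unfolding raise_coeff_def by (subst prod.lessThan_Suc_shift) simp
  then show ?case by (simp add: act_uh_mult act_uh_e Suc)
qed (simp add: act_uh_1 raise_coeff_def)

lemma act_uh_F_power: "act_uh l (uh_F ^ i) a j = (if j < i then 0 else a (j - i))"
proof (induction i arbitrary: j)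
  case (Suc i)
  have "act_uh l uh_F b j = (if j = 0 then 0 else b (j - 1))" for b j
    by (simp add: uh_F_def act_uh_to_uh act_gens)
  then show ?case by (auto simp: act_uh_mult Suc)
qed (simp add: act_uh_1)

definition basis_vec :: "nat \<Rightarrow> verma" where
  "basis_vec k = (\<lambda>j. if j = k then 1 else 0)"

lemma act_uh_term:
  "act_uh l (Fdiv i * cartan f * uh_e ^ k) a j = (if j < i then 0 else
     inverse (qfact i) * (exp_eval (1/2) ((l - 2 * of_nat (j - i))/2) f * (raise_coeff l (j - i) k * a (j - i + k))))"
  by (simp add: act_uh_mult Fdiv_def act_uh_scalar act_uh_F_power act_uh_cartan act_uh_e_power)

text \<open>Each of the \<open>k\<close> steps contributes \<open>v - v^-1\<close>, which is \<open>h\<close> times a unit, and a product of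
  quantum numbers that is a unit unless its argument is 0, a case that is excluded for large weight
  \<open>l\<close>.\<close>

lemma raise_coeff_X:
  obtains G where "raise_coeff l j k = fps_X ^ k * G" "l \<ge> of_nat (j + k) \<Longrightarrow> fps_nth G 0 \<noteq> 0"
proof
  let ?s = "fps_shift 1 (v - inverse v)"
  let ?G = "\<Prod>t<k. ?s * weight_E l (j + t)"
  have "v - inverse v = fps_X * ?s"
    by (rule X_times_shift[symmetric]) (simp add: v_nth)
  then have "raise_coeff l j k = (\<Prod>t<k. fps_X * (?s * weight_E l (j + t)))"
    unfolding raise_coeff_def by (metis mult.assoc)
  also have "\<dots> = fps_X ^ k * ?G" by (simp add: prod.distrib)
  finally show "raise_coeff l j k = fps_X ^ k * ?G" .
  assume "l \<ge> of_nat (j + k)"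
  then have "l - of_nat (j + t) \<noteq> 0" if "t < k" for t
  proof -
    have "of_nat (j + t) < (of_nat (j + k) :: rat)" using that by (simp only: of_nat_less_iff)
    then show ?thesis using \<open>l \<ge> of_nat (j + k)\<close> by linarith
  qed
  moreover have "of_nat (j + t) + 1 \<noteq> (0 :: rat)" for t by (metis of_nat_Suc of_nat_eq_0_iff nat.distinct(1) add.commute)
  moreover have "fps_nth ?s 0 = 1" by (simp add: v_nth)
  ultimately have "fps_nth (?s * weight_E l (j + t)) 0 \<noteq> 0" if "t < k" for t
    using that by (simp add: weight_E_def qnum_nth_0 del: of_nat_add)
  moreover have "fps_nth (prod g A) 0 = (\<Prod>t\<in>A. fps_nth (g t) 0)" for g :: "nat \<Rightarrow> rat fps" and A
    by (induction A rule: infinite_finite_induct) simp_all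
  ultimately show "fps_nth ?G 0 \<noteq> 0" by simp
qed

text \<open>The element with a given finite family of PBW coefficients; \<open>pbw_h_power\<close> is a quantitative form
  of the uniqueness of these coefficients.\<close>

definition pbw :: "(nat \<times> nat \<Rightarrow>\<^sub>0 laurent) \<Rightarrow> uh" where
  "pbw D = (\<Sum>p\<in>Poly_Mapping.keys D. Fdiv (fst p) * cartan (Poly_Mapping.lookup D p) * uh_e ^ snd p)"

lemma pbw_superset:
  "finite A \<Longrightarrow> Poly_Mapping.keys D \<subseteq> A \<Longrightarrow>
    pbw D = (\<Sum>p\<in>A. Fdiv (fst p) * cartan (Poly_Mapping.lookup D p) * uh_e ^ snd p)"
  unfolding pbw_def by (rule sum.mono_neutral_left) (auto simp: in_keys_iff cartan_0)

lemma pbw_add: "pbw (D + D') = pbw D + pbw D'"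
proof -
  let ?A = "Poly_Mapping.keys D \<union> Poly_Mapping.keys D'"
  have "finite ?A" "Poly_Mapping.keys (D + D') \<subseteq> ?A" by (auto dest!: keys_add[THEN subsetD])
  then show ?thesis
    by (simp add: pbw_superset[of ?A] lookup_add cartan_add distrib_right distrib_left sum.distrib)
qed

lemma pbw_diff: "pbw (D - D') = pbw D - pbw D'"
  using pbw_add[of "D - D'" D'] by (simp add: algebra_simps)

lemma pbw_single: "pbw (Poly_Mapping.single p f) = Fdiv (fst p) * cartan f * uh_e ^ snd p"
  by (simp add: pbw_def cartan_0)

lemma pbw_filt_imp_pbw:
  assumes "x \<in> pbw_filt n"
  shows "\<exists>D. x = pbw D \<and> (\<forall>i k. Poly_Mapping.lookup D (i, k) \<in> sign_ideal (n - k))"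
  using assms
proof (induction rule: pbw_filt.induct)
  case pbw_filt_0
  then show ?case by (intro exI[of _ 0]) (simp add: pbw_def)
next
  case (pbw_filt_step x f k i)
  then obtain D where D: "x = pbw D" "\<And>i k. Poly_Mapping.lookup D (i, k) \<in> sign_ideal (n - k)" by blast
  have "x + Fdiv i * cartan f * uh_e ^ k = pbw (D + Poly_Mapping.single (i, k) f)"
    by (simp add: D pbw_add pbw_single)
  moreover have "Poly_Mapping.lookup (D + Poly_Mapping.single (i, k) f) (i', k') \<in> sign_ideal (n - k')" for i' k'
    using D(2) pbw_filt_step by (auto simp: lookup_add lookup_single when_def intro!: sign_ideal_add)
  ultimately show ?case by blast
qed

lemma pbw_in_pbw_filt:
  assumes "\<And>i k. Poly_Mapping.lookup D (i, k) \<in> sign_ideal (n - k)"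
  shows "pbw D \<in> pbw_filt n"
proof -
  have "(\<Sum>p\<in>A. Fdiv (fst p) * cartan (Poly_Mapping.lookup D p) * uh_e ^ snd p) \<in> pbw_filt n" for A
  proof (induction A rule: infinite_finite_induct)
    case (insert p A)
    have "Poly_Mapping.lookup D p \<in> sign_ideal (n - snd p)" using assms[of "fst p" "snd p"] by simp
    then show ?case using insert by (simp add: pbw_filt_add pbw_filt_term)
  qed (simp_all add: pbw_filt.pbw_filt_0)
  then show ?thesis by (simp add: pbw_def)
qed

lemma h_power_h_divides:
  assumes "rep_uh x \<in> h_power_Uh m"
  shows "h_divides m (act_uh l x a j)"
proof -
  obtain z where "rep_uh x = to_Uh (fps_X ^ m * z)" using assms by (auto simp: h_power_Uh_eq)
  then have x: "x = to_uh (fps_X ^ m * z)" by (metis rep_to_uh rep_uh_inject)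
  have "fps_X ^ m = scalar (fps_X ^ m)"
    by (induction m) (simp_all add: scalar_1 scalar_mult scalar_X)
  then have "act_uh l x a j = fps_X ^ m * act l z a j"
    by (simp add: x act_uh_to_uh act_mult act_scalar)
  then show ?thesis unfolding h_divides_iff by blast
qed

text \<open>Apply the element to the basis vector \<open>m k\<close> and look at the coordinate of \<open>m i\<close>. The term
  \<open>F^(i) f e^k\<close> contributes the value of \<open>f\<close> at the highest weight times \<open>h^k\<close> and a unit. Terms
  with a higher power of \<open>e\<close> annihilate \<open>m k\<close>, and terms with a lower power \<open>k'\<close> are divisible by
  \<open>h^m\<close> by induction, but applied to the weight \<open>l - 2 (k - k')\<close> of \<open>m (k - k')\<close>. The bound
  \<open>3 k\<close> on the weight is chosen to survive this shift, as
  \<open>3 k - 2 (k - k') \<ge> 3 k'\<close>.\<close>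

lemma pbw_h_power:
  assumes "rep_uh (pbw D) \<in> h_power_Uh m" and "l \<ge> of_nat (3 * k)"
  shows "h_divides m (fps_X ^ k * exp_eval (1/2) (l/2) (Poly_Mapping.lookup D (i, k)))"
  using assms(2)
proof (induction k arbitrary: i l rule: less_induct)
  case (less k)
  let ?T = "\<lambda>p. Fdiv (fst p) * cartan (Poly_Mapping.lookup D p) * uh_e ^ snd p"
  let ?t = "\<lambda>p. act_uh l (?T p) (basis_vec k) i"
  let ?A = "insert (i, k) (Poly_Mapping.keys D)"
  have small: "h_divides m (?t p)" if "p \<noteq> (i, k)" for p
  proof (cases "\<not> i < fst p \<and> i - fst p + snd p = k")
    case True
    define r where "r = i - fst p"
    have k: "k = r + snd p" "snd p < k" using True that by (cases p; auto simp: r_def)+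
    have "of_nat (3 * snd p) \<le> l - 2 * of_nat r" using less.prems k by simp
    from less.IH[OF k(2) this, of "fst p"]
    have IH: "h_divides m (fps_X ^ snd p * exp_eval (1/2) ((l - 2 * of_nat r)/2) (Poly_Mapping.lookup D p))" by simp
    obtain G where G: "raise_coeff l r (snd p) = fps_X ^ snd p * G" using raise_coeff_X by metis
    have "?t p = (inverse (qfact (fst p)) * G) * (fps_X ^ snd p * exp_eval (1/2) ((l - 2 * of_nat r)/2) (Poly_Mapping.lookup D p))"
      unfolding act_uh_term using True G by (simp add: basis_vec_def r_def[symmetric] mult_ac)
    then show ?thesis using h_divides_mult[OF IH] by metis
  next
    case False
    then have "?t p = 0" unfolding act_uh_term by (auto simp: basis_vec_def)
    then show ?thesis by (simp add: h_divides_def)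
  qed
  have "h_divides m (act_uh l (pbw D) (basis_vec k) i)" by (rule h_power_h_divides[OF assms(1)])
  also have "act_uh l (pbw D) (basis_vec k) i = (\<Sum>p\<in>?A. ?t p)"
    by (subst pbw_superset[of ?A]) (auto simp: act_uh_sum)
  also have "\<dots> = ?t (i, k) + (\<Sum>p\<in>?A - {(i, k)}. ?t p)"
    by (subst sum.remove[of _ "(i, k)"]) auto
  finally have "h_divides m (?t (i, k) + (\<Sum>p\<in>?A - {(i, k)}. ?t p))" .
  moreover have "h_divides m (\<Sum>p\<in>?A - {(i, k)}. ?t p)" by (rule h_divides_sum) (use small in auto)
  ultimately have top: "h_divides m (?t (i, k))" using h_divides_diff by fastforce
  have "of_nat (0 + k) \<le> l" using less.prems by (simp add: algebra_simps) 
  then obtain G where G: "raise_coeff l 0 k = fps_X ^ k * G" "fps_nth G 0 \<noteq> 0" using raise_coeff_X by metis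
  have "?t (i, k) = (inverse (qfact i) * G) * (fps_X ^ k * exp_eval (1/2) (l/2) (Poly_Mapping.lookup D (i, k)))"
    unfolding act_uh_term using G(1) by (simp add: basis_vec_def mult_ac)
  with top show ?case
    using h_divides_unit_cancel[of "inverse (qfact i) * G"] G(2) qfact_nth_0 by (simp add: fps_inverse_def)
qed

text \<open>The coefficients of \<open>d\<close> inherit the approximation property from \<open>d\<close>, at the cost of the shift by
  \<open>k\<close> in \<open>pbw_h_power\<close>, so they lie in the closed ideal powers.\<close>

theorem pbw_filt_closed:
  assumes d: "d \<in> pbw_filt 0" and approx: "\<And>m. \<exists>w\<in>pbw_filt n. \<exists>M\<ge>m. rep_uh (d - w) \<in> h_power_Uh M"
  shows "d \<in> pbw_filt n"
proof -
  obtain D where D: "d = pbw D" using pbw_filt_imp_pbw[OF d] by blast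
  have "Poly_Mapping.lookup D (i, k) \<in> sign_ideal (n - k)" for i k
  proof (rule sign_ideal_closed)
    fix m
    obtain w M where w: "w \<in> pbw_filt n" "M \<ge> m + k" "rep_uh (d - w) \<in> h_power_Uh M" using approx by blast
    obtain D' where D': "w = pbw D'" "\<And>i k. Poly_Mapping.lookup D' (i, k) \<in> sign_ideal (n - k)" using pbw_filt_imp_pbw[OF w(1)] by blast
    have "h_divides m (exp_eval (1/2) (l/2) (Poly_Mapping.lookup D (i, k) - Poly_Mapping.lookup D' (i, k)))"
      if "l \<ge> of_nat (3 * k)" for l
    proof -
      have "h_divides M (fps_X ^ k * exp_eval (1/2) (l/2) (Poly_Mapping.lookup (D - D') (i, k)))"
        using w(3) that by (intro pbw_h_power) (simp_all add: D D' pbw_diff)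
      then have "fps_nth (fps_X ^ k * exp_eval (1/2) (l/2) (Poly_Mapping.lookup (D - D') (i, k))) (k + r) = 0" if "r < m" for r
        using w(2) that by (auto simp: h_divides_def)
      then show ?thesis by (simp add: h_divides_def fps_X_power_mult_nth lookup_minus)
    qed
    then show "\<exists>g\<in>sign_ideal (n - k). \<forall>l\<ge>of_nat (3 * k). h_divides m (exp_eval (1/2) (l/2) (Poly_Mapping.lookup D (i, k) - g))"
      using D'(2) by blast
  qed
  then show ?thesis unfolding D by (rule pbw_in_pbw_filt)
qed

section \<open>The powers of \<open>U1\<close> are the steps of the PBW filtration\<close>

definition U1_power :: "nat \<Rightarrow> uh set" where
  "U1_power n = {x. rep_uh x \<in> ideal_power U U1 n}"

lemma U1_power_add: "x \<in> U1_power n \<Longrightarrow> y \<in> U1_power n \<Longrightarrow> x + y \<in> U1_power n"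
proof -
  interpret I: ideal "ideal_power U U1 n" U by (rule U1_powers_ideal)
  show "x \<in> U1_power n \<Longrightarrow> y \<in> U1_power n \<Longrightarrow> x + y \<in> U1_power n"
    using I.a_closed by (simp add: U1_power_def rep_uh_add)
qed

lemma U1_power_zero: "0 \<in> U1_power n"
proof -
  interpret I: ideal "ideal_power U U1 n" U by (rule U1_powers_ideal)
  show ?thesis using I.zero_closed by (simp add: U1_power_def rep_uh_0)
qed

lemma ideal_power_carrier: "ideal_power U U1 n \<subseteq> carrier U"
  using U1_powers_ideal ideal.Icarr by fast

lemma U1_power_uminus: "x \<in> U1_power n \<Longrightarrow> - x \<in> U1_power n"
proof -
  interpret I: ideal "ideal_power U U1 n" U by (rule U1_powers_ideal)
  assume x: "x \<in> U1_power n"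
  then have "rep_uh x \<in> carrier U" using ideal_power_carrier by (auto simp: U1_power_def)
  then show "- x \<in> U1_power n"
    using x I.a_inv_closed by (simp add: U1_power_def rep_uh_uminus)
qed

lemma U1_power_absorb:
  assumes "x \<in> U1_power 0" "y \<in> U1_power n"
  shows "x * y \<in> U1_power n" "y * x \<in> U1_power n"
proof -
  interpret I: ideal "ideal_power U U1 n" U by (rule U1_powers_ideal)
  show "x * y \<in> U1_power n" "y * x \<in> U1_power n"
    using assms I.I_l_closed I.I_r_closed by (simp_all add: U1_power_def rep_uh_mult)
qed

definition U1_elems :: "uh set" where "U1_elems = {x. rep_uh x \<in> U1}"

lemma U1_power_Suc: "x \<in> U1_power n \<Longrightarrow> y \<in> U1_elems \<Longrightarrow> x * y \<in> U1_power (Suc n)"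
  using ideal_prod.prod[of "rep_uh x" "ideal_power U U1 n" "rep_uh y" U1 U]
  by (simp add: U1_power_def U1_elems_def rep_uh_mult)

lemma U1_elems_absorb:
  assumes "x \<in> U1_power 0" "y \<in> U1_elems"
  shows "x * y \<in> U1_elems"
  using assms ideal.I_l_closed[OF U1_ideal] by (simp add: U1_power_def U1_elems_def rep_uh_mult)

lemma U1_elems_diff:
  assumes "x \<in> U1_elems" "y \<in> U1_elems"
  shows "x - y \<in> U1_elems"
proof -
  interpret I: ideal U1 U by (rule U1_ideal)
  have "rep_uh y \<in> carrier U" using assms(2) I.Icarr by (auto simp: U1_elems_def)
  then show ?thesis
    using assms I.a_inv_closed[of "rep_uh y"] I.a_closed by (simp add: U1_elems_def rep_uh_diff a_minus_def)
qed

lemma U1_power_antimono: "m \<le> n \<Longrightarrow> U1_power n \<subseteq> U1_power m"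
proof -
  have "U1_power (Suc n) \<subseteq> U1_power n" for n
    using U.ideal_prod_inter[OF U1_powers_ideal U1_ideal, of n] by (auto simp: U1_power_def)
  then show "m \<le> n \<Longrightarrow> U1_power n \<subseteq> U1_power m" using lift_Suc_antimono_le[of U1_power] by blast
qed

lemma uh_scalar_v_powi: "uh_scalar (v powi m) = cartan (vK m 0)"
proof -
  have "v powi m = fps_exp (of_int m / 2)"
    using v_power[of "nat m"] v_power[of "nat (- m)"] by (auto simp: power_int_def)
  then show ?thesis by (simp add: cartan_vK exp_H_0)
qed

lemma to_uh_scalar_K: "to_uh (scalar (v powi m) * free_K) = cartan (vK m 1)"
  "to_uh (scalar (v powi m) * free_K_inv) = cartan (vK m (- 1))"
proof -
  have "vK m 1 = vK m 0 * vK 0 1" "vK m (- 1) = vK m 0 * vK 0 (- 1)" by (simp_all add: vK_mult)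
  then show "to_uh (scalar (v powi m) * free_K) = cartan (vK m 1)"
    "to_uh (scalar (v powi m) * free_K_inv) = cartan (vK m (- 1))"
    by (simp_all add: cartan_mult to_uh_mult uh_scalar_v_powi[symmetric] uh_scalar_def)
      (simp_all add: cartan_vK uh_scalar_1 exp_H_def free_K_def free_K_inv_def)
qed

lemma cartan_U1_power_0: "cartan f \<in> U1_power 0"
proof (induction f rule: poly_mapping_additive_induct)
  case (single k c)
  obtain a b where k: "k = (a, b)" by (cases k)
  have one: "1 \<in> U1_power 0" using U.one_closed by (simp add: U1_power_def rep_uh_1)
  have K: "cartan (vK 0 1) \<in> U1_power 0" "cartan (vK 0 (- 1)) \<in> U1_power 0"
    using to_uh_scalar_K[of 0] in_U[of "to_Uh free_K"] in_U[of "to_Uh free_K_inv"]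
    by (auto simp: U1_power_def U_gens_def scalar_1 rep_to_uh dest: sym)
  have pow: "x ^ n \<in> U1_power 0" if "x \<in> U1_power 0" for x n
    using that by (induction n) (auto simp: one U1_power_absorb)
  have vKn: "vK 0 d ^ n = vK 0 (int n * d)" for d n
    by (induction n) (simp_all add: vK_0 vK_mult algebra_simps)
  have cpow: "cartan (g ^ n) = cartan g ^ n" for g n
    by (induction n) (simp_all add: cartan_1 cartan_mult)
  have Kb: "cartan (vK 0 b) \<in> U1_power 0"
  proof (cases b rule: int_cases2)
    case (nonneg n)
    then show ?thesis using pow[OF K(1), of n] by (simp add: vKn flip: cpow)
  next
    case (nonpos n)
    then show ?thesis using pow[OF K(2), of n] by (simp add: vKn flip: cpow)
  qed
  have va: "cartan (vK a 0) \<in> U1_power 0"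
    unfolding uh_scalar_v_powi[symmetric] using U_scalar[OF v_powi_laurent, of a]
    by (simp add: U1_power_def uh_scalar_def rep_to_uh)
  have "cartan (vK a b) \<in> U1_power 0"
    using U1_power_absorb(1)[OF va Kb] by (simp add: vK_mult flip: cartan_mult)
  moreover have "of_int c \<in> U1_power 0"
  proof -
    have "of_nat n \<in> U1_power 0" for n by (induction n) (auto simp: U1_power_zero one U1_power_add)
    then show ?thesis by (cases c rule: int_cases2) (auto simp: U1_power_uminus)
  qed
  ultimately show ?case by (simp add: k cartan_single U1_power_absorb)
qed (simp_all add: cartan_0 U1_power_zero cartan_add U1_power_add)

text \<open>The elements \<open>v^m K - v^-m K^-1\<close> for \<open>m = 0\<close> and \<open>m = 1\<close> generate both \<open>v^2 - 1\<close> and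
  \<open>K^2 - 1\<close>, as \<open>v K - v^-1 K^-1 - v^-1 (K - K^-1) = (v - v^-1) K\<close>.\<close>

lemma cartan_sign_ideal_gens: "cartan v2_minus_1 \<in> U1_elems" "cartan K2_minus_1 \<in> U1_elems"
proof -
  have gen: "cartan (vK m 1 - vK (- m) (- 1)) \<in> U1_elems" for m
  proof -
    have "to_Uh (scalar (v powi m) * free_K - scalar (v powi (- m)) * free_K_inv) \<in> U1"
      unfolding U1_def using U.genideal_self[OF U1_gens_U] by (auto simp: U1_gens_def)
    moreover have "cartan (vK m 1 - vK (- m) (- 1)) = to_uh (scalar (v powi m) * free_K - scalar (v powi (- m)) * free_K_inv)"
      by (simp only: to_uh_diff to_uh_scalar_K cartan_diff)
    ultimately show ?thesis by (simp add: U1_elems_def rep_to_uh)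
  qed
  have "v2_minus_1 = vK 1 (- 1) * ((vK 1 1 - vK (- 1) (- 1)) - vK (- 1) 0 * (vK 0 1 - vK (- 0) (- 1)))"
    by (simp add: v2_minus_1_def right_diff_distrib vK_mult vK_0)
  then show "cartan v2_minus_1 \<in> U1_elems"
    by (metis cartan_mult cartan_diff U1_elems_absorb U1_elems_diff gen cartan_U1_power_0)
  have "K2_minus_1 = vK 0 1 * (vK 0 1 - vK (- 0) (- 1))"
    by (simp add: K2_minus_1_def right_diff_distrib vK_mult vK_0)
  then show "cartan K2_minus_1 \<in> U1_elems"
    by (metis cartan_mult U1_elems_absorb gen cartan_U1_power_0)
qed

lemma cartan_sign_ideal_U1_power: "f \<in> sign_ideal n \<Longrightarrow> cartan f \<in> U1_power n"
proof (induction n arbitrary: f)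
  case 0
  then show ?case by (simp add: cartan_U1_power_0)
next
  case (Suc n)
  obtain a b where *: "f = v2_minus_1 * a + K2_minus_1 * b" "a \<in> sign_ideal n" "b \<in> sign_ideal n"
    using Suc.prems by (auto elim!: sign_ideal_SucE)
  have "cartan f = cartan a * cartan v2_minus_1 + cartan b * cartan K2_minus_1"
    by (simp add: * cartan_add mult.commute flip: cartan_mult)
  then show ?case using Suc.IH * cartan_sign_ideal_gens by (simp add: U1_power_Suc U1_power_add)
qed

lemma e_U1_elems: "uh_e \<in> U1_elems"
proof -
  have "to_Uh (scalar (v - inverse v) * free_E) \<in> U1"
    unfolding U1_def using U.genideal_self[OF U1_gens_U] by (auto simp: U1_gens_def)
  then show ?thesis by (simp add: U1_elems_def uh_e_def rep_to_uh)
qed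

lemma Fdiv_to_uh: "Fdiv i = to_uh (scalar (inverse (qfact i)) * free_F ^ i)"
  by (simp add: Fdiv_def uh_scalar_def uh_F_def to_uh_mult to_uh_power)

lemma Fdiv_U1_power_0: "Fdiv i \<in> U1_power 0"
proof (cases "i = 0")
  case True
  then show ?thesis using cartan_U1_power_0[of 1] by (simp add: Fdiv_0 cartan_1)
next
  case False
  then have "to_Uh (scalar (inverse (qfact i)) * free_F ^ i) \<in> U_gens"
    unfolding U_gens_def by (intro imageI UnI2) (auto intro!: exI[of _ i])
  then show ?thesis using in_U by (simp add: U1_power_def Fdiv_to_uh rep_to_uh)
qed

lemma pbw_filt_subset_U1_power: "x \<in> pbw_filt n \<Longrightarrow> x \<in> U1_power n"
proof (induction rule: pbw_filt.induct)
  case (pbw_filt_step x f k i)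
  have "y * uh_e ^ k \<in> U1_power (m + k)" if "y \<in> U1_power m" for y m
  proof (induction k)
    case (Suc k)
    then show ?case by (simp add: power_Suc2 U1_power_Suc e_U1_elems del: power_Suc flip: mult.assoc)
  qed (simp add: that)
  from this[OF cartan_sign_ideal_U1_power[OF pbw_filt_step(2)]] have "cartan f * uh_e ^ k \<in> U1_power n"
    using subsetD[OF U1_power_antimono[of n "n - k + k"]] by simp
  then show ?case using pbw_filt_step U1_power_absorb(1)[OF Fdiv_U1_power_0] by (simp add: U1_power_add mult.assoc)
qed (rule U1_power_zero)

lemma abs_uh_ring:
  assumes "a \<in> carrier Uh" "b \<in> carrier Uh"
  shows "abs_uh (a \<oplus>\<^bsub>Uh\<^esub> b) = abs_uh a + abs_uh b" "abs_uh (a \<otimes>\<^bsub>Uh\<^esub> b) = abs_uh a * abs_uh b"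
  using assms by (simp_all add: plus_uh_def times_uh_def abs_uh_inverse)

lemma abs_uh_uminus: "a \<in> carrier Uh \<Longrightarrow> abs_uh (\<ominus>\<^bsub>Uh\<^esub> a) = - abs_uh a"
  by (simp add: uminus_uh_def abs_uh_inverse)

lemma laurent_v_cartan:
  assumes "a \<in> laurent_v"
  shows "\<exists>g. uh_scalar a = cartan g"
  using assms unfolding laurent_v_def
proof (induction rule: generate_ring.induct)
  case one
  show ?case by (intro exI[of _ 1]) (simp add: ring_of_type_algebra_def uh_scalar_1 cartan_1)
next
  case (incl h)
  then show ?case using uh_scalar_v_powi[of 1] uh_scalar_v_powi[of "- 1"] by (auto simp: power_int_minus)
next
  case (a_inv h)
  then obtain g where g: "uh_scalar h = cartan g" by blast
  interpret R: ring "ring_of_type_algebra :: rat fps ring" by (rule ring_from_type_algebra)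
  have "\<ominus>\<^bsub>ring_of_type_algebra\<^esub> h = - h"
    by (rule R.minus_equality) (simp_all add: ring_of_type_algebra_def)
  then show ?case using g cartan_diff[of 0 g] by (intro exI[of _ "- g"]) (simp add: cartan_0 uh_scalar_uminus)
next
  case (eng_add h1 h2)
  then show ?case by (auto simp: ring_of_type_algebra_def uh_scalar_add simp flip: cartan_add)
next
  case (eng_mult h1 h2)
  then show ?case by (auto simp: ring_of_type_algebra_def uh_scalar_mult simp flip: cartan_mult)
qed

lemma cartan_pbw_filt_0: "cartan f \<in> pbw_filt n" if "f \<in> sign_ideal n"
  using pbw_filt_term[of f n 0 0] that by (simp add: Fdiv_0)

text \<open>For the inclusion of \<open>U1^n\<close> in the filtration it suffices that the generators of \<open>U\<close> and of
  \<open>U1\<close> lie in degrees 0 and 1, since the filtration is multiplicative.\<close>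

lemma carrier_U_pbw_filt:
  assumes "a \<in> carrier U"
  shows "abs_uh a \<in> pbw_filt 0"
proof -
  have "a \<in> generate_ring Uh (to_Uh ` scalar ` laurent_v \<union> U_gens)" using assms by (simp add: U_def)
  then show ?thesis
  proof (induction rule: generate_ring.induct)
    case one
    have "abs_uh \<one>\<^bsub>Uh\<^esub> = cartan 1" by (simp add: cartan_1 one_uh_def)
    then show ?case using cartan_pbw_filt_0[of 1 0] by simp
  next
    case (incl h)
    have "to_uh free_K = cartan (vK 0 1)" "to_uh free_K_inv = cartan (vK 0 (- 1))"
      using to_uh_scalar_K[of 0] by (simp_all add: scalar_1)
    moreover have "uh_e \<in> pbw_filt 0" using pbw_filt_term[of 1 0 1 0] by (simp add: Fdiv_0 cartan_1)
    moreover have "Fdiv i \<in> pbw_filt 0" for i using pbw_filt_term[of 1 0 0 i] by (simp add: cartan_1)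
    moreover have "uh_scalar a \<in> pbw_filt 0" if "a \<in> laurent_v" for a
      using laurent_v_cartan[OF that] cartan_pbw_filt_0[of _ 0] by auto
    ultimately show ?case
      using incl by (auto simp: U_gens_def cartan_pbw_filt_0 Fdiv_to_uh uh_e_def uh_scalar_def simp flip: to_uh_def)
  next
    case (a_inv h)
    then have "h \<in> carrier Uh" using Uh.generate_ring_in_carrier[OF U_gens_subset] by blast
    then show ?case using a_inv by (simp add: abs_uh_uminus pbw_filt_uminus)
  next
    case (eng_add h1 h2)
    then have "h1 \<in> carrier Uh" "h2 \<in> carrier Uh" using Uh.generate_ring_in_carrier[OF U_gens_subset] by blast+
    then show ?case using eng_add by (simp add: abs_uh_ring pbw_filt_add)
  next
    case (eng_mult h1 h2)
    then have "h1 \<in> carrier Uh" "h2 \<in> carrier Uh" using Uh.generate_ring_in_carrier[OF U_gens_subset] by blast+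
    then show ?case using eng_mult pbw_filt_mult[of _ 0 _ 0] by (simp add: abs_uh_ring)
  qed
qed

lemma U1_pbw_filt:
  assumes "a \<in> U1"
  shows "abs_uh a \<in> pbw_filt 1"
proof -
  define J where "J = {a \<in> carrier U. abs_uh a \<in> pbw_filt 1}"
  have cl: "a \<in> carrier Uh" if "a \<in> carrier U" for a using that U_subset by blast
  have "ideal J U"
  proof (rule idealI)
    show "ring U" by (rule U.ring_axioms)
    show "subgroup J (add_monoid U)"
    proof (rule U.add.subgroupI)
      have "abs_uh \<zero>\<^bsub>Uh\<^esub> \<in> pbw_filt 1" using pbw_filt.pbw_filt_0[of 1] by (simp add: zero_uh_def)
      then show "J \<noteq> {}" using U.zero_closed by (auto simp: J_def)
      fix a b assume a: "a \<in> J" and b: "b \<in> J"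
      then have c: "a \<in> carrier U" "b \<in> carrier U" by (auto simp: J_def)
      show "\<ominus>\<^bsub>U\<^esub> a \<in> J" using a U.a_inv_closed[OF c(1)] c cl by (auto simp: J_def abs_uh_uminus pbw_filt_uminus)
      show "a \<oplus>\<^bsub>U\<^esub> b \<in> J" using a b U.a_closed[OF c] c cl by (auto simp: J_def abs_uh_ring pbw_filt_add)
    qed (auto simp: J_def)
    fix a x assume a: "a \<in> J" and x: "x \<in> carrier U"
    then have c: "a \<in> carrier U" by (auto simp: J_def)
    show "x \<otimes>\<^bsub>U\<^esub> a \<in> J"
      using a U.m_closed[OF x c] cl[OF x] cl[OF c] pbw_filt_mult[OF carrier_U_pbw_filt[OF x], of "abs_uh a" 1]
      by (simp add: J_def abs_uh_ring)
    show "a \<otimes>\<^bsub>U\<^esub> x \<in> J"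
      using a U.m_closed[OF c x] cl[OF x] cl[OF c] pbw_filt_mult[of "abs_uh a" 1, OF _ carrier_U_pbw_filt[OF x]]
      by (simp add: J_def abs_uh_ring)
  qed
  moreover have "U1_gens \<subseteq> J"
  proof -
    have "uh_e \<in> pbw_filt 1" using pbw_filt_term[of 1 1 1 0] by (simp add: Fdiv_0 cartan_1)
    moreover have "cartan (vK m 1) - cartan (vK (- m) (- 1)) \<in> pbw_filt 1" for m
    proof -
      have "vK m 1 - vK (- m) (- 1) = vK (- m) (- 1) * (vK (2 * m) (2 * 1) - 1)"
        by (simp add: right_diff_distrib vK_mult)
      then have "vK m 1 - vK (- m) (- 1) \<in> sign_ideal 1" using sign_ideal_mult[OF vK_even_sign_ideal] by metis
      then show ?thesis using cartan_pbw_filt_0 by (metis cartan_diff)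
    qed
    ultimately have "abs_uh a \<in> pbw_filt 1" if "a \<in> U1_gens" for a
      using that by (auto simp: U1_gens_def uh_e_def to_uh_diff to_uh_scalar_K simp flip: to_uh_def)
    then show ?thesis using U1_gens_U by (auto simp: J_def)
  qed
  ultimately have "U1 \<subseteq> J" unfolding U1_def by (rule U.genideal_minimal)
  then show ?thesis using assms by (auto simp: J_def)
qed

lemma ideal_power_pbw_filt: "a \<in> ideal_power U U1 n \<Longrightarrow> abs_uh a \<in> pbw_filt n"
proof (induction n arbitrary: a)
  case 0
  then show ?case by (simp add: carrier_U_pbw_filt)
next
  case (Suc n)
  have carr: "ideal_power U U1 n \<subseteq> carrier Uh" "U1 \<subseteq> carrier Uh" "ideal_prod U (ideal_power U U1 n) U1 \<subseteq> carrier Uh"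
    using ideal_power_carrier[of n] ideal_power_carrier[of "Suc n"] ideal.Icarr[OF U1_ideal] U_subset by auto
  from Suc.prems have "a \<in> ideal_prod U (ideal_power U U1 n) U1" by simp
  then show ?case
  proof (induction rule: ideal_prod.induct)
    case (prod i j)
    then have "i \<in> carrier Uh" "j \<in> carrier Uh" using carr by auto
    then show ?case using pbw_filt_mult[OF Suc.IH[OF prod(1)] U1_pbw_filt[OF prod(2)]] by (simp add: abs_uh_ring)
  next
    case (sum s1 s2)
    then have "s1 \<in> carrier Uh" "s2 \<in> carrier Uh" using carr by auto
    then show ?case using sum by (simp add: abs_uh_ring pbw_filt_add)
  qed
qed

lemma U1_power_eq_pbw_filt: "U1_power n = pbw_filt n"
  using pbw_filt_subset_U1_power ideal_power_pbw_filt[of "rep_uh _" n] by (auto simp: U1_power_def rep_uh_inverse)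

section \<open>Injectivity\<close>

lemma ideal_power_closed:
  assumes "d \<in> carrier U" 
    and "\<And>m. \<exists>w\<in>ideal_power U U1 n. \<exists>M\<ge>m. d \<ominus>\<^bsub>Uh\<^esub> w \<in> h_power_Uh M"
  shows "d \<in> ideal_power U U1 n"
proof -
  have rep_abs: "rep_uh (abs_uh a) = a" if "a \<in> carrier U" for a
    using that U_subset by (intro abs_uh_inverse) blast
  have "abs_uh d \<in> pbw_filt n"
  proof (rule pbw_filt_closed)
    show "abs_uh d \<in> pbw_filt 0" by (rule carrier_U_pbw_filt[OF assms(1)])
    fix m
    obtain w M where w: "w \<in> ideal_power U U1 n" "M \<ge> m" "d \<ominus>\<^bsub>Uh\<^esub> w \<in> h_power_Uh M" using assms(2) by blast
    have "rep_uh (abs_uh d - abs_uh w) = d \<ominus>\<^bsub>Uh\<^esub> w"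
      using assms(1) w(1) ideal_power_carrier by (subst rep_uh_diff, subst (1 2) rep_abs) auto
    then show "\<exists>w\<in>pbw_filt n. \<exists>M\<ge>m. rep_uh (abs_uh d - w) \<in> h_power_Uh M"
      using w ideal_power_pbw_filt by metis
  qed
  then show ?thesis using rep_abs[OF assms(1)] by (simp add: U1_power_eq_pbw_filt[symmetric] U1_power_def)
qed

lemma dotU_decreasing:
  assumes "x \<in> carrier dotU" "n \<le> m"
  shows "x m \<subseteq> x n"
proof -
  have "x (Suc n) \<subseteq> x n" for n
  proof
    fix a assume a: "a \<in> x (Suc n)"
    interpret I: ideal "ideal_power U U1 n" U by (rule U1_powers_ideal)
    obtain u where "u (Suc n) \<in> carrier U" "x (Suc n) = ideal_power U U1 (Suc n) +>\<^bsub>U\<^esub> u (Suc n)"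
      using dotU_rep[OF assms(1)] by metis
    then have "a \<in> carrier U"
      using a ideal_power_carrier[of "Suc n"] U.a_closed by (auto simp: a_r_coset_def' simp del: ideal_power.simps)
    then have "a = \<zero>\<^bsub>U\<^esub> \<oplus>\<^bsub>U\<^esub> a" using U_subset by auto
    then have "a \<in> ideal_power U U1 n <+>\<^bsub>U\<^esub> x (Suc n)"
      using a I.zero_closed unfolding set_add_def' by blast
    then show "a \<in> x n" using assms(1) by (simp add: dotU_def adic_completion_def)
  qed
  then show ?thesis using lift_Suc_antimono_le[of x] assms(2) by blast
qed

text \<open>Let \<open>x\<close> and \<open>y\<close> have the same image, with representatives \<open>a n\<close> and \<open>b n\<close>. Then
  \<open>a M - b M\<close> is in \<open>h^M U\<^sub>h\<close> for all \<open>M\<close>, and for \<open>M \<ge> n\<close> it differs from \<open>a n - b n\<close> by an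
  element of \<open>U1^n\<close>. So closedness applies to \<open>a n - b n\<close>.\<close>

theorem proposition6p8:
  shows "inj_on i_dotU (carrier dotU)"
proof (rule inj_onI, rule ext)
  fix x y n assume x: "x \<in> carrier dotU" and y: "y \<in> carrier dotU" and eq: "i_dotU x = i_dotU y"
  obtain a where a: "\<And>n. a n \<in> carrier U" "\<And>n. x n = ideal_power U U1 n +>\<^bsub>U\<^esub> a n"
    using dotU_rep[OF x] by metis
  obtain b where b: "\<And>n. b n \<in> carrier U" "\<And>n. y n = ideal_power U U1 n +>\<^bsub>U\<^esub> b n"
    using dotU_rep[OF y] by metis
  interpret I: ideal "ideal_power U U1 n" U by (rule U1_powers_ideal)
  have carr: "a m \<in> carrier Uh" "b m \<in> carrier Uh" for m using a b U_subset by auto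
  have h: "a m \<ominus>\<^bsub>Uh\<^esub> b m \<in> h_power_Uh m" for m
  proof -
    have "h_power_Uh m +>\<^bsub>Uh\<^esub> a m = h_power_Uh m +>\<^bsub>Uh\<^esub> b m"
      using i_dotU_coset[OF x, of m] i_dotU_coset[OF y, of m] a b eq by (simp add: coset_absorb)
    then show ?thesis using carr hcong_iff[of "a m" "b m" m] by (simp add: hcong_def)
  qed
  have step: "c n \<ominus>\<^bsub>U\<^esub> c m \<in> ideal_power U U1 n"
    if "n \<le> m" "z \<in> carrier dotU" "\<And>n. c n \<in> carrier U" "\<And>n. z n = ideal_power U U1 n +>\<^bsub>U\<^esub> c n" for c z m
  proof -
    interpret I': ideal "ideal_power U U1 m" U by (rule U1_powers_ideal)
    have "c m \<in> z n" using dotU_decreasing[OF that(2,1)] I'.a_rcos_self[OF that(3)] that(4) by auto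
    then have "ideal_power U U1 n +>\<^bsub>U\<^esub> c n = ideal_power U U1 n +>\<^bsub>U\<^esub> c m"
      using U.a_repr_independence[of "c m" "ideal_power U U1 n" "c n"] that I.a_subgroup by simp
    then show ?thesis using U.quotient_eq_iff_same_a_r_cos[OF U1_powers_ideal that(3) that(3)] by blast
  qed
  have "a n \<ominus>\<^bsub>U\<^esub> b n \<in> ideal_power U U1 n"
  proof (rule ideal_power_closed)
    show "a n \<ominus>\<^bsub>U\<^esub> b n \<in> carrier U" using a b by (intro U.minus_closed)
    fix m
    define M where "M = max m n"
    define w where "w = (a n \<ominus>\<^bsub>U\<^esub> a M) \<ominus>\<^bsub>U\<^esub> (b n \<ominus>\<^bsub>U\<^esub> b M)"
    have "a n \<ominus>\<^bsub>U\<^esub> a M \<in> ideal_power U U1 n" "b n \<ominus>\<^bsub>U\<^esub> b M \<in> ideal_power U U1 n"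
      using step[OF _ x a, of M] step[OF _ y b, of M] by (auto simp: M_def)
    then have "w \<in> ideal_power U U1 n" 
      unfolding w_def by (subst a_minus_def) (intro I.a_closed I.a_inv_closed)
    moreover have "(a n \<ominus>\<^bsub>U\<^esub> b n) \<ominus>\<^bsub>Uh\<^esub> w = a M \<ominus>\<^bsub>Uh\<^esub> b M"
    proof -
      have "(rep_uh (p - q) \<ominus>\<^bsub>Uh\<^esub> rep_uh ((p - r) - (q - s))) = rep_uh (r - s)" for p q r s
        unfolding rep_uh_diff[symmetric] by simp
      from this[of "abs_uh (a n)" "abs_uh (b n)" "abs_uh (a M)" "abs_uh (b M)"] show ?thesis
        using carr a b U.minus_closed[OF b(1) b(1), of n M]
        by (simp add: w_def rep_uh_diff abs_uh_inverse U.minus_closed)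
    qed
    ultimately show "\<exists>w\<in>ideal_power U U1 n. \<exists>M\<ge>m. (a n \<ominus>\<^bsub>U\<^esub> b n) \<ominus>\<^bsub>Uh\<^esub> w \<in> h_power_Uh M"
      using h[of M] by (metis M_def max.cobounded1)
  qed
  then show "x n = y n"
    using U.quotient_eq_iff_same_a_r_cos[OF U1_powers_ideal a(1) b(1)] a(2) b(2) by simp
qed

end
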